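(* Let $G$ be a compact Hausdorff group, let $A$ be a separable complex Hilbert space, let $s\ge 0$ and let $\gamma:\widehat{G}\to(0,\infty)$ be a measurable function. Let $f\in\mathfrak{B}^s_\gamma(G,A)$ and set $M=\|f\|_{\mathfrak{B}^s_\gamma}$. Then for every $n\in\mathbb{N}=\{1,2,\dots\}$ there exist indices $(\sigma_\ell,i_\ell,j_\ell)_{\ell=1}^n$ with $\sigma_\ell\in\widehat{G}$ and $i_\ell,j_\ell\in\{1,\dots,d_{\sigma_\ell}\}$ (with possible repetitions) and unit vectors $e_1,\dots,e_n\in A$ such that the function $$f_n(x):=\frac{M}{n}\sum_{\ell=1}^n(1+\gamma(\sigma_\ell)^2)^{-s/2}\,u^{\sigma_\ell}_{i_\ell j_\ell}(x)\,e_\ell,\qquad x\in G,$$ satisfies $$\|f-f_n\|_{L^2(G,A)}\le\frac{M}{\sqrt{n}}.$$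
   Context: $G$ is a compact Hausdorff group with normalized Haar measure $dx$. $\widehat{G}$ is the set of unitary equivalence classes of continuous irreducible unitary representations of $G$; for each class a representative, again denoted $\sigma$, is fixed, acting on a Hilbert space $H_\sigma$ of finite dimension $d_\sigma$, together with an orthonormal basis $\{\xi_1^\sigma,\dots,\xi_{d_\sigma}^\sigma\}$ of $H_\sigma$. Matrix coefficients: $u_{ij}^\sigma(x)=\langle\sigma(x)\xi_j^\sigma,\xi_i^\sigma\rangle_{H_\sigma}$. For a complex Banach space $A$, $L^p(G,A)$ ($1\le p<\infty$) is the Bochner space with norm $\|f\|_{L^p}=(\int_G\|f(x)\|_A^p\,dx)^{1/p}$. For $f\in L^1(G,A)$ (in particular $f\in L^2(G,A)$) and $\sigma\in\widehat{G}$, the Fourier coefficient $\widehat f(\sigma)$ is the sesquilinear map $H_\sigma\times H_\sigma\to A$ given by $$\widehat f(\sigma)(\xi,\eta)=\int_G\langle\sigma(x)^*\xi,\eta\rangle_{H_\sigma}f(x)\,dx.$$ For $s\ge0$ and $\gamma:\widehat G\to(0,\infty)$, the spectral Barron space $\mathfrak{B}^s_\gamma(G,A)$ is the set of all $f\in L^2(G,A)$ for which $$\|f\|_{\mathfrak{B}^s_\gamma}:=\sum_{\sigma\in\widehat G}d_\sigma(1+\gamma(\sigma)^2)^{s/2}\sum_{i=1}^{d_\sigma}\sum_{j=1}^{d_\sigma}\|\widehat f(\sigma)(\xi_j^\sigma,\xi_i^\sigma)\|_A<\infty.$$ *)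

theory Defs
  imports "HOL-Analysis.Analysis" "Jordan_Normal_Form.Schur_Decomposition"
    "Jordan_Normal_Form.VS_Connect"
begin

(* Complex Hilbert spaces; completeness comes from the superclass banach. The inner product is
   linear in its first argument. *)
class complex_hilbert = banach +
  fixes scaleC :: "complex \<Rightarrow> 'a \<Rightarrow> 'a"  (infixr "*\<^sub>C" 75)
    and cinner :: "'a \<Rightarrow> 'a \<Rightarrow> complex"
  assumes scaleC_add_right: "c *\<^sub>C (x + y) = c *\<^sub>C x + c *\<^sub>C y"
    and scaleC_add_left: "(b + c) *\<^sub>C x = b *\<^sub>C x + c *\<^sub>C x"
    and scaleC_scaleC: "b *\<^sub>C (c *\<^sub>C x) = (b * c) *\<^sub>C x"
    and scaleR_scaleC: "r *\<^sub>R x = complex_of_real r *\<^sub>C x"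
    and cinner_commute: "cinner x y = cnj (cinner y x)"
    and cinner_add_left: "cinner (x + y) z = cinner x z + cinner y z"
    and cinner_scaleC_left: "cinner (c *\<^sub>C x) y = c * cinner x y"
    and cinner_self: "cinner x x = complex_of_real ((norm x)\<^sup>2)"

(* The group G is a type of class topological_group_add. This class does not assume
   commutativity: x + y is the group product, 0 the identity, - x the inverse. *)

definition radon_measure :: "'g::topological_space measure \<Rightarrow> bool" where
  "radon_measure \<mu> \<longleftrightarrow>
     sets \<mu> = sets borel \<and>
     (\<forall>K. compact K \<longrightarrow> emeasure \<mu> K < \<infinity>) \<and>
     (\<forall>B\<in>sets borel. emeasure \<mu> B = (INF U\<in>{U. open U \<and> B \<subseteq> U}. emeasure \<mu> U)) \<and>
     (\<forall>U. open U \<longrightarrow> emeasure \<mu> U = (SUP K\<in>{K. compact K \<and> K \<subseteq> U}. emeasure \<mu> K))"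

definition normalized_haar_measure :: "'g::topological_group_add measure \<Rightarrow> bool" where
  "normalized_haar_measure \<mu> \<longleftrightarrow>
     radon_measure \<mu> \<and>
     (\<forall>a. \<forall>B\<in>sets borel. emeasure \<mu> ((\<lambda>x. a + x) ` B) = emeasure \<mu> B) \<and>
     emeasure \<mu> UNIV = 1"

definition unitary_mat :: "nat \<Rightarrow> complex Matrix.mat \<Rightarrow> bool" where
  "unitary_mat d U \<longleftrightarrow>
     U \<in> carrier_mat d d \<and> mat_adjoint U * U = 1\<^sub>m d \<and> U * mat_adjoint U = 1\<^sub>m d"

(* Unitary representations of dimension d are taken on the Hilbert space C^d, rendered as
   carrier_vec d with the inner product \<bullet>c (linear in its first argument); operators on it
   are d x d matrices. Every d-dimensional Hilbert space is unitarily isomorphic to C^d; no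
   preferred basis enters, since orthonormal bases are chosen separately below. *)
type_synonym 'g matrep = "'g \<Rightarrow> complex Matrix.mat"

definition unitary_rep :: "nat \<Rightarrow> 'g::topological_group_add matrep \<Rightarrow> bool" where
  "unitary_rep d \<pi> \<longleftrightarrow>
     (\<forall>x. unitary_mat d (\<pi> x)) \<and>
     \<pi> 0 = 1\<^sub>m d \<and>
     (\<forall>x y. \<pi> (x + y) = \<pi> x * \<pi> y) \<and>
     (\<forall>i<d. \<forall>j<d. continuous_on UNIV (\<lambda>x. \<pi> x $$ (i, j)))"

definition irreducible_rep :: "nat \<Rightarrow> 'g::topological_group_add matrep \<Rightarrow> bool" where
  "irreducible_rep d \<pi> \<longleftrightarrow>
     unitary_rep d \<pi> \<and> d > 0 \<and>
     (\<forall>W. VectorSpace.subspace class_ring W (module_vec TYPE(complex) d) \<longrightarrow>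
          (\<forall>x. \<forall>w\<in>W. \<pi> x *\<^sub>v w \<in> W) \<longrightarrow>
          W = {0\<^sub>v d} \<or> W = carrier_vec d)"

definition irreps :: "'g::topological_group_add matrep set" where
  "irreps = {\<pi>. \<exists>d. irreducible_rep d \<pi>}"

definition rep_dim :: "'g::topological_group_add matrep \<Rightarrow> nat" where
  "rep_dim \<pi> = dim_row (\<pi> 0)"

definition unitary_equiv :: "('g::topological_group_add matrep \<times> 'g matrep) set" where
  "unitary_equiv =
     {(\<pi>, \<rho>). \<pi> \<in> irreps \<and> \<rho> \<in> irreps \<and> rep_dim \<pi> = rep_dim \<rho> \<and>
        (\<exists>U. unitary_mat (rep_dim \<pi>) U \<and> (\<forall>x. U * \<pi> x = \<rho> x * U))}"

definition unitary_dual :: "'g::topological_group_add matrep set set" where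
  "unitary_dual = irreps // unitary_equiv"

definition orthonormal_basis :: "nat \<Rightarrow> (nat \<Rightarrow> complex Matrix.vec) \<Rightarrow> bool" where
  "orthonormal_basis d b \<longleftrightarrow>
     (\<forall>i\<in>{1..d}. b i \<in> carrier_vec d) \<and>
     (\<forall>i\<in>{1..d}. \<forall>j\<in>{1..d}. b i \<bullet>c b j = (if i = j then 1 else 0)) \<and>
     vectorspace.basis class_ring (module_vec TYPE(complex) d) (b ` {1..d})"

(* The fixed choices: a representative rp \<sigma> of every class \<sigma>, and an orthonormal basis
   \<xi> \<sigma> 1, ..., \<xi> \<sigma> d of its space. *)
definition dual_choice ::
  "('g::topological_group_add matrep set \<Rightarrow> 'g matrep) \<Rightarrow>
   ('g matrep set \<Rightarrow> nat \<Rightarrow> complex Matrix.vec) \<Rightarrow> bool" where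
  "dual_choice rp \<xi> \<longleftrightarrow>
     (\<forall>\<sigma>\<in>unitary_dual. rp \<sigma> \<in> \<sigma> \<and> orthonormal_basis (rep_dim (rp \<sigma>)) (\<xi> \<sigma>))"

definition matrix_coeff ::
  "'g matrep \<Rightarrow> (nat \<Rightarrow> complex Matrix.vec) \<Rightarrow> nat \<Rightarrow> nat \<Rightarrow> 'g \<Rightarrow> complex" where
  "matrix_coeff \<pi> b i j x = (\<pi> x *\<^sub>v b j) \<bullet>c b i"

(* For second-countable (i.e. separable) targets, Borel measurability is the strong
   measurability of Bochner spaces. *)
definition Lp_space ::
  "real \<Rightarrow> 'g measure \<Rightarrow> ('g \<Rightarrow> 'a::{banach,second_countable_topology}) set" where
  "Lp_space p \<mu> = {f \<in> borel_measurable \<mu>. integrable \<mu> (\<lambda>x. norm (f x) powr p)}"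

definition Lp_norm ::
  "real \<Rightarrow> 'g measure \<Rightarrow> ('g \<Rightarrow> 'a::{banach,second_countable_topology}) \<Rightarrow> real" where
  "Lp_norm p \<mu> f = (\<integral>x. norm (f x) powr p \<partial>\<mu>) powr (1 / p)"

definition fourier_coeff ::
  "'g measure \<Rightarrow> ('g \<Rightarrow> 'a::{complex_hilbert,second_countable_topology}) \<Rightarrow> 'g matrep \<Rightarrow>
   complex Matrix.vec \<Rightarrow> complex Matrix.vec \<Rightarrow> 'a" where
  "fourier_coeff \<mu> f \<pi> v w = (\<integral>x. ((mat_adjoint (\<pi> x) *\<^sub>v v) \<bullet>c w) *\<^sub>C f x \<partial>\<mu>)"

definition barron_term ::
  "'g::topological_group_add measure \<Rightarrow> ('g matrep set \<Rightarrow> 'g matrep) \<Rightarrow>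
   ('g matrep set \<Rightarrow> nat \<Rightarrow> complex Matrix.vec) \<Rightarrow> ('g matrep set \<Rightarrow> real) \<Rightarrow> real \<Rightarrow>
   ('g \<Rightarrow> 'a::{complex_hilbert,second_countable_topology}) \<Rightarrow> 'g matrep set \<Rightarrow> real" where
  "barron_term \<mu> rp \<xi> \<gamma> s f \<sigma> =
     real (rep_dim (rp \<sigma>)) * (1 + (\<gamma> \<sigma>)\<^sup>2) powr (s / 2) *
     (\<Sum>i=1..rep_dim (rp \<sigma>). \<Sum>j=1..rep_dim (rp \<sigma>).
        norm (fourier_coeff \<mu> f (rp \<sigma>) (\<xi> \<sigma> j) (\<xi> \<sigma> i)))"

definition barron_space ::
  "'g::topological_group_add measure \<Rightarrow> ('g matrep set \<Rightarrow> 'g matrep) \<Rightarrow>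
   ('g matrep set \<Rightarrow> nat \<Rightarrow> complex Matrix.vec) \<Rightarrow> ('g matrep set \<Rightarrow> real) \<Rightarrow> real \<Rightarrow>
   ('g \<Rightarrow> 'a::{complex_hilbert,second_countable_topology}) set" where
  "barron_space \<mu> rp \<xi> \<gamma> s =
     {f \<in> Lp_space 2 \<mu>. barron_term \<mu> rp \<xi> \<gamma> s f summable_on unitary_dual}"

definition barron_norm ::
  "'g::topological_group_add measure \<Rightarrow> ('g matrep set \<Rightarrow> 'g matrep) \<Rightarrow>
   ('g matrep set \<Rightarrow> nat \<Rightarrow> complex Matrix.vec) \<Rightarrow> ('g matrep set \<Rightarrow> real) \<Rightarrow> real \<Rightarrow>
   ('g \<Rightarrow> 'a::{complex_hilbert,second_countable_topology}) \<Rightarrow> real" where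
  "barron_norm \<mu> rp \<xi> \<gamma> s f = (\<Sum>\<^sub>\<infinity>\<sigma>\<in>unitary_dual. barron_term \<mu> rp \<xi> \<gamma> s f \<sigma>)"

end

theory Submission
  imports Defs "Jordan_Normal_Form.Spectral_Radius"
begin

text \<open>Schur orthogonality and the Peter--Weyl theorem give \<open>f = \<Sum> d\<^sub>\<sigma> c\<^sub>i\<^sub>j u\<^sub>i\<^sub>j\<close>, with an absolutely
  convergent series. Grouping the factors as \<open>d\<^sub>\<sigma> w\<^sub>\<sigma> \<parallel>c\<^sub>i\<^sub>j\<parallel>\<close> and \<open>w\<^sub>\<sigma>\<^sup>-\<^sup>1 u\<^sub>i\<^sub>j c\<^sub>i\<^sub>j / \<parallel>c\<^sub>i\<^sub>j\<parallel>\<close>, where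
  \<open>w\<^sub>\<sigma> = (1 + \<gamma>(\<sigma>)\<^sup>2)\<^bsup>s/2\<^esup>\<close>, exhibits \<open>f\<close> as \<open>M\<close> times a convex combination of functions of
  \<open>L\<^sup>2\<close>-norm at most 1, and Maurey's argument in a Hilbert space yields the rate \<open>M / \<surd>n\<close>.
  For the Peter--Weyl theorem, a nonzero function orthogonal to all irreducible coefficients
  produces a self-adjoint continuous \<open>\<theta>\<close> with the same property; its rescaled convolution powers
  converge uniformly to an idempotent kernel \<open>p\<close>. The left invariant space of functions
  \<open>f = f * p\<close> is finite-dimensional, and a minimal invariant subspace of it consists of
  coefficients of an irreducible representation, a contradiction.\<close>

section \<open>Integration against Haar measure\<close>

text \<open>\<open>G\<close> carries no countability assumption, and this shapes the analysis.
  Integrals are interchanged only for continuous kernels, and the scalar harmonic analysis takes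
  place among continuous functions, where a vanishing norm forces vanishing at every point and
  limits are uniform; a square-integrable function enters by being convolved with a continuous one.
  The dual may be uncountable, so the Fourier series is a limit along finite subsets, and
  measurability of its sum needs a sequence extracted from them. In place of spectral theory for the
  operator of convolution by \<theta>, its top eigenprojection is reached by power iteration: a
  single finite-dimensional piece on which the operator is nonzero already yields the contradiction.
  Separability of \<open>A\<close> reduces vector-valued completeness to the scalar case. The
  probability measure on the atoms is never built; only the consequence is used that some atom does
  at least as well as the average. Normalizing by \<open>M\<close> fails for \<open>M = 0\<close>,
  so that case is separate, and it is the one place where a unit vector and a nonempty dual must be
  supplied from outside.\<close>

locale haar_compact =
  fixes \<mu> :: "'g::{topological_group_add,t2_space} measure"
  assumes compact_UNIV: "compact (UNIV :: 'g set)"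
    and haar: "normalized_haar_measure \<mu>"
begin

lemma sets_haar [measurable_cong, simp]: "sets \<mu> = sets borel"
  using haar by (auto simp: normalized_haar_measure_def radon_measure_def)

lemma space_haar [simp]: "space \<mu> = UNIV"
  using sets_eq_imp_space_eq[OF sets_haar] by simp

lemma emeasure_UNIV [simp]: "emeasure \<mu> UNIV = 1"
  using haar by (auto simp: normalized_haar_measure_def)

sublocale finite_measure \<mu>
  by (rule finite_measureI) simp

lemma measure_UNIV [simp]: "measure \<mu> UNIV = 1"
  by (simp add: measure_def)

lemma continuous_borel_measurable:
  fixes f :: "'g \<Rightarrow> 'b::topological_space"
  assumes "continuous_on UNIV f"
  shows "f \<in> borel_measurable \<mu>"
  by (subst measurable_cong_sets[OF sets_haar refl])
     (rule borel_measurable_continuous_onI[OF assms])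

lemma continuous_bounded:
  fixes f :: "'g \<Rightarrow> 'b::real_normed_vector"
  assumes "continuous_on UNIV f"
  obtains B where "B > 0" "\<And>x. norm (f x) \<le> B"
proof -
  have "bounded (f ` UNIV)"
    using compact_continuous_image[OF assms compact_UNIV] by (rule compact_imp_bounded)
  then show ?thesis using that unfolding bounded_pos by blast
qed

lemma integrable_mult_continuous:
  fixes h :: "'g \<Rightarrow> complex"
  assumes "integrable \<mu> h" "continuous_on UNIV f"
  shows "integrable \<mu> (\<lambda>x. h x * f x)"
proof -
  obtain B where B: "\<And>x. norm (f x) \<le> B" using continuous_bounded[OF assms(2)] by blast
  show ?thesis
  proof (rule Bochner_Integration.integrable_bound)
    show "integrable \<mu> (\<lambda>x. B * norm (h x))" using assms(1) by simp
    show "(\<lambda>x. h x * f x) \<in> borel_measurable \<mu>"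
      using assms(1) continuous_borel_measurable[OF assms(2)] by simp
    have "norm (h x * f x) \<le> norm (B * norm (h x))" for x
      using B[of x] mult_right_mono[OF order.trans[OF B[of x] abs_ge_self], of "norm (h x)"]
      by (simp add: norm_mult mult.commute abs_mult)
    then show "AE x in \<mu>. norm (h x * f x) \<le> norm (B * norm (h x))" by simp
  qed
qed

lemma integrable_continuous:
  fixes f :: "'g \<Rightarrow> 'b::{banach,second_countable_topology}"
  assumes "continuous_on UNIV f"
  shows "integrable \<mu> f"
proof -
  obtain B where B: "\<And>x. norm (f x) \<le> B" using continuous_bounded[OF assms] by blast
  then show ?thesis
    by (intro integrable_const_bound[of _ B] continuous_borel_measurable assms) auto
qed

lemma norm_integral_bound:
  fixes f :: "'g \<Rightarrow> 'b::{banach,second_countable_topology}"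
  assumes "\<And>x. norm (f x) \<le> B"
  shows "norm (\<integral>x. f x \<partial>\<mu>) \<le> B"
proof -
  have "B \<ge> 0" using assms[of undefined] norm_ge_zero order.trans by blast
  show ?thesis
  proof (cases "integrable \<mu> f")
    case True
    have "norm (\<integral>x. f x \<partial>\<mu>) \<le> (\<integral>x. norm (f x) \<partial>\<mu>)" by simp
    also have "\<dots> \<le> (\<integral>x. B \<partial>\<mu>)"
      using True assms by (intro integral_mono) auto
    finally show ?thesis by simp
  next
    case False
    \<comment> \<open>A non-integrable function has integral 0 by convention, so the bound reduces
      to \<open>B \<ge> 0\<close>.\<close>
    then show ?thesis using \<open>B \<ge> 0\<close> by (simp add: not_integrable_integral_eq)
  qed
qed

section \<open>Left invariance of the Haar integral\<close>

lemma continuous_translate: "continuous_on UNIV (\<lambda>x::'g. a + x)"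
  by (intro continuous_intros)

lemma distr_translate: "distr \<mu> \<mu> (\<lambda>x. a + x) = \<mu>"
proof (rule measure_eqI)
  fix B assume "B \<in> sets (distr \<mu> \<mu> (\<lambda>x. a + x))"
  then have B: "B \<in> sets borel" by simp
  have m: "(\<lambda>x. a + x) \<in> measurable \<mu> \<mu>"
    using continuous_borel_measurable[OF continuous_translate]
    by (subst measurable_cong_sets[OF refl sets_haar])
  have "(\<lambda>x. a + x) -` B = (\<lambda>x. - a + x) ` B"
    by (auto simp: image_iff) (metis add.assoc add_0 left_minus)
  then show "emeasure (distr \<mu> \<mu> (\<lambda>x. a + x)) B = emeasure \<mu> B"
    using haar B by (simp add: emeasure_distr[OF m] normalized_haar_measure_def)
qed simp

lemma integral_translate:
  fixes f :: "'g \<Rightarrow> 'b::{banach,second_countable_topology}"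
  assumes "f \<in> borel_measurable \<mu>"
  shows "(\<integral>x. f (a + x) \<partial>\<mu>) = (\<integral>x. f x \<partial>\<mu>)"
proof -
  have m: "(\<lambda>x. a + x) \<in> measurable \<mu> \<mu>"
    using continuous_borel_measurable[OF continuous_translate]
    by (subst measurable_cong_sets[OF refl sets_haar])
  show ?thesis using integral_distr[OF m assms] by (simp add: distr_translate)
qed

lemma integral_translate_cont:
  fixes f :: "'g \<Rightarrow> 'b::{banach,second_countable_topology}"
  assumes "continuous_on UNIV f"
  shows "(\<integral>x. f (a + x) \<partial>\<mu>) = (\<integral>x. f x \<partial>\<mu>)"
  by (rule integral_translate[OF continuous_borel_measurable[OF assms]])

text \<open>Compactness of the second factor (the tube lemma) makes one neighbourhood of
  \<open>x0\<close> serve all \<open>y\<close>; it stands in for uniform continuity with respect to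
  a metric.\<close>

lemma kernel_nbhd:
  fixes K :: "'g \<Rightarrow> 'g \<Rightarrow> complex"
  assumes "continuous_on UNIV (\<lambda>(x, y). K x y)" "e > 0"
  obtains U where "open U" "x0 \<in> U" "\<And>x y. x \<in> U \<Longrightarrow> norm (K x y - K x0 y) \<le> e"
proof -
  have c: "continuous_on (UNIV \<times> UNIV) (\<lambda>(x, y). K x y)" using assms(1) by simp
  show ?thesis
    by (rule continuous_on_prod_compactE[OF c compact_UNIV UNIV_I \<open>e > 0\<close>, of x0])
       (use that in \<open>auto simp: dist_norm\<close>)
qed

lemma kernel_continuous_right:
  fixes K :: "'g \<Rightarrow> 'g \<Rightarrow> complex"
  assumes "continuous_on UNIV (\<lambda>(x, y). K x y)"
  shows "continuous_on UNIV (K x)"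
  using continuous_on_compose2[OF assms, of UNIV "\<lambda>y. (x, y)"]
  by (simp add: continuous_on_Pair)

lemma kernel_continuous_left:
  fixes K :: "'g \<Rightarrow> 'g \<Rightarrow> complex"
  assumes "continuous_on UNIV (\<lambda>(x, y). K x y)"
  shows "continuous_on UNIV (\<lambda>x. K x y)"
  using continuous_on_compose2[OF assms, of UNIV "\<lambda>x. (x, y)"]
  by (simp add: continuous_on_Pair)

lemma norm_integral_diff_le:
  fixes h :: "'g \<Rightarrow> complex"
  assumes h: "integrable \<mu> h" and f: "integrable \<mu> (\<lambda>y. h y * f y)" and g: "integrable \<mu> (\<lambda>y. h y * g y)"
    and le: "\<And>y. norm (f y - g y) \<le> e"
  shows "norm ((\<integral>y. h y * f y \<partial>\<mu>) - (\<integral>y. h y * g y \<partial>\<mu>)) \<le> (\<integral>y. norm (h y) \<partial>\<mu>) * e"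
proof -
  have "(\<integral>y. h y * f y \<partial>\<mu>) - (\<integral>y. h y * g y \<partial>\<mu>) = (\<integral>y. h y * f y - h y * g y \<partial>\<mu>)"
    using f g by simp
  also have "norm \<dots> \<le> (\<integral>y. norm (h y * f y - h y * g y) \<partial>\<mu>)" by simp
  also have "\<dots> \<le> (\<integral>y. norm (h y) * e \<partial>\<mu>)"
    using h integrable_norm[OF Bochner_Integration.integrable_diff[OF f g]] le
    by (intro integral_mono) (auto simp: norm_mult simp flip: right_diff_distrib intro!: mult_left_mono)
  finally show ?thesis by simp
qed

lemma continuous_kernel_integral:
  fixes K :: "'g \<Rightarrow> 'g \<Rightarrow> complex"
  assumes K: "continuous_on UNIV (\<lambda>(x, y). K x y)" and h: "integrable \<mu> h"
  shows "continuous_on UNIV (\<lambda>x. \<integral>y. h y * K x y \<partial>\<mu>)"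
proof (rule continuous_at_imp_continuous_on, rule ballI, unfold isCont_def tendsto_iff, intro allI impI)
  fix x0 and e :: real assume e: "e > 0"
  define c where "c = (\<integral>y. norm (h y) \<partial>\<mu>)"
  have c: "c \<ge> 0" by (simp add: c_def)
  \<comment> \<open>\<open>c\<close> may be 0, whence the \<open>+ 1\<close>.\<close>
  define e' where "e' = e / (c + 1)"
  have e': "e' > 0" "c * e' < e" using e c by (auto simp: e'_def field_simps)
  obtain U where U: "open U" "x0 \<in> U" "\<And>x y. x \<in> U \<Longrightarrow> norm (K x y - K x0 y) \<le> e'"
    using kernel_nbhd[OF K e'(1)] by blast
  have "dist (\<integral>y. h y * K x y \<partial>\<mu>) (\<integral>y. h y * K x0 y \<partial>\<mu>) < e" if "x \<in> U" for x
  proof -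
    have "dist (\<integral>y. h y * K x y \<partial>\<mu>) (\<integral>y. h y * K x0 y \<partial>\<mu>) \<le> c * e'"
      unfolding dist_norm c_def using U(3)[OF that]
      by (intro norm_integral_diff_le h integrable_mult_continuous kernel_continuous_right K)
    then show ?thesis using e' by simp
  qed
  then show "\<forall>\<^sub>F x in at x0. dist (\<integral>y. h y * K x y \<partial>\<mu>) (\<integral>y. h y * K x0 y \<partial>\<mu>) < e"
    using U(1,2) unfolding eventually_at_topological by blast
qed

text \<open>Finitely many neighbourhoods from \<open>kernel_nbhd\<close> cover the group, and
  \<open>r x\<close> is the centre of the first one containing \<open>x\<close>. Taking the first
  makes the pieces disjoint differences of open sets, hence Borel.\<close>

lemma finite_range_approx:
  fixes K :: "'g \<Rightarrow> 'g \<Rightarrow> complex"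
  assumes K: "continuous_on UNIV (\<lambda>(x, y). K x y)" and e: "e > 0"
  obtains r where "finite (range r)" "\<And>v. r -` {v} \<in> sets borel"
    "\<And>x y. norm (K x y - K (r x) y) \<le> e"
proof -
  have "\<exists>U. open U \<and> x0 \<in> U \<and> (\<forall>x\<in>U. \<forall>y. norm (K x y - K x0 y) \<le> e)" for x0
    by (rule kernel_nbhd[OF K e, of x0]) blast
  then obtain U where U: "\<And>x0. open (U x0)" "\<And>x0. x0 \<in> U x0"
    "\<And>x0 x y. x \<in> U x0 \<Longrightarrow> norm (K x y - K x0 y) \<le> e" by metis
  obtain F where F: "finite F" "UNIV \<subseteq> (\<Union>x\<in>F. U x)"
    by (rule compactE_image[OF compact_UNIV, of UNIV U]) (use U in blast)+
  obtain xs where xs: "set xs = F" using finite_list[OF F(1)] by blast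
  define n where "n x = (LEAST i. i < length xs \<and> x \<in> U (xs ! i))" for x
  have ex: "\<exists>i. i < length xs \<and> x \<in> U (xs ! i)" for x
    using F(2) xs by (metis UN_E UNIV_I in_set_conv_nth subsetD)
  have n: "n x < length xs \<and> x \<in> U (xs ! n x)" for x
    unfolding n_def by (rule LeastI_ex[OF ex])
  define r where "r x = xs ! n x" for x
  have "finite (range r)"
    by (rule finite_subset[of _ F]) (use n xs F in \<open>auto simp: r_def\<close>)
  moreover have "r -` {v} \<in> sets borel" for v
  proof -
    have eqn: "{x. n x = i} = (if i < length xs then U (xs ! i) - (\<Union>k<i. U (xs ! k)) else {})" for i
    proof (cases "i < length xs")
      case True
      have "n x = i \<longleftrightarrow> x \<in> U (xs ! i) \<and> (\<forall>k<i. x \<notin> U (xs ! k))" for x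
      proof
        assume "n x = i"
        then show "x \<in> U (xs ! i) \<and> (\<forall>k<i. x \<notin> U (xs ! k))"
          using n[of x] not_less_Least[of _ "\<lambda>i. i < length xs \<and> x \<in> U (xs ! i)"] True
          by (fastforce simp: n_def[symmetric])
      next
        assume *: "x \<in> U (xs ! i) \<and> (\<forall>k<i. x \<notin> U (xs ! k))"
        then show "n x = i"
          unfolding n_def using True by (intro Least_equality) (auto simp: not_less[symmetric])
      qed
      then show ?thesis using True by auto
    next
      case False
      then show ?thesis using n by auto
    qed
    have "{x. n x = i} \<in> sets borel" for i
      unfolding eqn using U(1) by (auto intro!: sets.Diff sets.finite_UN borel_open)
    moreover have "r -` {v} = (\<Union>i\<in>{i. i < length xs \<and> xs ! i = v}. {x. n x = i})"
      using n by (auto simp: r_def)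
    ultimately show ?thesis by (auto intro!: sets.finite_UN)
  qed
  moreover have "norm (K x y - K (r x) y) \<le> e" for x y
    using U(3)[of x "r x"] n by (auto simp: r_def)
  ultimately show ?thesis using that by blast
qed

text \<open>The Borel \<open>\<sigma>\<close>-algebra of \<open>G \<times> G\<close> may be larger than the product \<open>\<sigma>\<close>-algebra, so
  this does not follow from the Fubini theorem for product measures; a continuous kernel
  is approximated uniformly by kernels that are simple functions of the first variable.\<close>

lemma Fubini_continuous_kernel:
  fixes K :: "'g \<Rightarrow> 'g \<Rightarrow> complex"
  assumes K: "continuous_on UNIV (\<lambda>(x, y). K x y)" and h: "integrable \<mu> h"
  shows "(\<integral>x. (\<integral>y. h y * K x y \<partial>\<mu>) \<partial>\<mu>) = (\<integral>y. h y * (\<integral>x. K x y \<partial>\<mu>) \<partial>\<mu>)" (is "?L = ?R")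
proof -
  define c where "c = (\<integral>y. norm (h y) \<partial>\<mu>)"
  have K': "continuous_on UNIV (\<lambda>(y, x). K x y)"
    using continuous_on_compose2[OF K, of UNIV "\<lambda>p. (snd p, fst p)"]
    by (simp add: case_prod_beta' continuous_on_Pair continuous_on_fst continuous_on_snd)
  have kr: "continuous_on UNIV (K x)" for x using kernel_continuous_right[OF K] .
  have kl: "continuous_on UNIV (\<lambda>x. K x y)" for y using kernel_continuous_left[OF K] .
  have cI: "continuous_on UNIV (\<lambda>y. \<integral>x. K x y \<partial>\<mu>)"
    using continuous_kernel_integral[OF K', of "\<lambda>_. 1"] by simp
  \<comment> \<open>Rounding the first variable by \<open>r\<close> moves each side by at most
    \<open>c * e\<close>, and for the rounded kernel both sides are the same finite sum.\<close>
  have "norm (?L - ?R) \<le> 2 * c * e" if e: "e > 0" for e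
  proof -
    obtain r where r: "finite (range r)" "\<And>v. r -` {v} \<in> sets borel"
      "\<And>x y. norm (K x y - K (r x) y) \<le> e"
      using finite_range_approx[OF K e] by blast
    define I where "I v x = (indicator (r -` {v}) x :: complex)" for v x
    have I: "integrable \<mu> (I v)" for v
      unfolding I_def using r(2)
      by (intro integrable_const_bound[of _ 1] borel_measurable_indicator) (auto simp: indicator_def)
    have sum_r: "q (r x) = (\<Sum>v\<in>range r. I v x * q v)" for q :: "'g \<Rightarrow> complex" and x
    proof -
      have "(\<Sum>v\<in>range r. I v x * q v) = (\<Sum>v\<in>range r. if v = r x then q v else 0)"
        by (intro sum.cong) (auto simp: I_def indicator_def)
      then show ?thesis using r(1) by simp
    qed
    have int1: "integrable \<mu> (\<lambda>x. q (r x))" for q :: "'g \<Rightarrow> complex"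
      unfolding sum_r[of q] using I by (intro Bochner_Integration.integrable_sum) auto
    have int2: "integrable \<mu> (\<lambda>y. h y * K v y)" for v
      by (rule integrable_mult_continuous[OF h kr])
    have eqq: "(\<integral>x. K (r x) y \<partial>\<mu>) = (\<Sum>v\<in>range r. (\<integral>x. I v x \<partial>\<mu>) * K v y)" for y
      using I by (subst sum_r[of "\<lambda>v. K v y"]) (subst Bochner_Integration.integral_sum; simp)
    define L' where "L' = (\<integral>x. (\<integral>y. h y * K (r x) y \<partial>\<mu>) \<partial>\<mu>)"
    define R' where "R' = (\<integral>y. h y * (\<integral>x. K (r x) y \<partial>\<mu>) \<partial>\<mu>)"
    have "L' = (\<Sum>v\<in>range r. (\<integral>x. I v x \<partial>\<mu>) * (\<integral>y. h y * K v y \<partial>\<mu>))"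
      unfolding L'_def using I
      by (subst sum_r[of "\<lambda>v. \<integral>y. h y * K v y \<partial>\<mu>"]) (subst Bochner_Integration.integral_sum; simp)
    moreover have "R' = (\<Sum>v\<in>range r. (\<integral>x. I v x \<partial>\<mu>) * (\<integral>y. h y * K v y \<partial>\<mu>))"
    proof -
      have "R' = (\<integral>y. (\<Sum>v\<in>range r. (\<integral>x. I v x \<partial>\<mu>) * (h y * K v y)) \<partial>\<mu>)"
        unfolding R'_def eqq by (simp add: sum_distrib_left mult_ac)
      also have "\<dots> = (\<Sum>v\<in>range r. (\<integral>y. (\<integral>x. I v x \<partial>\<mu>) * (h y * K v y) \<partial>\<mu>))"
        using int2 by (intro Bochner_Integration.integral_sum) auto
      finally show ?thesis by simp
    qed
    ultimately have eq: "L' = R'" by simp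
    have "norm (?L - L') \<le> c * e"
    proof -
      have "?L - L' = (\<integral>x. (\<integral>y. h y * K x y \<partial>\<mu>) - (\<integral>y. h y * K (r x) y \<partial>\<mu>) \<partial>\<mu>)"
        unfolding L'_def
        using integrable_continuous[OF continuous_kernel_integral[OF K h]] int1[of "\<lambda>v. \<integral>y. h y * K v y \<partial>\<mu>"]
        by simp
      also have "norm \<dots> \<le> c * e"
        unfolding c_def by (intro norm_integral_bound norm_integral_diff_le h int2 r)
      finally show ?thesis .
    qed
    moreover have "norm (?R - R') \<le> c * e"
      unfolding R'_def c_def
    proof (rule norm_integral_diff_le[OF h integrable_mult_continuous[OF h cI]])
      show "integrable \<mu> (\<lambda>y. h y * (\<integral>x. K (r x) y \<partial>\<mu>))"
        unfolding eqq by (intro integrable_mult_continuous h continuous_intros kr)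
      fix y
      have "(\<integral>x. K x y \<partial>\<mu>) - (\<integral>x. K (r x) y \<partial>\<mu>) = (\<integral>x. K x y - K (r x) y \<partial>\<mu>)"
        using integrable_continuous[OF kl] int1[of "\<lambda>v. K v y"] by simp
      then show "norm ((\<integral>x. K x y \<partial>\<mu>) - (\<integral>x. K (r x) y \<partial>\<mu>)) \<le> e"
        by (simp add: norm_integral_bound r)
    qed
    ultimately have "norm (?L - L' - (?R - R')) \<le> c * e + c * e"
      by (meson add_mono norm_triangle_ineq4 order_trans)
    then show ?thesis using eq by (simp add: algebra_simps)
  qed
  note le = this
  have "c \<ge> 0" by (simp add: c_def)
  have "norm (?L - ?R) \<le> e" if "e > 0" for e
  proof -
    have "norm (?L - ?R) \<le> 2 * c * (e / (2 * c + 1))" using \<open>c \<ge> 0\<close> that by (intro le) simp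
    also have "\<dots> \<le> e" using \<open>c \<ge> 0\<close> that by (simp add: field_simps)
    finally show ?thesis .
  qed
  then have "norm (?L - ?R) \<le> 0" using field_le_epsilon[of "norm (?L - ?R)" 0] by simp
  then show ?thesis by simp
qed

text \<open>Haar measure charges every nonempty open set: finitely many left translates of a null
  one would cover the compact group, whose mass is 1.\<close>

lemma continuous_square_integral_zero:
  fixes q :: "'g \<Rightarrow> complex"
  assumes q: "continuous_on UNIV q" and z: "(\<integral>x. (norm (q x))\<^sup>2 \<partial>\<mu>) = 0"
  shows "q x = 0"
proof (rule ccontr)
  assume x: "q x \<noteq> 0"
  define U where "U = {y. q y \<noteq> 0}"
  have op: "open U"
    unfolding U_def by (intro open_Collect_neq q continuous_intros)
  have "AE y in \<mu>. (norm (q y))\<^sup>2 = 0"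
    using z q by (subst integral_nonneg_eq_0_iff_AE[symmetric])
      (auto intro!: integrable_continuous continuous_intros)
  then have "AE y in \<mu>. y \<notin> U" by (simp add: U_def)
  then have U0: "emeasure \<mu> U = 0"
    using op AE_iff_measurable[of U \<mu> "\<lambda>y. y \<notin> U"] by (simp add: U_def)
  have opt: "open ((\<lambda>y. a + y) ` U)" for a
  proof -
    have "(\<lambda>y. a + y) ` U = (\<lambda>y. - a + y) -` U"
      by (auto simp: image_iff) (metis add.assoc add_0 right_minus)
    then show ?thesis using open_vimage[OF op continuous_translate] by simp
  qed
  have cov: "y \<in> (\<lambda>z. (y + - x) + z) ` U" for y
    using x by (intro image_eqI[of _ _ x]) (auto simp: U_def add.assoc)
  define W where "W y = (\<lambda>z. (y + - x) + z) ` U" for y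
  have W: "open (W y)" "y \<in> W y" "emeasure \<mu> (W y) = 0" for y
    using opt[of "y + - x"] cov[of y] haar op U0
    by (auto simp: W_def normalized_haar_measure_def simp del: add_uminus_conv_diff)
  obtain F where F: "finite F" "UNIV \<subseteq> (\<Union>y\<in>F. W y)"
    by (rule compactE_image[OF compact_UNIV, of UNIV W]) (use W in blast)+
  have "emeasure \<mu> UNIV \<le> emeasure \<mu> (\<Union>y\<in>F. W y)"
    using F W(1) by (intro emeasure_mono) (auto intro!: sets.finite_UN)
  also have "\<dots> \<le> (\<Sum>y\<in>F. emeasure \<mu> (W y))"
    using F W(1) by (intro emeasure_subadditive_finite) auto
  finally show False using W(3) by simp
qed

end

section \<open>Convolution\<close>

text \<open>Log-convexity makes the ratios \<open>A (Suc n) / A n\<close> increase to some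
  \<open>L\<close>, so \<open>A n / L ^ Suc n\<close> decreases; the doubling inequality
  \<open>sub\<close> keeps it at least 1. In the application \<open>A n\<close> is the sum of the
  powers \<open>2 * n + 2\<close> of the eigenvalues of a self-adjoint operator, \<open>L\<close> is
  the largest squared eigenvalue and \<open>B\<close> its multiplicity.\<close>

lemma log_convex_submultiplicative_limit:
  fixes A :: "nat \<Rightarrow> real"
  assumes pos: "\<And>n. A n > 0"
    and lc: "\<And>n. (A (Suc n))\<^sup>2 \<le> A n * A (Suc (Suc n))"
    and bd: "\<And>n. A (Suc n) \<le> A n * C"
    and sub: "\<And>n. A (2 * n + 1) \<le> (A n)\<^sup>2"
  obtains L B where "L > 0" "B \<ge> 1" "(\<lambda>n. A n / L ^ Suc n) \<longlonglongrightarrow> B"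
proof -
  define r where "r n = A (Suc n) / A n" for n
  have rpos: "r n > 0" for n using pos by (simp add: r_def)
  have Ar: "A (Suc n) = A n * r n" for n using pos[of n] by (simp add: r_def)
  have "r n \<le> r (Suc n)" for n
    using lc[of n] pos[of n] pos[of "Suc n"] by (simp add: r_def field_simps power2_eq_square)
  then have inc: "incseq r" by (rule incseq_SucI)
  have rC: "r n \<le> C" for n
    using bd[of n] pos[of n] by (simp add: r_def field_simps)
  obtain L where L: "r \<longlonglongrightarrow> L" "\<And>n. r n \<le> L"
    using incseq_convergent[OF inc] rC by blast
  have Lpos: "L > 0" using rpos[of 0] L(2)[of 0] by simp
  \<comment> \<open>If this failed, iterating \<open>sub\<close> from \<open>n\<close> would make
    \<open>A\<close> decay along a subsequence faster than the growth rate at least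
    \<open>r N\<close> beyond \<open>N\<close> permits. Letting \<open>N\<close> tend to infinity
    gives the bound for \<open>L\<close>.\<close>
  have rle: "r N ^ Suc n \<le> A n" for N n
  proof (rule ccontr)
    assume neg: "\<not> r N ^ Suc n \<le> A n"
    define x where "x = r N ^ Suc n"
    define y where "y = A n"
    have xy: "0 < y" "y < x" using neg pos by (auto simp: x_def y_def)
    have lower: "A N * r N ^ k \<le> A (N + k)" for k
    proof (induction k)
      case (Suc k)
      have "A N * r N ^ Suc k \<le> A (N + k) * r N"
        using Suc rpos[of N] by (simp add: mult_right_mono mult.assoc mult.left_commute)
      also have "\<dots> \<le> A (N + k) * r (N + k)"
        using incseqD[OF inc, of N "N + k"] pos[of "N + k"] by simp
      finally show ?case using Ar[of "N + k"] by simp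
    qed simp
    \<comment> \<open>Chosen so that \<open>m (Suc k) = 2 * m k + 1\<close>, the index on the left
      of \<open>sub\<close>.\<close>
    define m where "m k = 2 ^ k * Suc n - 1" for k
    have m1: "Suc (m k) = 2 ^ k * Suc n" for k unfolding m_def by simp
    have upper: "A (m k) \<le> y ^ (2 ^ k)" for k
    proof (induction k)
      case (Suc k)
      have "Suc (m (Suc k)) = Suc (2 * m k + 1)"
        using m1[of k] m1[of "Suc k"] by simp
      then have "m (Suc k) = 2 * m k + 1" by simp
      then have "A (m (Suc k)) \<le> (A (m k))\<^sup>2" using sub by simp
      also have "\<dots> \<le> (y ^ (2 ^ k))\<^sup>2"
        using Suc pos[of "m k"] by (intro power_mono) auto
      finally show ?case by (simp add: power_mult mult.commute flip: power_mult)
    qed (simp add: m_def y_def)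
    define c where "c = r N ^ Suc N"
    have c: "c > 0" using rpos by (simp add: c_def)
    have "A N / c \<le> (y / x) ^ k" if "k \<ge> N" for k
    proof -
      have k: "k < 2 ^ k" by simp
      have "Suc k \<le> Suc (m k)"
        unfolding m1 using k by (simp add: Suc_leI trans_le_add1)
      then have "N \<le> m k" using that by simp
      then obtain j where j: "m k = N + j" using le_Suc_ex by blast
      have "r N ^ Suc (m k) = c * r N ^ j" by (simp add: j c_def power_add)
      then have "x ^ (2 ^ k) = c * r N ^ j"
        by (simp only: m1 x_def power_mult[symmetric] mult.commute[of "Suc n"])
      then have "A N / c * x ^ (2 ^ k) \<le> y ^ (2 ^ k)"
        using lower[of j] upper[of k] c by (simp add: j)
      then have "A N / c \<le> (y / x) ^ (2 ^ k)"
        using xy by (simp add: power_divide pos_le_divide_eq)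
      \<comment> \<open>Since \<open>y / x < 1\<close>, the exponent may be lowered from
        \<open>2 ^ k\<close> to \<open>k\<close>, leaving a geometric sequence.\<close>
      also have "\<dots> \<le> (y / x) ^ k"
        using xy k by (intro power_decreasing) (auto simp: less_imp_le)
      finally show ?thesis .
    qed
    moreover have "(\<lambda>k. (y / x) ^ k) \<longlonglongrightarrow> 0"
      using xy by (intro LIMSEQ_realpow_zero) auto
    ultimately have "A N / c \<le> 0" by (intro LIMSEQ_le_const) auto
    then show False using pos[of N] c by (simp add: field_simps)
  qed
  have Lle: "L ^ Suc n \<le> A n" for n
    by (rule LIMSEQ_le_const2[OF tendsto_power[OF L(1)]]) (use rle in blast)
  define b where "b n = A n / L ^ Suc n" for n
  have b1: "b n \<ge> 1" for n using Lle[of n] Lpos by (simp add: b_def)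
  have "b (Suc n) \<le> b n" for n
    using L(2)[of n] Lpos pos[of n] by (simp add: b_def Ar field_simps)
  then have "decseq b" by (rule decseq_SucI)
  then obtain B where B: "b \<longlonglongrightarrow> B" using decseq_convergent[of b 1] b1 by metis
  have "B \<ge> 1" using b1 by (intro LIMSEQ_le_const[OF B]) auto
  then show ?thesis using that[of L B] Lpos B by (simp add: b_def[abs_def])
qed

text \<open>The involution of the convolution algebra: \<open>adj a = a\<close> says that right
  convolution by \<open>a\<close> is a self-adjoint operator.\<close>

definition adj :: "('g::group_add \<Rightarrow> complex) \<Rightarrow> 'g \<Rightarrow> complex" where
  "adj a x = cnj (a (- x))"

text \<open>The left regular representation, which commutes with right convolutions.\<close>

definition transl :: "'g::group_add \<Rightarrow> ('g \<Rightarrow> 'b) \<Rightarrow> 'g \<Rightarrow> 'b" where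
  "transl z a x = a (- z + x)"

lemma adj_adj [simp]: "adj (adj a) = a"
  by (simp add: adj_def fun_eq_iff)

lemma transl_0 [simp]: "transl 0 a = a"
  by (simp add: transl_def fun_eq_iff)

lemma transl_transl: "transl z (transl w a) = transl (z + w) a"
  by (simp add: transl_def fun_eq_iff minus_add add.assoc[symmetric])

lemma continuous_transl [continuous_intros]:
  fixes a :: "'g::topological_group_add \<Rightarrow> 'b::topological_space"
  assumes "continuous_on UNIV a"
  shows "continuous_on UNIV (transl z a)"
  unfolding transl_def
  by (rule continuous_on_compose2[OF assms]) (auto intro!: continuous_intros)

lemma continuous_adj [continuous_intros]:
  fixes a :: "'g::topological_group_add \<Rightarrow> complex"
  assumes "continuous_on UNIV a"
  shows "continuous_on UNIV (adj a)"
  unfolding adj_def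
  by (intro continuous_intros continuous_on_compose2[OF assms]) auto

section \<open>Inner product and convolution algebra of continuous functions\<close>

context haar_compact
begin

definition ip :: "('g \<Rightarrow> complex) \<Rightarrow> ('g \<Rightarrow> complex) \<Rightarrow> complex" where
  "ip a b = (\<integral>x. a x * cnj (b x) \<partial>\<mu>)"

definition nrm2 :: "('g \<Rightarrow> complex) \<Rightarrow> real" where
  "nrm2 a = (\<integral>x. (norm (a x))\<^sup>2 \<partial>\<mu>)"

definition conv :: "('g \<Rightarrow> complex) \<Rightarrow> ('g \<Rightarrow> complex) \<Rightarrow> 'g \<Rightarrow> complex" where
  "conv a b x = (\<integral>y. a y * b (- y + x) \<partial>\<mu>)"

abbreviation cont :: "('g \<Rightarrow> complex) \<Rightarrow> bool" where
  "cont a \<equiv> continuous_on UNIV a"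

lemma ip_integrable: "cont a \<Longrightarrow> cont b \<Longrightarrow> integrable \<mu> (\<lambda>x. a x * cnj (b x))"
  by (intro integrable_continuous continuous_intros)

lemma ip_cnj: "cnj (ip a b) = ip b a"
  unfolding ip_def by (subst Bochner_Integration.integral_cnj[symmetric]) (simp add: mult.commute)

lemma ip_self: "ip a a = of_real (nrm2 a)"
  unfolding ip_def nrm2_def complex_norm_square[symmetric] of_real_power[symmetric]
  by (rule integral_complex_of_real)

lemma nrm2_nonneg: "nrm2 a \<ge> 0"
  by (simp add: nrm2_def)

lemma nrm2_eq_0D: "cont a \<Longrightarrow> nrm2 a = 0 \<Longrightarrow> a x = 0"
  unfolding nrm2_def by (rule continuous_square_integral_zero)

lemma ip_diff_left: "cont a \<Longrightarrow> cont b \<Longrightarrow> cont c \<Longrightarrow> ip (\<lambda>x. a x - b x) c = ip a c - ip b c"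
  using ip_integrable[of a c] ip_integrable[of b c] by (simp add: ip_def left_diff_distrib)

lemma ip_diff_right: "cont a \<Longrightarrow> cont b \<Longrightarrow> cont c \<Longrightarrow> ip c (\<lambda>x. a x - b x) = ip c a - ip c b"
  by (subst (1 2 3) ip_cnj[symmetric]) (simp add: ip_diff_left)

lemma ip_scale_left: "ip (\<lambda>x. k * a x) c = k * ip a c"
  by (simp add: ip_def mult.assoc)

lemma ip_scale_right: "ip c (\<lambda>x. k * a x) = cnj k * ip c a"
  by (subst (1 2) ip_cnj[symmetric]) (simp add: ip_scale_left)

lemma ip_sum_left:
  "(\<And>i. i \<in> I \<Longrightarrow> cont (a i)) \<Longrightarrow> cont c \<Longrightarrow> ip (\<lambda>x. \<Sum>i\<in>I. a i x) c = (\<Sum>i\<in>I. ip (a i) c)"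
  unfolding ip_def sum_distrib_right
  by (rule Bochner_Integration.integral_sum) (auto intro: ip_integrable)

lemma ip_sum_right:
  "(\<And>i. i \<in> I \<Longrightarrow> cont (a i)) \<Longrightarrow> cont c \<Longrightarrow> ip c (\<lambda>x. \<Sum>i\<in>I. a i x) = (\<Sum>i\<in>I. ip c (a i))"
  by (subst (1 2) ip_cnj[symmetric]) (simp add: ip_sum_left)

lemma nrm2_diff:
  assumes "cont a" "cont b"
  shows "nrm2 (\<lambda>x. a x - b x) = nrm2 a - 2 * Re (ip a b) + nrm2 b"
proof -
  have "complex_of_real (nrm2 (\<lambda>x. a x - b x)) = ip a a - ip a b - (ip b a - ip b b)"
    using assms by (simp add: ip_self[symmetric] ip_diff_left ip_diff_right continuous_intros)
  then have "Re (complex_of_real (nrm2 (\<lambda>x. a x - b x))) = Re (ip a a - ip a b - (ip b a - ip b b))"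
    by simp
  moreover have "Re (ip b a) = Re (ip a b)" by (subst ip_cnj[symmetric]) simp
  ultimately show ?thesis by (simp add: ip_self)
qed

definition orthonormal :: "nat \<Rightarrow> (nat \<Rightarrow> 'g \<Rightarrow> complex) \<Rightarrow> bool" where
  "orthonormal d F \<longleftrightarrow> (\<forall>i<d. cont (F i)) \<and> (\<forall>i<d. \<forall>j<d. ip (F i) (F j) = (if i = j then 1 else 0))"

lemma orthonormal_residual:
  assumes F: "orthonormal d F" and q: "cont q"
  defines "r \<equiv> \<lambda>x. q x - (\<Sum>i<d. ip q (F i) * F i x)"
  shows "cont r" "\<And>j. j < d \<Longrightarrow> ip r (F j) = 0"
    "nrm2 r = nrm2 q - (\<Sum>i<d. (norm (ip q (F i)))\<^sup>2)"
proof -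
  define s where "s = (\<lambda>x. \<Sum>i<d. ip q (F i) * F i x)"
  have Fc: "cont (F i)" if "i < d" for i using F that by (simp add: orthonormal_def)
  have s: "cont s" unfolding s_def using Fc by (intro continuous_intros) auto
  have r_eq: "r = (\<lambda>x. q x - s x)" by (simp add: r_def s_def)
  show r: "cont r" unfolding r_eq by (intro continuous_intros q s)
  have sF: "ip s (F j) = ip q (F j)" if "j < d" for j
  proof -
    have "ip s (F j) = (\<Sum>i<d. ip q (F i) * ip (F i) (F j))"
      unfolding s_def using Fc that
      by (subst ip_sum_left) (auto intro!: continuous_intros simp: ip_scale_left)
    also have "\<dots> = (\<Sum>i<d. if i = j then ip q (F i) else 0)"
      using F that by (intro sum.cong) (auto simp: orthonormal_def)
    finally show ?thesis using that by simp
  qed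
  show rF: "ip r (F j) = 0" if "j < d" for j
    unfolding r_eq using that by (simp add: ip_diff_left q s Fc sF)
  have "ip r s = 0"
    unfolding s_def using r rF by (subst ip_sum_right) (auto intro!: continuous_intros Fc simp: ip_scale_right)
  moreover have "ip q s = of_real (\<Sum>i<d. (norm (ip q (F i)))\<^sup>2)"
  proof -
    have "ip q s = (\<Sum>i<d. cnj (ip q (F i)) * ip q (F i))"
      unfolding s_def using q
      by (subst ip_sum_right) (auto intro!: continuous_intros Fc simp: ip_scale_right)
    then show ?thesis by (simp only: of_real_sum complex_norm_square mult.commute)
  qed
  moreover have "ip r s = ip q s - ip s s" unfolding r_eq by (simp add: ip_diff_left q s)
  ultimately have "nrm2 s = (\<Sum>i<d. (norm (ip q (F i)))\<^sup>2)"
    "Re (ip q s) = (\<Sum>i<d. (norm (ip q (F i)))\<^sup>2)"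
    by (metis diff_eq_diff_eq diff_zero diff_self ip_self of_real_eq_iff, metis Re_complex_of_real)
  then show "nrm2 r = nrm2 q - (\<Sum>i<d. (norm (ip q (F i)))\<^sup>2)"
    unfolding r_eq nrm2_diff[OF q s] by simp
qed

lemma Bessel:
  assumes "orthonormal d F" "cont q"
  shows "(\<Sum>i<d. (norm (ip q (F i)))\<^sup>2) \<le> nrm2 q"
  using orthonormal_residual(3)[OF assms] nrm2_nonneg[of "\<lambda>x. q x - (\<Sum>i<d. ip q (F i) * F i x)"]
  by simp

text \<open>Bessel's inequality for the single function \<open>b\<close> divided by its norm; if
  that norm is 0, continuity makes \<open>b\<close> vanish at every point.\<close>

lemma Cauchy_Schwarz_ip:
  assumes "cont a" "cont b"
  shows "(norm (ip a b))\<^sup>2 \<le> nrm2 a * nrm2 b"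
proof (cases "nrm2 b = 0")
  case True
  then have "b x = 0" for x by (rule nrm2_eq_0D[OF assms(2)])
  then show ?thesis using True by (simp add: ip_def)
next
  case False
  define k where "k = 1 / complex_of_real (sqrt (nrm2 b))"
  have k: "(norm k)\<^sup>2 = 1 / nrm2 b"
    using nrm2_nonneg[of b] by (simp add: k_def norm_divide power_divide)
  have "k * cnj k = complex_of_real (1 / nrm2 b)"
    using k by (metis complex_norm_square)
  then have "orthonormal 1 (\<lambda>_ x. k * b x)"
    using assms False
    by (auto simp: orthonormal_def ip_scale_left ip_scale_right ip_self intro!: continuous_intros)
       (simp add: mult.assoc[symmetric] mult.commute)
  from Bessel[OF this assms(1)] have "(norm k)\<^sup>2 * (norm (ip a b))\<^sup>2 \<le> nrm2 a"
    by (simp add: ip_scale_right norm_mult power_mult_distrib)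
  then show ?thesis using False nrm2_nonneg[of b] by (simp add: k field_simps)
qed

lemma ip_transl:
  assumes "cont a" "cont b"
  shows "ip (transl z a) (transl z b) = ip a b"
  unfolding ip_def transl_def
  by (rule integral_translate_cont[of "\<lambda>x. a x * cnj (b x)"]) (intro continuous_intros assms)

lemma nrm2_transl: "cont a \<Longrightarrow> nrm2 (transl z a) = nrm2 a"
  using ip_transl[of a a z] by (simp add: ip_self)

text \<open>Each value of a convolution is an inner product with a translate. Pointwise bounds thus
  come from Cauchy-Schwarz, and \<open>conv f p = f\<close> with \<open>adj p = p\<close> becomes a
  reproducing property.\<close>

lemma conv_eq_ip: "conv a b x = ip a (transl x (adj b))"
  by (simp add: conv_def ip_def transl_def adj_def minus_add)

lemma continuous_translates:
  assumes "cont b"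
  shows "continuous_on UNIV (\<lambda>(x::'g, y). b (- y + x))"
  unfolding case_prod_beta'
  by (rule continuous_on_compose2[OF assms]) (auto intro!: continuous_intros)

text \<open>Integrability of the left factor is enough: this is how a merely integrable function is
  turned into a continuous one.\<close>

lemma cont_conv:
  assumes "integrable \<mu> a" "cont b"
  shows "cont (conv a b)"
  unfolding conv_def[abs_def]
  by (rule continuous_kernel_integral[OF continuous_translates[OF assms(2)] assms(1)])

lemma cont_conv': "cont a \<Longrightarrow> cont b \<Longrightarrow> cont (conv a b)"
  by (intro cont_conv integrable_continuous)

lemma transl_conv_left:
  assumes "cont a" "cont b"
  shows "transl z (conv a b) = conv (transl z a) b"
proof
  fix x
  have "conv (transl z a) b x = ip (transl z a) (transl z (transl (- z + x) (adj b)))"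
    by (simp add: conv_eq_ip transl_transl add.assoc[symmetric])
  also have "\<dots> = ip a (transl (- z + x) (adj b))"
    by (intro ip_transl continuous_intros assms)
  finally show "transl z (conv a b) x = conv (transl z a) b x"
    by (simp add: transl_def conv_eq_ip)
qed

lemma conv_assoc:
  assumes a: "integrable \<mu> a" and b: "cont b" and c: "cont c"
  shows "conv (conv a b) c = conv a (conv b c)"
proof
  fix x
  have K: "continuous_on UNIV (\<lambda>(z, y). b (- y + z) * c (- z + x))"
    unfolding case_prod_beta'
    by (intro continuous_intros continuous_on_compose2[OF b] continuous_on_compose2[OF c]) auto
  have "conv (conv a b) c x = (\<integral>z. (\<integral>y. a y * (b (- y + z) * c (- z + x)) \<partial>\<mu>) \<partial>\<mu>)"
    by (simp add: conv_def mult.assoc[symmetric])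
  also have "\<dots> = (\<integral>y. a y * (\<integral>z. b (- y + z) * c (- z + x) \<partial>\<mu>) \<partial>\<mu>)"
    by (rule Fubini_continuous_kernel[OF K a])
  also have "(\<integral>z. b (- y + z) * c (- z + x) \<partial>\<mu>) = conv b c (- y + x)" for y
  proof -
    have "cont (\<lambda>z. b z * c (- z + (- y + x)))"
      by (intro continuous_intros continuous_on_compose2[OF b] continuous_on_compose2[OF c]) auto
    from integral_translate_cont[OF this, of "- y"] show ?thesis
      by (simp add: conv_def minus_add add.assoc)
  qed
  then have "(\<integral>y. a y * (\<integral>z. b (- y + z) * c (- z + x) \<partial>\<mu>) \<partial>\<mu>) = conv a (conv b c) x"
    by (simp add: conv_def[of a])
  finally show "conv (conv a b) c x = conv a (conv b c) x" .
qed

lemma adj_conv: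
  assumes "cont a" "cont b"
  shows "adj (conv a b) = conv (adj b) (adj a)"
proof
  fix x
  have "adj (conv a b) x = ip (transl (- x) (adj b)) a"
    by (simp add: adj_def[of "conv a b"] conv_eq_ip ip_cnj)
  also have "\<dots> = ip (transl x (transl (- x) (adj b))) (transl x a)"
    by (intro ip_transl[symmetric] continuous_intros assms)
  finally show "adj (conv a b) x = conv (adj b) (adj a) x"
    by (simp add: conv_eq_ip transl_transl)
qed

text \<open>Convergence in mean square becomes uniform after one further convolution.\<close>

lemma norm_conv_le:
  assumes "cont a" "cont b"
  shows "(norm (conv a b x))\<^sup>2 \<le> nrm2 a * nrm2 (adj b)"
  unfolding conv_eq_ip
  by (metis Cauchy_Schwarz_ip assms continuous_adj continuous_transl nrm2_transl)

end

section \<open>Idempotent kernels\<close>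

context haar_compact
begin

text \<open>\<open>cpow \<theta> n\<close> is the convolution power with \<open>n + 1\<close>
  factors: a zeroth power would be the unit of convolution, which in general is not a function.
  Hence the \<open>Suc\<close> in the addition of exponents.\<close>

fun cpow :: "('g \<Rightarrow> complex) \<Rightarrow> nat \<Rightarrow> 'g \<Rightarrow> complex" where
  "cpow \<theta> 0 = \<theta>"
| "cpow \<theta> (Suc n) = conv (cpow \<theta> n) \<theta>"

lemma cont_cpow: "cont \<theta> \<Longrightarrow> cont (cpow \<theta> n)"
  by (induction n) (auto intro: cont_conv')

lemma conv_cpow:
  assumes "cont \<theta>"
  shows "conv (cpow \<theta> m) (cpow \<theta> n) = cpow \<theta> (Suc (m + n))"
proof (induction n)
  case (Suc n)
  show ?case
    using Suc assms
    by (simp add: conv_assoc[symmetric] cont_cpow integrable_continuous)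
qed simp

lemma adj_cpow:
  assumes "cont \<theta>" "adj \<theta> = \<theta>"
  shows "adj (cpow \<theta> n) = cpow \<theta> n"
proof (induction n)
  case (Suc n)
  then show ?case
    using assms conv_cpow[OF assms(1), of 0 n] by (simp add: adj_conv cont_cpow)
qed (simp add: assms)

lemma ip_cpow:
  assumes "cont \<theta>" "adj \<theta> = \<theta>"
  shows "ip (cpow \<theta> m) (cpow \<theta> n) = cpow \<theta> (Suc (m + n)) 0"
  using conv_cpow[OF assms(1), of m n] conv_eq_ip[of "cpow \<theta> m" "cpow \<theta> n" 0]
  by (simp add: adj_cpow[OF assms])

lemma uniform_limit_integral:
  fixes \<psi> :: "nat \<Rightarrow> 'g \<Rightarrow> complex"
  assumes lim: "uniform_limit UNIV \<psi> p sequentially" and c: "\<And>n. cont (\<psi> n)" and u: "integrable \<mu> u"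
  shows "(\<lambda>n. \<integral>x. u x * \<psi> n x \<partial>\<mu>) \<longlonglongrightarrow> (\<integral>x. u x * p x \<partial>\<mu>)"
proof (rule LIMSEQ_I)
  fix e :: real assume e: "e > 0"
  have p: "cont p" by (rule uniform_limit_theorem[OF _ lim]) (use c in auto)
  define k where "k = (\<integral>x. norm (u x) \<partial>\<mu>)"
  have k: "k \<ge> 0" by (simp add: k_def)
  have "e / (k + 1) > 0" using e k by simp
  then obtain N where N: "\<And>n x. n \<ge> N \<Longrightarrow> norm (\<psi> n x - p x) < e / (k + 1)"
    using uniform_limitD[OF lim, of "e / (k + 1)"] unfolding eventually_sequentially dist_norm by blast
  have "norm ((\<integral>x. u x * \<psi> n x \<partial>\<mu>) - (\<integral>x. u x * p x \<partial>\<mu>)) < e" if "n \<ge> N" for n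
  proof -
    have "norm ((\<integral>x. u x * \<psi> n x \<partial>\<mu>) - (\<integral>x. u x * p x \<partial>\<mu>)) \<le> k * (e / (k + 1))"
      unfolding k_def
      by (intro norm_integral_diff_le integrable_mult_continuous u c p)
         (use N[OF that] in \<open>auto simp: k_def intro: less_imp_le\<close>)
    also have "\<dots> < e" using e k by (simp add: field_simps)
    finally show ?thesis .
  qed
  then show "\<exists>N. \<forall>n\<ge>N. norm ((\<integral>x. u x * \<psi> n x \<partial>\<mu>) - (\<integral>x. u x * p x \<partial>\<mu>)) < e" by blast
qed

text \<open>The even powers of a self-adjoint \<open>\<theta>\<close>, rescaled by powers of the norm of the operator
  \<open>a \<mapsto> a * \<theta>\<close>, converge to the kernel of the projection onto the sum of its top eigenspaces. The number
  \<open>A n = \<parallel>\<theta>\<^bsup>n+1\<^esup>\<parallel>\<^sup>2\<close> is the trace of the power \<open>2 n + 2\<close> of this operator; the inequality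
  \<open>A (2 n + 1) \<le> (A n)\<^sup>2\<close> keeps the limit away from zero, replacing compactness of the operator.\<close>

lemma idempotent_kernel:
  assumes \<theta>: "cont \<theta>" "adj \<theta> = \<theta>" and nz: "\<theta> x0 \<noteq> 0"
  obtains p where "cont p" "adj p = p" "conv p p = p" "p 0 \<noteq> 0"
    "\<And>u. integrable \<mu> u \<Longrightarrow> (\<And>n. (\<integral>x. u x * cpow \<theta> n x \<partial>\<mu>) = 0) \<Longrightarrow> (\<integral>x. u x * p x \<partial>\<mu>) = 0"
proof -
  define A where "A n = nrm2 (cpow \<theta> n)" for n
  note cc = cont_cpow[OF \<theta>(1)]
  have A: "complex_of_real (A n) = cpow \<theta> (2 * n + 1) 0" for n
    using ip_cpow[OF \<theta>, of n n] by (simp add: A_def ip_self mult_2)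
  have A0: "A n \<ge> 0" for n by (simp add: A_def nrm2_nonneg)
  \<comment> \<open>An inner product of powers depends only on the sum of the indices, and
    \<open>n + (n + 2) = 2 * (n + 1)\<close>; so the middle term is the inner product of the two
    outer powers.\<close>
  have lc: "(A (Suc n))\<^sup>2 \<le> A n * A (Suc (Suc n))" for n
  proof -
    have "complex_of_real (A (Suc n)) = ip (cpow \<theta> n) (cpow \<theta> (Suc (Suc n)))"
      unfolding A ip_cpow[OF \<theta>] by (rule arg_cong[where f="\<lambda>k. cpow \<theta> k 0"]) simp
    then have "(A (Suc n))\<^sup>2 = (norm (ip (cpow \<theta> n) (cpow \<theta> (Suc (Suc n)))))\<^sup>2"
      using A0[of "Suc n"] by (metis norm_of_real abs_of_nonneg)
    also have "\<dots> \<le> A n * A (Suc (Suc n))"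
      unfolding A_def by (intro Cauchy_Schwarz_ip cc)
    finally show ?thesis .
  qed
  have nrm2_le: "nrm2 a \<le> B" if "cont a" "\<And>x. (norm (a x))\<^sup>2 \<le> B" for a B
  proof -
    have "nrm2 a = norm (\<integral>x. (norm (a x))\<^sup>2 \<partial>\<mu>)"
      using nrm2_nonneg[of a] by (simp add: nrm2_def)
    also have "\<dots> \<le> B" by (rule norm_integral_bound) (use that in auto)
    finally show ?thesis .
  qed
  have bd: "A (Suc n) \<le> A n * A 0" for n
    unfolding A_def using norm_conv_le[OF cc[of n] \<theta>(1)] cc[of "Suc n"] \<theta>
    by (intro nrm2_le) auto
  have sub: "A (2 * n + 1) \<le> (A n)\<^sup>2" for n
    unfolding A_def
  proof (rule nrm2_le[OF cc])
    fix x
    have "cpow \<theta> (2 * n + 1) = conv (cpow \<theta> n) (cpow \<theta> n)"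
      by (simp add: conv_cpow[OF \<theta>(1)] mult_2)
    then show "(norm (cpow \<theta> (2 * n + 1) x))\<^sup>2 \<le> (nrm2 (cpow \<theta> n))\<^sup>2"
      using norm_conv_le[OF cc[of n] cc[of n], of x] by (simp add: adj_cpow[OF \<theta>] power2_eq_square)
  qed
  \<comment> \<open>Log-convexity passes positivity from \<open>n\<close> and \<open>n + 1\<close>
    to \<open>n + 2\<close>, hence the pair. \<open>A 1 > 0\<close> because
    \<open>cpow \<theta> 1\<close> takes the value \<open>A 0\<close> at the identity.\<close>
  have nzA: "A n > 0 \<and> A (Suc n) > 0" for n
  proof (induction n)
    case 0
    have "nrm2 \<theta> \<noteq> 0" using nrm2_eq_0D[OF \<theta>(1)] nz by blast
    then have a0: "A 0 > 0" using A0[of 0] by (simp add: A_def)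
    then have "cpow \<theta> 1 0 \<noteq> 0" using A[of 0] by (metis add_0 less_irrefl mult_0_right of_real_eq_0_iff)
    then have "nrm2 (cpow \<theta> 1) \<noteq> 0" using nrm2_eq_0D[OF cc[of 1]] by blast
    then show ?case using a0 A0[of 1] by (simp add: A_def)
  next
    case (Suc n)
    then have "0 < (A (Suc n))\<^sup>2" by simp
    also note lc[of n]
    finally show ?case using Suc by (simp add: zero_less_mult_iff)
  qed
  obtain L B where LB: "L > 0" "B \<ge> 1" "(\<lambda>n. A n / L ^ Suc n) \<longlonglongrightarrow> B"
    using log_convex_submultiplicative_limit[of A "A 0"] nzA lc bd sub by blast
  define b where "b n = A n / L ^ Suc n" for n
  \<comment> \<open>Only even powers occur, so top eigenvalues of opposite sign cannot produce
    oscillation. The exponent \<open>2 * n + 2\<close> matches \<open>L ^ Suc n\<close>, as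
    \<open>L\<close> plays the role of a squared eigenvalue.\<close>
  define \<psi> where "\<psi> n = (\<lambda>x. of_real (1 / L ^ Suc n) * cpow \<theta> (2 * n + 1) x)" for n
  have \<psi>c: "cont (\<psi> n)" for n unfolding \<psi>_def by (intro continuous_intros cc)
  have \<psi>conv: "conv (\<psi> n) (\<psi> m) = \<psi> (Suc (n + m))" for n m
  proof
    fix x
    have "conv (\<psi> n) (\<psi> m) x = of_real (1 / L ^ Suc n) * of_real (1 / L ^ Suc m) * conv (cpow \<theta> (2 * n + 1)) (cpow \<theta> (2 * m + 1)) x"
      unfolding conv_def \<psi>_def by (subst integral_mult_right_zero[symmetric]) (simp only: mult_ac)
    then show "conv (\<psi> n) (\<psi> m) x = \<psi> (Suc (n + m)) x"
      unfolding conv_cpow[OF \<theta>(1)] \<psi>_def by (simp add: power_add algebra_simps del: cpow.simps)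
  qed
  have \<psi>adj: "adj (\<psi> n) = \<psi> n" for n
    using adj_cpow[OF \<theta>, of "2 * n + 1"] unfolding \<psi>_def adj_def fun_eq_iff by simp
  have \<psi>ip: "ip (\<psi> n) (\<psi> m) = of_real (b (Suc (n + m)))" for n m
  proof -
    have "ip (\<psi> n) (\<psi> m) = \<psi> (Suc (n + m)) 0"
      using \<psi>conv[of n m] conv_eq_ip[of "\<psi> n" "\<psi> m" 0] by (simp add: \<psi>adj)
    then show ?thesis unfolding \<psi>_def b_def A[symmetric] by simp
  qed
  \<comment> \<open>All inner products of the \<open>\<psi> n\<close> are values of the one
    convergent sequence \<open>b\<close>, so the right-hand side tends to
    \<open>B - 2 * B + B = 0\<close>.\<close>
  have \<psi>diff: "nrm2 (\<lambda>x. \<psi> n x - \<psi> m x) = b (Suc (n + n)) - 2 * b (Suc (n + m)) + b (Suc (m + m))" for n m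
    using \<psi>ip[of n n] \<psi>ip[of n m] \<psi>ip[of m m] by (simp add: nrm2_diff[OF \<psi>c \<psi>c] ip_self)
  define K where "K = nrm2 (\<psi> 0) + 1"
  have K: "K > 0" using nrm2_nonneg[of "\<psi> 0"] by (simp add: K_def)
  \<comment> \<open>Convolving with \<open>\<psi> 0\<close> raises the index by one and upgrades the
    mean-square estimate to a uniform one.\<close>
  have sup: "(norm (\<psi> (Suc n) x - \<psi> (Suc m) x))\<^sup>2 \<le> nrm2 (\<lambda>x. \<psi> n x - \<psi> m x) * K" for n m x
  proof -
    have "\<psi> (Suc n) x - \<psi> (Suc m) x = conv (\<lambda>x. \<psi> n x - \<psi> m x) (\<psi> 0) x"
      using \<psi>conv[of n 0] \<psi>conv[of m 0]
      by (simp add: conv_eq_ip fun_eq_iff ip_diff_left \<psi>c continuous_intros \<psi>adj)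
    also have "(norm \<dots>)\<^sup>2 \<le> nrm2 (\<lambda>x. \<psi> n x - \<psi> m x) * nrm2 (adj (\<psi> 0))"
      by (intro norm_conv_le continuous_intros \<psi>c)
    also have "\<dots> \<le> nrm2 (\<lambda>x. \<psi> n x - \<psi> m x) * K"
      unfolding \<psi>adj K_def by (intro mult_left_mono nrm2_nonneg) auto
    finally show ?thesis .
  qed
  have b: "b \<longlonglongrightarrow> B" using LB(3) by (simp add: b_def[abs_def])
  have "uniformly_Cauchy_on UNIV \<psi>"
  proof (rule uniformly_Cauchy_onI)
    fix e :: real assume e: "e > 0"
    \<comment> \<open>The 4 is the sum of the absolute coefficients 1, 2, 1 in
      \<open>\<psi>diff\<close>.\<close>
    then have "e\<^sup>2 / (4 * K) > 0" using K by simp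
    then obtain N where N: "\<And>n. n \<ge> N \<Longrightarrow> norm (b n - B) < e\<^sup>2 / (4 * K)"
      using LIMSEQ_D[OF b] by blast
    show "\<exists>M. \<forall>x\<in>UNIV. \<forall>m\<ge>M. \<forall>n\<ge>M. dist (\<psi> m x) (\<psi> n x) < e"
    proof (intro exI ballI allI impI)
      fix x m' n' assume "m' \<ge> Suc N" "n' \<ge> Suc N"
      then obtain m n where mn: "m' = Suc m" "n' = Suc n" "m \<ge> N" "n \<ge> N"
        by (metis Suc_le_D Suc_le_mono)
      have "norm (b (Suc (m + m)) - B) < e\<^sup>2 / (4 * K)" "norm (b (Suc (m + n)) - B) < e\<^sup>2 / (4 * K)"
        "norm (b (Suc (n + n)) - B) < e\<^sup>2 / (4 * K)"
        by (rule N, use mn in simp)+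
      then have "nrm2 (\<lambda>x. \<psi> m x - \<psi> n x) < 4 * (e\<^sup>2 / (4 * K))"
        unfolding \<psi>diff real_norm_def by linarith
      then have "nrm2 (\<lambda>x. \<psi> m x - \<psi> n x) * K < e\<^sup>2"
        using K by (simp add: field_simps)
      then have "(norm (\<psi> m' x - \<psi> n' x))\<^sup>2 < e\<^sup>2"
        using sup[of m x n] mn by simp
      then show "dist (\<psi> m' x) (\<psi> n' x) < e"
        using e unfolding dist_norm by (meson power2_less_imp_less less_imp_le)
    qed
  qed
  then have "uniformly_convergent_on UNIV \<psi>" by (simp add: uniformly_convergent_eq_Cauchy)
  then obtain p where p: "uniform_limit UNIV \<psi> p sequentially" by (auto simp: uniformly_convergent_on_def)
  have pc: "cont p" by (rule uniform_limit_theorem[OF _ p]) (use \<psi>c in auto)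
  have pt: "(\<lambda>n. \<psi> n x) \<longlonglongrightarrow> p x" for x by (rule tendsto_uniform_limitI[OF p]) simp
  have "adj p x = p x" for x
  proof -
    have "(\<lambda>n. cnj (\<psi> n (- x))) \<longlonglongrightarrow> cnj (p (- x))" by (intro tendsto_cnj pt)
    moreover have "cnj (\<psi> n (- x)) = \<psi> n x" for n using \<psi>adj[of n] by (metis adj_def)
    ultimately show ?thesis using LIMSEQ_unique[OF _ pt[of x]] by (simp add: adj_def)
  qed
  then have "adj p = p" by blast
  \<comment> \<open>Two successive limits in the exponent law \<open>\<psi>conv\<close>: the left
    factor goes to \<open>p\<close> with \<open>m\<close> fixed, then the right one.\<close>
  moreover have "conv p p x = p x" for x
  proof -
    have 1: "conv p (\<psi> m) x = p x" for m
    proof -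
      have "integrable \<mu> (\<lambda>y. \<psi> m (- y + x))"
        by (rule integrable_continuous) (intro continuous_intros continuous_on_compose2[OF \<psi>c]; simp)
      from uniform_limit_integral[OF p \<psi>c this]
      have "(\<lambda>n. conv (\<psi> n) (\<psi> m) x) \<longlonglongrightarrow> conv p (\<psi> m) x"
        by (simp add: conv_def mult.commute)
      moreover have "(\<lambda>n. \<psi> (n + Suc m) x) \<longlonglongrightarrow> p x" by (rule LIMSEQ_ignore_initial_segment[OF pt])
      ultimately show ?thesis by (simp add: \<psi>conv LIMSEQ_unique)
    qed
    have "uniform_limit UNIV (\<lambda>n y. \<psi> n (- y + x)) (\<lambda>y. p (- y + x)) sequentially"
      by (rule uniform_limit_compose'[OF p]) auto
    moreover have "cont (\<lambda>y. \<psi> n (- y + x))" for n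
      by (intro continuous_intros continuous_on_compose2[OF \<psi>c]; simp)
    ultimately have "(\<lambda>m. conv p (\<psi> m) x) \<longlonglongrightarrow> conv p p x"
      unfolding conv_def by (intro uniform_limit_integral integrable_continuous pc)
    then show ?thesis by (simp add: 1 LIMSEQ_const_iff)
  qed
  then have "conv p p = p" by blast
  \<comment> \<open>The value at the identity is the trace of the projection, and
    \<open>B \<ge> 1\<close>.\<close>
  moreover have "p 0 = of_real B"
  proof -
    have "\<psi> n 0 = of_real (b n)" for n unfolding \<psi>_def b_def A[symmetric] by simp
    then have "(\<lambda>n. \<psi> n 0) \<longlonglongrightarrow> of_real B" using b by (simp add: tendsto_of_real)
    then show ?thesis using LIMSEQ_unique[OF pt] by blast
  qed
  then have "p 0 \<noteq> 0" using LB by simp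
  moreover have "(\<integral>x. u x * p x \<partial>\<mu>) = 0"
    if u: "integrable \<mu> u" and z: "\<And>n. (\<integral>x. u x * cpow \<theta> n x \<partial>\<mu>) = 0" for u
  proof -
    have "(\<integral>x. u x * \<psi> n x \<partial>\<mu>) = 0" for n
    proof -
      have "(\<integral>x. u x * \<psi> n x \<partial>\<mu>) = (\<integral>x. of_real (1 / L ^ Suc n) * (u x * cpow \<theta> (2 * n + 1) x) \<partial>\<mu>)"
        unfolding \<psi>_def by (simp only: mult_ac)
      also have "\<dots> = of_real (1 / L ^ Suc n) * (\<integral>x. u x * cpow \<theta> (2 * n + 1) x \<partial>\<mu>)" by simp
      finally show ?thesis using z[of "2 * n + 1"] by simp
    qed
    then show ?thesis using uniform_limit_integral[OF p \<psi>c u] by (simp add: LIMSEQ_const_iff)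
  qed
  ultimately show ?thesis using that[OF pc] by blast
qed

end

section \<open>Schur's lemma\<close>

lemma mat_adjoint_carrier [simp]:
  "A \<in> carrier_mat n m \<Longrightarrow> mat_adjoint A \<in> carrier_mat m n"
  by (auto simp: mat_adjoint_def)

lemma dim_mat_adjoint [simp]:
  "dim_row (mat_adjoint A) = dim_col A" "dim_col (mat_adjoint A) = dim_row A"
  by (auto simp: mat_adjoint_def)

lemma mat_adjoint_index [simp]:
  assumes "i < dim_col A" "j < dim_row A"
  shows "mat_adjoint A $$ (i, j) = cnj (A $$ (j, i))"
  using assms by (auto simp: mat_adjoint_def mat_of_rows_index)

lemma mat_adjoint_adjoint [simp]:
  fixes A :: "complex Matrix.mat"
  shows "mat_adjoint (mat_adjoint A) = A"
  by (rule eq_matI) auto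

lemma mult_mat_index:
  assumes "A \<in> carrier_mat n m" "B \<in> carrier_mat m p" "i < n" "j < p"
  shows "(A * B) $$ (i, j) = (\<Sum>k<m. A $$ (i, k) * B $$ (k, j))"
  using assms by (auto simp: scalar_prod_def lessThan_atLeast0 intro!: sum.cong)

lemma mult_mat_vec_index:
  assumes "A \<in> carrier_mat n m" "v \<in> carrier_vec m" "i < n"
  shows "(A *\<^sub>v v) $ i = (\<Sum>k<m. A $$ (i, k) * v $ k)"
  using assms by (auto simp: scalar_prod_def lessThan_atLeast0 intro!: sum.cong)

lemma mat_adjoint_mult:
  fixes A :: "complex Matrix.mat"
  assumes "A \<in> carrier_mat n m" "B \<in> carrier_mat m p"
  shows "mat_adjoint (A * B) = mat_adjoint B * mat_adjoint A"
proof (rule eq_matI)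
  show "dim_row (mat_adjoint (A * B)) = dim_row (mat_adjoint B * mat_adjoint A)"
    "dim_col (mat_adjoint (A * B)) = dim_col (mat_adjoint B * mat_adjoint A)"
    by auto
  fix i j assume "i < dim_row (mat_adjoint B * mat_adjoint A)" "j < dim_col (mat_adjoint B * mat_adjoint A)"
  then have ij: "i < p" "j < n" using assms by auto
  have "mat_adjoint (A * B) $$ (i, j) = cnj (\<Sum>k<m. A $$ (j, k) * B $$ (k, i))"
    using mat_adjoint_index[of i "A * B" j] ij assms mult_mat_index[OF assms ij(2,1)] by auto
  also have "\<dots> = (\<Sum>k<m. mat_adjoint B $$ (i, k) * mat_adjoint A $$ (k, j))"
    using assms ij by (auto simp: mult.commute)
  also have "\<dots> = (mat_adjoint B * mat_adjoint A) $$ (i, j)"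
    using assms ij by (subst mult_mat_index[of _ p m _ n]) auto
  finally show "mat_adjoint (A * B) $$ (i, j) = (mat_adjoint B * mat_adjoint A) $$ (i, j)" .
qed

lemma mat_adjoint_one [simp]: "mat_adjoint (1\<^sub>m n :: complex Matrix.mat) = 1\<^sub>m n"
  by (rule eq_matI) auto

lemma smult_smult_mat: "k \<cdot>\<^sub>m (l \<cdot>\<^sub>m A) = (k * l :: complex) \<cdot>\<^sub>m A"
  by (rule eq_matI) (auto simp: mult.assoc)

lemma unitary_matD:
  assumes "unitary_mat d U"
  shows "U \<in> carrier_mat d d" "mat_adjoint U \<in> carrier_mat d d"
    "mat_adjoint U * U = 1\<^sub>m d" "U * mat_adjoint U = 1\<^sub>m d"
  using assms by (auto simp: unitary_mat_def)

lemma unitary_matI: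
  assumes "U \<in> carrier_mat d d" "mat_adjoint U * U = 1\<^sub>m d"
  shows "unitary_mat d U"
  using assms mat_mult_left_right_inverse[of "mat_adjoint U" d U] by (simp add: unitary_mat_def)

lemma unitary_mat_adjoint: "unitary_mat d U \<Longrightarrow> unitary_mat d (mat_adjoint U)"
  by (auto simp: unitary_mat_def)

lemma unitary_mat_one: "unitary_mat d (1\<^sub>m d)"
  by (auto simp: unitary_mat_def)

lemma mult_cancel_middle:
  assumes "A \<in> carrier_mat d d" "B \<in> carrier_mat d d" "C \<in> carrier_mat d d" "D \<in> carrier_mat d d"
    and "B * C = 1\<^sub>m d"
  shows "(A * B) * (C * D) = A * (D :: complex Matrix.mat)"
proof -
  have "(A * B) * (C * D) = A * (B * (C * D))"
    using assms by (intro assoc_mult_mat[of _ d d _ d _ d]) auto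
  also have "B * (C * D) = (B * C) * D"
    using assms by (intro assoc_mult_mat[of _ d d _ d _ d, symmetric]) auto
  finally have "(A * B) * (C * D) = A * ((B * C) * D)" .
  then show ?thesis using assms by simp
qed

lemma unitary_mat_mult:
  assumes "unitary_mat d U" "unitary_mat d V"
  shows "unitary_mat d (U * V)"
proof (rule unitary_matI)
  note U = unitary_matD[OF assms(1)] and V = unitary_matD[OF assms(2)]
  show "U * V \<in> carrier_mat d d" using U V by simp
  have "mat_adjoint (U * V) * (U * V) = (mat_adjoint V * mat_adjoint U) * (U * V)"
    by (simp add: mat_adjoint_mult[OF U(1) V(1)])
  then show "mat_adjoint (U * V) * (U * V) = 1\<^sub>m d"
    using mult_cancel_middle[OF V(2) U(2) U(1) V(1) U(3)] V(3) by simp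
qed

lemma unitary_mat_columns:
  assumes U: "unitary_mat d U" and ij: "i < d" "j < d"
  shows "(\<Sum>k<d. U $$ (k, i) * cnj (U $$ (k, j))) = (if i = j then 1 else 0)"
proof -
  have "(mat_adjoint U * U) $$ (j, i) = (\<Sum>k<d. cnj (U $$ (k, j)) * U $$ (k, i))"
    using unitary_matD[OF U] ij by (subst mult_mat_index[of _ d d _ d]) auto
  then show ?thesis using unitary_matD[OF U] ij by (auto simp: mult.commute split: if_splits)
qed

text \<open>Columns of a unitary matrix have length 1. This is the source of the uniform bound 1 on
  the atoms.\<close>

lemma norm_unitary_mat_le:
  assumes U: "unitary_mat d U" and ij: "i < d" "j < d"
  shows "norm (U $$ (i, j)) \<le> 1"
proof -
  have "complex_of_real (\<Sum>k<d. (norm (U $$ (k, j)))\<^sup>2) = 1"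
    using unitary_mat_columns[OF U ij(2) ij(2)] by (simp only: of_real_sum complex_norm_square) simp
  then have "(\<Sum>k<d. (norm (U $$ (k, j)))\<^sup>2) = 1" using of_real_eq_1_iff by blast
  then have "(norm (U $$ (i, j)))\<^sup>2 \<le> 1"
    using member_le_sum[of i "{..<d}" "\<lambda>k. (norm (U $$ (k, j)))\<^sup>2"] ij by simp
  then show ?thesis using power2_le_imp_le[of "norm (U $$ (i, j))" 1] by simp
qed

lemma subspace_module_vec_iff:
  "VectorSpace.subspace class_ring W (module_vec TYPE(complex) d) \<longleftrightarrow>
     W \<subseteq> carrier_vec d \<and> 0\<^sub>v d \<in> W \<and> (\<forall>v\<in>W. \<forall>w\<in>W. v + w \<in> W) \<and> (\<forall>c. \<forall>v\<in>W. c \<cdot>\<^sub>v v \<in> W)"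
  unfolding VectorSpace.subspace_def submodule_def
  using vec_vs[of d] vec_module[of d] by (auto simp: module_vec_simps)

section \<open>Irreducible representations and their intertwiners\<close>

lemma irreducible_repD:
  assumes "irreducible_rep d \<pi>"
  shows "unitary_rep d \<pi>" "d > 0" "\<And>x. unitary_mat d (\<pi> x)" "\<pi> 0 = 1\<^sub>m d" "\<And>x y. \<pi> (x + y) = \<pi> x * \<pi> y"
    "\<And>i j. i < d \<Longrightarrow> j < d \<Longrightarrow> continuous_on UNIV (\<lambda>x. \<pi> x $$ (i, j))"
    "\<And>x. \<pi> x \<in> carrier_mat d d"
  using assms by (auto simp: irreducible_rep_def unitary_rep_def unitary_mat_def)

lemma irreducible_repD_subspace:
  assumes "irreducible_rep d \<pi>" "W \<subseteq> carrier_vec d" "0\<^sub>v d \<in> W" "\<And>v w. v \<in> W \<Longrightarrow> w \<in> W \<Longrightarrow> v + w \<in> W"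
    "\<And>c v. v \<in> W \<Longrightarrow> c \<cdot>\<^sub>v v \<in> W" "\<And>x v. v \<in> W \<Longrightarrow> \<pi> x *\<^sub>v v \<in> W" "v \<in> W" "v \<noteq> 0\<^sub>v d"
  shows "W = carrier_vec d"
proof -
  have "VectorSpace.subspace class_ring W (module_vec TYPE(complex) d)"
    using assms by (simp add: subspace_module_vec_iff)
  then have "W = {0\<^sub>v d} \<or> W = carrier_vec d"
    using assms unfolding irreducible_rep_def by blast
  then show ?thesis using assms(7,8) by blast
qed

lemma rep_minus:
  assumes "irreducible_rep d \<pi>"
  shows "\<pi> (- x) = mat_adjoint (\<pi> x)"
proof -
  note D = irreducible_repD[OF assms]
  have "\<pi> (- x) = (mat_adjoint (\<pi> x) * \<pi> x) * \<pi> (- x)"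
    using unitary_matD[OF D(3)[of x]] D(7)[of "- x"] by simp
  also have "\<dots> = mat_adjoint (\<pi> x) * (\<pi> x * \<pi> (- x))"
    using D(7) by (simp add: assoc_mult_mat[of _ d d _ d _ d])
  also have "\<pi> x * \<pi> (- x) = 1\<^sub>m d" using D(5)[of x "- x"] D(4) by simp
  finally show ?thesis
    using right_mult_one_mat[of "mat_adjoint (\<pi> x)" d d] D(7)[of x] by simp
qed

lemma rep_dim_irreducible:
  assumes "irreducible_rep d \<pi>"
  shows "rep_dim \<pi> = d"
  using irreducible_repD(4)[OF assms] by (simp add: rep_dim_def)

lemma irreps_rep_dim: "\<pi> \<in> irreps \<Longrightarrow> irreducible_rep (rep_dim \<pi>) \<pi>"
  by (auto simp: irreps_def rep_dim_irreducible)

text \<open>Over the complex numbers \<open>T\<close> has an eigenvalue; its eigenspace is invariant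
  because \<open>T\<close> commutes with the representation, so it is the whole space.\<close>

lemma Schur_scalar:
  assumes \<pi>: "irreducible_rep d \<pi>" and T: "T \<in> carrier_mat d d" and comm: "\<And>x. \<pi> x * T = T * \<pi> x"
  obtains c where "T = c \<cdot>\<^sub>m 1\<^sub>m d"
proof -
  note D = irreducible_repD[OF \<pi>]
  obtain c v where v: "eigenvector T v c"
    using spectrum_non_empty[OF T D(2)] by (auto simp: spectrum_def eigenvalue_def)
  define W where "W = {w \<in> carrier_vec d. T *\<^sub>v w = c \<cdot>\<^sub>v w}"
  have "W = carrier_vec d"
  proof (rule irreducible_repD_subspace[OF \<pi>])
    show "W \<subseteq> carrier_vec d" by (auto simp: W_def)
    show "0\<^sub>v d \<in> W" using T by (auto simp: W_def)
    show "a + b \<in> W" if "a \<in> W" "b \<in> W" for a b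
      using that T by (auto simp: W_def mult_add_distrib_mat_vec[OF T] smult_add_distrib_vec[of _ d])
    show "k \<cdot>\<^sub>v a \<in> W" if "a \<in> W" for k a
      using that T by (auto simp: W_def mult_mat_vec[OF T] smult_smult_assoc mult.commute)
    show "\<pi> x *\<^sub>v a \<in> W" if "a \<in> W" for x a
    proof -
      have a: "a \<in> carrier_vec d" "T *\<^sub>v a = c \<cdot>\<^sub>v a" using that by (auto simp: W_def)
      have "T *\<^sub>v (\<pi> x *\<^sub>v a) = (T * \<pi> x) *\<^sub>v a"
        using assoc_mult_mat_vec[OF T D(7) a(1)] by simp
      also have "\<dots> = \<pi> x *\<^sub>v (T *\<^sub>v a)"
        using assoc_mult_mat_vec[OF D(7) T a(1)] comm by simp
      also have "\<dots> = c \<cdot>\<^sub>v (\<pi> x *\<^sub>v a)" using a mult_mat_vec[OF D(7) a(1)] by simp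
      finally show ?thesis using a D(7)[of x] by (auto simp: W_def)
    qed
    show "v \<in> W" "v \<noteq> 0\<^sub>v d" using v T by (auto simp: W_def eigenvector_def)
  qed
  then have all: "T *\<^sub>v w = c \<cdot>\<^sub>v w" if "w \<in> carrier_vec d" for w using that by (auto simp: W_def)
  have "T = c \<cdot>\<^sub>m 1\<^sub>m d"
  proof (rule eq_matI)
    fix i j assume "i < dim_row (c \<cdot>\<^sub>m 1\<^sub>m d)" "j < dim_col (c \<cdot>\<^sub>m 1\<^sub>m d)"
    then have ij: "i < d" "j < d" by auto
    have "T $$ (i, j) = (T *\<^sub>v unit_vec d j) $ i"
      using ij T scalar_prod_right_unit[of j d "row T i"] by auto
    then show "T $$ (i, j) = (c \<cdot>\<^sub>m 1\<^sub>m d) $$ (i, j)"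
      using all[of "unit_vec d j"] ij by simp
  qed (use T in auto)
  then show ?thesis using that by blast
qed

text \<open>With \<open>S\<close> the adjoint of \<open>T\<close>, both \<open>T * S\<close> and
  \<open>S * T\<close> are intertwiners of irreducible representations, hence scalar. Associativity
  of \<open>T * S * T\<close> makes the two scalars equal, equality of traces makes the dimensions
  equal, and a positive multiple of \<open>T\<close> is then unitary.\<close>

lemma Schur_intertwiner:
  assumes \<pi>: "irreducible_rep d \<pi>" and \<rho>: "irreducible_rep d' \<rho>"
    and T: "T \<in> carrier_mat d d'" and inter: "\<And>x. \<pi> x * T = T * \<rho> x"
    and nz: "T \<noteq> 0\<^sub>m d d'"
  shows "(\<rho>, \<pi>) \<in> unitary_equiv"
proof -
  note P = irreducible_repD[OF \<pi>] and R = irreducible_repD[OF \<rho>]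
  define S where "S = mat_adjoint T"
  have S: "S \<in> carrier_mat d' d" using T by (simp add: S_def)
  have interS: "\<rho> x * S = S * \<pi> x" for x
  proof -
    have "mat_adjoint (\<pi> (- x) * T) = mat_adjoint (T * \<rho> (- x))" using inter by simp
    then show ?thesis
      using mat_adjoint_mult[OF P(7) T, of "- x"] mat_adjoint_mult[OF T R(7), of "- x"]
        P(7)[of x] R(7)[of x] by (simp add: S_def rep_minus[OF \<pi>] rep_minus[OF \<rho>])
  qed
  have "\<pi> x * (T * S) = (T * S) * \<pi> x" for x
    using inter[of x] interS[of x] assoc_mult_mat[OF P(7)[of x] T S] assoc_mult_mat[OF T S P(7)[of x]]
      assoc_mult_mat[OF T R(7)[of x] S] by simp
  then obtain c where c: "T * S = c \<cdot>\<^sub>m 1\<^sub>m d" using Schur_scalar[OF \<pi>, of "T * S"] T S by auto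
  have "\<rho> x * (S * T) = (S * T) * \<rho> x" for x
    using inter[of x] interS[of x] assoc_mult_mat[OF R(7)[of x] S T] assoc_mult_mat[OF S T R(7)[of x]]
      assoc_mult_mat[OF S P(7)[of x] T] by simp
  then obtain c' where c': "S * T = c' \<cdot>\<^sub>m 1\<^sub>m d'" using Schur_scalar[OF \<rho>, of "S * T"] T S by auto
  have TS: "(\<Sum>k<d'. T $$ (i, k) * cnj (T $$ (i, k))) = c" if "i < d" for i
  proof -
    have "(T * S) $$ (i, i) = (\<Sum>k<d'. T $$ (i, k) * cnj (T $$ (i, k)))"
      using T that by (subst mult_mat_index[OF T S]) (auto simp: S_def)
    then show ?thesis using c that by simp
  qed
  have ST: "(\<Sum>k<d. T $$ (k, j) * cnj (T $$ (k, j))) = c'" if "j < d'" for j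
  proof -
    have "(S * T) $$ (j, j) = (\<Sum>k<d. T $$ (k, j) * cnj (T $$ (k, j)))"
      using T that by (subst mult_mat_index[OF S T]) (auto simp: S_def mult.commute)
    then show ?thesis using c' that by simp
  qed
  \<comment> \<open>The scalar \<open>c\<close> is the common squared length of the rows of
    \<open>T\<close>, so it is real; row 0 exists because \<open>d > 0\<close>.\<close>
  define a where "a = (\<Sum>k<d'. (norm (T $$ (0, k)))\<^sup>2)"
  have ca: "c = complex_of_real a"
    unfolding a_def using TS[OF P(2)] by (simp only: of_real_sum complex_norm_square)
  have "a \<ge> 0" by (simp add: a_def sum_nonneg)
  moreover have "a \<noteq> 0"
  proof
    assume "a = 0"
    have "T $$ (i, k) = 0" if "i < d" "k < d'" for i k
    proof -
      have "complex_of_real (\<Sum>k<d'. (norm (T $$ (i, k)))\<^sup>2) = 0"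
        using TS[OF that(1)] ca \<open>a = 0\<close> by (simp only: of_real_sum complex_norm_square) simp
      then have "(\<Sum>k<d'. (norm (T $$ (i, k)))\<^sup>2) = 0" using of_real_eq_0_iff by blast
      then show ?thesis using that by (simp add: sum_nonneg_eq_0_iff)
    qed
    then have "T = 0\<^sub>m d d'" using T by (intro eq_matI) auto
    then show False using nz by simp
  qed
  ultimately have a: "a > 0" by simp
  have "(T * S) * T = T * (S * T)" using assoc_mult_mat[OF T S T] .
  then have eqT: "c \<cdot>\<^sub>m T = c' \<cdot>\<^sub>m T"
    using T by (simp add: c c' mult_smult_distrib[OF T one_carrier_mat] mult_smult_assoc_mat[OF one_carrier_mat T])
  have cc': "c = c'"
  proof (rule ccontr)
    assume "c \<noteq> c'"
    have "T $$ (i, k) = 0" if "i < d" "k < d'" for i k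
    proof -
      have "(c \<cdot>\<^sub>m T) $$ (i, k) = (c' \<cdot>\<^sub>m T) $$ (i, k)" using eqT by simp
      then show ?thesis using that T \<open>c \<noteq> c'\<close> by simp
    qed
    then have "T = 0\<^sub>m d d'" using T by (intro eq_matI) auto
    then show False using nz by simp
  qed
  \<comment> \<open>The squared entries of \<open>T\<close> summed by rows and by columns: the
    traces of \<open>T * S\<close> and \<open>S * T\<close>.\<close>
  have "of_nat d * c = (\<Sum>i<d. \<Sum>k<d'. T $$ (i, k) * cnj (T $$ (i, k)))"
    using TS by simp
  also have "\<dots> = (\<Sum>k<d'. \<Sum>i<d. T $$ (i, k) * cnj (T $$ (i, k)))" by (rule sum.swap)
  also have "\<dots> = of_nat d' * c'" using ST by simp
  finally have "of_nat d * c' = of_nat d' * c'" using cc' by simp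
  moreover have "c' \<noteq> 0" using cc' ca a by auto
  ultimately have dd: "d = d'" by simp
  define s where "s = complex_of_real (1 / sqrt a)"
  define U where "U = s \<cdot>\<^sub>m T"
  have U: "U \<in> carrier_mat d d" using T dd by (simp add: U_def)
  have "s * s * c = 1" using a ca by (simp add: s_def flip: of_real_mult)
  have "mat_adjoint U = s \<cdot>\<^sub>m S"
    using T by (intro eq_matI) (auto simp: U_def S_def s_def mat_adjoint_def mat_of_rows_index)
  then have "mat_adjoint U * U = (s * s) \<cdot>\<^sub>m (S * T)"
    using S T by (simp add: U_def mult_smult_distrib[OF S T] mult_smult_assoc_mat[OF S T]
      mult_smult_assoc_mat[of _ d' d _ d'] smult_smult_mat)
  also have "\<dots> = 1\<^sub>m d"
    using \<open>s * s * c = 1\<close> dd by (intro eq_matI) (auto simp: c' cc'[symmetric] smult_smult_mat)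
  finally have "unitary_mat d U" by (intro unitary_matI U)
  moreover have "U * \<rho> x = \<pi> x * U" for x
    using inter[of x] T P(7)[of x] R(7)[of x] by (simp add: U_def mult_smult_distrib[of _ d d _ d'] mult_smult_assoc_mat[of _ d d' _ d'])
  moreover have "\<rho> \<in> irreps" "\<pi> \<in> irreps" using \<pi> \<rho> by (auto simp: irreps_def)
  ultimately show ?thesis
    using rep_dim_irreducible[OF \<pi>] rep_dim_irreducible[OF \<rho>] dd by (auto simp: unitary_equiv_def)
qed

section \<open>Equivalence and orthogonality of irreducible representations\<close>

text \<open>Multiplication by \<open>U\<close> carries invariant subspaces of the conjugate to
  invariant subspaces of \<open>\<pi>\<close>. This permits writing a representation in another
  orthonormal basis.\<close>

lemma irreducible_rep_unitary_conj:
  assumes \<pi>: "irreducible_rep d \<pi>" and U: "unitary_mat d U"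
  shows "irreducible_rep d (\<lambda>x. mat_adjoint U * \<pi> x * U)"
proof -
  note P = irreducible_repD[OF \<pi>] and UD = unitary_matD[OF U]
  define \<tau> where "\<tau> x = mat_adjoint U * \<pi> x * U" for x
  have \<tau>c: "\<tau> x \<in> carrier_mat d d" for x unfolding \<tau>_def by (rule mult_carrier_mat[OF mult_carrier_mat[OF UD(2) P(7)] UD(1)])
  have \<tau>2: "\<tau> x = mat_adjoint U * (\<pi> x * U)" for x
    unfolding \<tau>_def by (rule assoc_mult_mat[OF UD(2) P(7) UD(1)])
  have U\<tau>: "U * \<tau> x = \<pi> x * U" for x
  proof -
    have "U * \<tau> x = (U * mat_adjoint U) * (\<pi> x * U)"
      unfolding \<tau>2 using UD P(7)[of x] by (intro assoc_mult_mat[of _ d d _ d _ d, symmetric]) auto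
    then show ?thesis using UD P(7)[of x] by simp
  qed
  have "unitary_mat d (\<tau> x)" for x
    unfolding \<tau>_def by (intro unitary_mat_mult unitary_mat_adjoint U P)
  moreover have "\<tau> 0 = 1\<^sub>m d"
    using UD P(4) right_mult_one_mat[OF UD(2)] by (simp add: \<tau>_def)
  moreover have "\<tau> (x + y) = \<tau> x * \<tau> y" for x y
  proof -
    have "\<tau> x * \<tau> y = (mat_adjoint U * \<pi> x) * (\<pi> y * U)"
      unfolding \<tau>2[of y] \<tau>_def[of x] using UD P(7)[of x] P(7)[of y]
      by (intro mult_cancel_middle) auto
    also have "\<dots> = mat_adjoint U * (\<pi> x * (\<pi> y * U))"
      using UD P(7)[of x] P(7)[of y] by (intro assoc_mult_mat[of _ d d _ d _ d]) auto
    also have "\<pi> x * (\<pi> y * U) = \<pi> (x + y) * U"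
      unfolding P(5) using UD P(7)[of x] P(7)[of y] by (intro assoc_mult_mat[of _ d d _ d _ d, symmetric]) auto
    finally show ?thesis by (simp add: \<tau>2)
  qed
  moreover have "continuous_on UNIV (\<lambda>x. \<tau> x $$ (i, j))" if "i < d" "j < d" for i j
  proof -
    have "\<tau> x $$ (i, j) = (\<Sum>l<d. (\<Sum>k<d. mat_adjoint U $$ (i, k) * \<pi> x $$ (k, l)) * U $$ (l, j))" for x
      unfolding \<tau>_def mult_mat_index[OF mult_carrier_mat[OF UD(2) P(7)] UD(1) that]
      by (intro sum.cong refl) (simp only: mult_mat_index[OF UD(2) P(7) that(1)] lessThan_iff)
    then show ?thesis using P(6) by (auto intro!: continuous_intros)
  qed
  ultimately have "unitary_rep d \<tau>" by (auto simp: unitary_rep_def)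
  moreover have "W = {0\<^sub>v d} \<or> W = carrier_vec d"
    if subW: "VectorSpace.subspace class_ring W (module_vec TYPE(complex) d)"
      and invW: "\<And>x w. w \<in> W \<Longrightarrow> \<tau> x *\<^sub>v w \<in> W" for W
  proof -
    have W: "W \<subseteq> carrier_vec d" "0\<^sub>v d \<in> W" "\<And>v w. v \<in> W \<Longrightarrow> w \<in> W \<Longrightarrow> v + w \<in> W"
      "\<And>c v. v \<in> W \<Longrightarrow> c \<cdot>\<^sub>v v \<in> W"
      using subW by (auto simp: subspace_module_vec_iff)
    define W2 where "W2 = (\<lambda>w. U *\<^sub>v w) ` W"
    have undo: "mat_adjoint U *\<^sub>v (U *\<^sub>v w) = w" if "w \<in> carrier_vec d" for w
      using assoc_mult_mat_vec[OF UD(2,1) that] UD(3) that by simp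
    have sub2: "VectorSpace.subspace class_ring W2 (module_vec TYPE(complex) d)"
      unfolding subspace_module_vec_iff
    proof (intro conjI ballI allI)
      show "W2 \<subseteq> carrier_vec d" using W(1) UD(1) by (auto simp: W2_def)
      show "0\<^sub>v d \<in> W2" unfolding W2_def using W(2) UD(1) by (intro image_eqI[of _ _ "0\<^sub>v d"]) auto
      fix v assume "v \<in> W2"
      then obtain v' where v': "v' \<in> W" "v = U *\<^sub>v v'" by (auto simp: W2_def)
      show "c \<cdot>\<^sub>v v \<in> W2" for c
        unfolding W2_def using v' W(4)[of v' c] mult_mat_vec[OF UD(1) subsetD[OF W(1) v'(1)], of c]
        by (intro image_eqI[of _ _ "c \<cdot>\<^sub>v v'"]) auto
      fix w assume "w \<in> W2"
      then obtain w' where w': "w' \<in> W" "w = U *\<^sub>v w'" by (auto simp: W2_def)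
      show "v + w \<in> W2"
        unfolding W2_def using v' w' W(3)[of v' w']
          mult_add_distrib_mat_vec[OF UD(1) subsetD[OF W(1) v'(1)] subsetD[OF W(1) w'(1)]]
        by (intro image_eqI[of _ _ "v' + w'"]) auto
    qed
    have "\<pi> x *\<^sub>v w \<in> W2" if w: "w \<in> W2" for x w
    proof -
      obtain w' where w': "w' \<in> W" "w = U *\<^sub>v w'" using w by (auto simp: W2_def)
      have c: "w' \<in> carrier_vec d" using w' W(1) by auto
      have "\<pi> x *\<^sub>v w = U *\<^sub>v (\<tau> x *\<^sub>v w')"
        using assoc_mult_mat_vec[OF P(7)[of x] UD(1) c] assoc_mult_mat_vec[OF UD(1) \<tau>c[of x] c] U\<tau>[of x] w'
        by simp
      then show ?thesis using invW[OF w'(1)] by (auto simp: W2_def)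
    qed
    then consider "W2 = {0\<^sub>v d}" | "W2 = carrier_vec d"
      using \<pi> sub2 unfolding irreducible_rep_def by blast
    then show ?thesis
    proof cases
      case 1
      have "w = 0\<^sub>v d" if "w \<in> W" for w
      proof -
        have "U *\<^sub>v w = 0\<^sub>v d" using 1 that by (auto simp: W2_def)
        moreover have "mat_adjoint U *\<^sub>v 0\<^sub>v d = 0\<^sub>v d" using mult_mat_vec_index[OF UD(2), of "0\<^sub>v d"] UD(2) by (intro eq_vecI) auto
        ultimately show ?thesis using undo[OF subsetD[OF W(1) that]] by simp
      qed
      then show ?thesis using W(2) by blast
    next
      case 2
      have "w \<in> W" if w: "w \<in> carrier_vec d" for w
      proof -
        have "U *\<^sub>v w \<in> W2" using 2 UD(1) w by auto
        then obtain w' where w': "w' \<in> W" "U *\<^sub>v w = U *\<^sub>v w'" by (auto simp: W2_def)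
        have "w' = w" using undo[OF w] undo[OF subsetD[OF W(1) w'(1)]] w'(2) by metis
        then show ?thesis using w'(1) by simp
      qed
      then show ?thesis using W(1) by blast
    qed
  qed
  ultimately have "irreducible_rep d \<tau>" using P(2) unfolding irreducible_rep_def by blast
  then show ?thesis unfolding \<tau>_def[abs_def] .
qed

section \<open>Unitary equivalence\<close>

lemma unitary_equivI:
  assumes "irreducible_rep d \<pi>" "irreducible_rep d \<rho>" "unitary_mat d U" "\<And>x. U * \<pi> x = \<rho> x * U"
  shows "(\<pi>, \<rho>) \<in> unitary_equiv"
  using assms rep_dim_irreducible[OF assms(1)] rep_dim_irreducible[OF assms(2)]
  by (auto simp: unitary_equiv_def irreps_def)

lemma unitary_equivE:
  assumes "(\<pi>, \<rho>) \<in> unitary_equiv"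
  obtains d U where "irreducible_rep d \<pi>" "irreducible_rep d \<rho>" "unitary_mat d U" "\<And>x. U * \<pi> x = \<rho> x * U"
  using assms irreps_rep_dim[of \<pi>] irreps_rep_dim[of \<rho>] unfolding unitary_equiv_def by auto

lemma unitary_equiv_sym:
  assumes "(\<pi>, \<rho>) \<in> unitary_equiv"
  shows "(\<rho>, \<pi>) \<in> unitary_equiv"
  using assms
proof (rule unitary_equivE)
  fix d U assume \<pi>: "irreducible_rep d \<pi>" and \<rho>: "irreducible_rep d \<rho>" and U: "unitary_mat d U"
    and eq: "\<And>x. U * \<pi> x = \<rho> x * U"
  note P = irreducible_repD[OF \<pi>] and R = irreducible_repD[OF \<rho>] and UD = unitary_matD[OF U]
  have "mat_adjoint U * \<rho> x = \<pi> x * mat_adjoint U" for x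
  proof -
    have "mat_adjoint U * \<rho> x = mat_adjoint U * (\<rho> x * (U * mat_adjoint U))"
      using UD R(7)[of x] right_mult_one_mat[of "\<rho> x" d d] by simp
    also have "\<rho> x * (U * mat_adjoint U) = U * \<pi> x * mat_adjoint U"
      unfolding eq using UD R(7)[of x] by (intro assoc_mult_mat[of _ d d _ d _ d, symmetric]) auto
    also have "\<dots> = U * (\<pi> x * mat_adjoint U)"
      using UD P(7)[of x] by (intro assoc_mult_mat[of _ d d _ d _ d]) auto
    also have "mat_adjoint U * (U * (\<pi> x * mat_adjoint U)) = (mat_adjoint U * U) * (\<pi> x * mat_adjoint U)"
      using UD P(7)[of x] by (intro assoc_mult_mat[of _ d d _ d _ d, symmetric]) auto
    finally show ?thesis using UD P(7)[of x] by simp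
  qed
  then show ?thesis by (intro unitary_equivI[OF \<rho> \<pi> unitary_mat_adjoint[OF U]])
qed

lemma unitary_equiv_trans:
  assumes "(\<pi>, \<rho>) \<in> unitary_equiv" "(\<rho>, \<kappa>) \<in> unitary_equiv"
  shows "(\<pi>, \<kappa>) \<in> unitary_equiv"
proof -
  obtain d U where 1: "irreducible_rep d \<pi>" "irreducible_rep d \<rho>" "unitary_mat d U" "\<And>x. U * \<pi> x = \<rho> x * U"
    using unitary_equivE[OF assms(1)] by blast
  obtain d' V where 2: "irreducible_rep d' \<rho>" "irreducible_rep d' \<kappa>" "unitary_mat d' V" "\<And>x. V * \<rho> x = \<kappa> x * V"
    using unitary_equivE[OF assms(2)] by blast
  have d: "d' = d" using rep_dim_irreducible[OF 1(2)] rep_dim_irreducible[OF 2(1)] by simp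
  note c = irreducible_repD(7)[OF 1(1)] irreducible_repD(7)[OF 1(2)] irreducible_repD(7)[OF 2(2), unfolded d]
    unitary_matD(1)[OF 1(3)] unitary_matD(1)[OF 2(3), unfolded d]
  have "V * U * \<pi> x = \<kappa> x * (V * U)" for x
    using assoc_mult_mat[OF c(5,4) c(1)[of x]] assoc_mult_mat[OF c(5) c(2)[of x] c(4)]
      assoc_mult_mat[OF c(3)[of x] c(5,4)] 1(4)[of x] 2(4)[of x] by simp
  then show ?thesis
    using 1 2 d by (intro unitary_equivI[of d \<pi> \<kappa> "V * U"] unitary_mat_mult) auto
qed

lemma unitary_equiv_refl:
  assumes "\<pi> \<in> irreps"
  shows "(\<pi>, \<pi>) \<in> unitary_equiv"
proof (rule unitary_equivI[OF irreps_rep_dim[OF assms] irreps_rep_dim[OF assms] unitary_mat_one])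
  fix x
  have "\<pi> x \<in> carrier_mat (rep_dim \<pi>) (rep_dim \<pi>)"
    by (rule irreducible_repD(7)[OF irreps_rep_dim[OF assms]])
  then show "1\<^sub>m (rep_dim \<pi>) * \<pi> x = \<pi> x * 1\<^sub>m (rep_dim \<pi>)"
    by (simp only: left_mult_one_mat right_mult_one_mat)
qed

lemma equiv_unitary_equiv: "equiv irreps unitary_equiv"
proof (rule equivI)
  show "unitary_equiv \<subseteq> irreps \<times> irreps" by (auto simp: unitary_equiv_def)
  show "refl_on irreps unitary_equiv" by (auto simp: refl_on_def intro: unitary_equiv_refl)
  show "sym unitary_equiv" by (auto intro: symI unitary_equiv_sym)
  show "trans unitary_equiv" by (auto intro: transI unitary_equiv_trans)
qed

section \<open>Schur orthogonality relations\<close>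

context haar_compact
begin

lemma rep_cont: "irreducible_rep d \<pi> \<Longrightarrow> i < d \<Longrightarrow> j < d \<Longrightarrow> cont (\<lambda>x. \<pi> x $$ (i, j))"
  by (rule irreducible_repD(6))

lemma rep_add_index:
  assumes "irreducible_rep d \<pi>" "i < d" "j < d"
  shows "\<pi> (x + y) $$ (i, j) = (\<Sum>k<d. \<pi> x $$ (i, k) * \<pi> y $$ (k, j))"
  unfolding irreducible_repD(5)[OF assms(1)]
  by (rule mult_mat_index[OF irreducible_repD(7)[OF assms(1)] irreducible_repD(7)[OF assms(1)] assms(2,3)])

lemma rep_minus_index:
  assumes "irreducible_rep d \<pi>" "i < d" "j < d"
  shows "\<pi> (- x) $$ (i, j) = cnj (\<pi> x $$ (j, i))"
  using irreducible_repD(7)[OF assms(1), of x] assms by (simp add: rep_minus)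

text \<open>\<open>T\<close> is the average over \<open>x\<close> of the product of
  \<open>\<pi> x\<close>, the matrix unit at \<open>(k, l)\<close> and the adjoint of
  \<open>\<rho> x\<close>; averaging over the group produces an intertwiner.\<close>

lemma integral_rep_intertwines:
  assumes \<pi>: "irreducible_rep d \<pi>" and \<rho>: "irreducible_rep d' \<rho>" and kl: "k < d" "l < d'"
  defines "T \<equiv> mat d d' (\<lambda>(i, j). \<integral>x. \<pi> x $$ (i, k) * cnj (\<rho> x $$ (j, l)) \<partial>\<mu>)"
  shows "\<pi> y * T = T * \<rho> y"
proof (rule eq_matI)
  note P = irreducible_repD[OF \<pi>] and R = irreducible_repD[OF \<rho>]
  have T: "T \<in> carrier_mat d d'" by (simp add: T_def)
  show "dim_row (\<pi> y * T) = dim_row (T * \<rho> y)" "dim_col (\<pi> y * T) = dim_col (T * \<rho> y)"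
    using P(7)[of y] R(7)[of y] T by auto
  fix i j assume "i < dim_row (T * \<rho> y)" "j < dim_col (T * \<rho> y)"
  then have ij: "i < d" "j < d'" using T R(7)[of y] by auto
  have int: "integrable \<mu> (\<lambda>x. \<pi> x $$ (m, k) * cnj (\<rho> x $$ (n, l)))" if "m < d" "n < d'" for m n
    by (intro integrable_continuous continuous_intros P R that kl)
  have "(\<pi> y * T) $$ (i, j) = (\<Sum>m<d. \<pi> y $$ (i, m) * (\<integral>x. \<pi> x $$ (m, k) * cnj (\<rho> x $$ (j, l)) \<partial>\<mu>))"
    unfolding mult_mat_index[OF P(7) T ij] using ij by (simp add: T_def)
  also have "\<dots> = (\<Sum>m<d. \<integral>x. \<pi> y $$ (i, m) * (\<pi> x $$ (m, k) * cnj (\<rho> x $$ (j, l))) \<partial>\<mu>)"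
    by simp
  also have "\<dots> = (\<integral>x. (\<Sum>m<d. \<pi> y $$ (i, m) * (\<pi> x $$ (m, k) * cnj (\<rho> x $$ (j, l)))) \<partial>\<mu>)"
    using int ij by (intro Bochner_Integration.integral_sum[symmetric]) auto
  also have "\<dots> = (\<integral>x. \<pi> (y + x) $$ (i, k) * cnj (\<rho> x $$ (j, l)) \<partial>\<mu>)"
    by (simp add: rep_add_index[OF \<pi> ij(1) kl(1)] sum_distrib_right mult.assoc)
  \<comment> \<open>Translation by \<open>- y\<close> moves the group element from \<pi> to
    \<rho>.\<close>
  also have "\<dots> = (\<integral>x. \<pi> (y + (- y + x)) $$ (i, k) * cnj (\<rho> (- y + x) $$ (j, l)) \<partial>\<mu>)"
    by (rule integral_translate_cont[symmetric])
       (intro continuous_intros P R continuous_on_compose2[OF P(6)] kl ij subset_UNIV)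
  also have "\<dots> = (\<integral>x. (\<Sum>m<d'. \<rho> y $$ (m, j) * (\<pi> x $$ (i, k) * cnj (\<rho> x $$ (m, l)))) \<partial>\<mu>)"
  proof -
    have "cnj (\<rho> (- y + x) $$ (j, l)) = (\<Sum>m<d'. \<rho> y $$ (m, j) * cnj (\<rho> x $$ (m, l)))" for x
      using ij by (simp add: rep_add_index[OF \<rho> ij(2) kl(2)] rep_minus_index[OF \<rho>])
    then show ?thesis
      by (simp add: add.assoc[symmetric] sum_distrib_left mult_ac)
  qed
  also have "\<dots> = (\<Sum>m<d'. \<integral>x. \<rho> y $$ (m, j) * (\<pi> x $$ (i, k) * cnj (\<rho> x $$ (m, l))) \<partial>\<mu>)"
    using int ij by (intro Bochner_Integration.integral_sum) auto
  also have "\<dots> = (\<Sum>m<d'. T $$ (i, m) * \<rho> y $$ (m, j))"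
    using ij by (simp add: T_def mult.commute)
  also have "\<dots> = (T * \<rho> y) $$ (i, j)" using mult_mat_index[OF T R(7) ij] by simp
  finally show "(\<pi> y * T) $$ (i, j) = (T * \<rho> y) $$ (i, j)" .
qed

lemma Schur_orthogonality_inequivalent:
  assumes \<pi>: "irreducible_rep d \<pi>" and \<rho>: "irreducible_rep d' \<rho>" and ne: "(\<rho>, \<pi>) \<notin> unitary_equiv"
    and "i < d" "k < d" "j < d'" "l < d'"
  shows "(\<integral>x. \<pi> x $$ (i, k) * cnj (\<rho> x $$ (j, l)) \<partial>\<mu>) = 0"
proof -
  define T where "T = mat d d' (\<lambda>(i, j). \<integral>x. \<pi> x $$ (i, k) * cnj (\<rho> x $$ (j, l)) \<partial>\<mu>)"
  have "T = 0\<^sub>m d d'"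
    using Schur_intertwiner[OF \<pi> \<rho>, of T] integral_rep_intertwines[OF \<pi> \<rho> assms(5,7)] ne
    by (auto simp: T_def)
  then have "T $$ (i, j) = 0" using assms by simp
  then show ?thesis using assms by (simp add: T_def)
qed

text \<open>The averaged matrix is a scalar \<open>c\<close>. Its trace integrates the inner product
  of columns \<open>k\<close> and \<open>l\<close> of a unitary matrix, so
  \<open>of_nat d * c\<close> is 1 or 0.\<close>

lemma Schur_orthogonality_same:
  assumes \<pi>: "irreducible_rep d \<pi>" and "i < d" "k < d" "j < d" "l < d"
  shows "(\<integral>x. \<pi> x $$ (i, k) * cnj (\<pi> x $$ (j, l)) \<partial>\<mu>) = (if i = j \<and> k = l then 1 / of_nat d else 0)"
proof -
  note P = irreducible_repD[OF \<pi>]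
  define T where "T = mat d d (\<lambda>(i, j). \<integral>x. \<pi> x $$ (i, k) * cnj (\<pi> x $$ (j, l)) \<partial>\<mu>)"
  have "T \<in> carrier_mat d d" by (simp add: T_def)
  then obtain c where c: "T = c \<cdot>\<^sub>m 1\<^sub>m d"
    using Schur_scalar[OF \<pi>, of T] integral_rep_intertwines[OF \<pi> \<pi> assms(3,5)]
    unfolding T_def by metis
  have entry: "(\<integral>x. \<pi> x $$ (m, k) * cnj (\<pi> x $$ (n, l)) \<partial>\<mu>) = (if m = n then c else 0)"
    if "m < d" "n < d" for m n
  proof -
    have "T $$ (m, n) = (c \<cdot>\<^sub>m 1\<^sub>m d) $$ (m, n)" using c by simp
    then show ?thesis using that by (simp add: T_def)
  qed
  have "of_nat d * c = (\<Sum>m<d. \<integral>x. \<pi> x $$ (m, k) * cnj (\<pi> x $$ (m, l)) \<partial>\<mu>)"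
    by (simp add: entry)
  also have "\<dots> = (\<integral>x. (\<Sum>m<d. \<pi> x $$ (m, k) * cnj (\<pi> x $$ (m, l))) \<partial>\<mu>)"
    by (intro Bochner_Integration.integral_sum[symmetric] integrable_continuous continuous_intros P)
       (use assms in auto)
  also have "\<dots> = (if k = l then 1 else 0)"
    by (simp add: unitary_mat_columns[OF P(3) assms(3,5)])
  finally have "c = (if k = l then 1 / of_nat d else 0)" using P(2) by (auto simp: field_simps split: if_splits)
  then show ?thesis using entry[OF assms(2,4)] by auto
qed

end

section \<open>Completeness of the irreducible coefficients\<close>

context haar_compact
begin

text \<open>All irreducible representations are quantified over, not just chosen representatives, so
  that it applies at once to a representation constructed during the proof.\<close>

definition orth_irreps :: "('g \<Rightarrow> complex) \<Rightarrow> bool" where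
  "orth_irreps h \<longleftrightarrow>
     (\<forall>d \<pi>. irreducible_rep d \<pi> \<longrightarrow> (\<forall>i<d. \<forall>j<d. (\<integral>x. h x * cnj (\<pi> x $$ (i, j)) \<partial>\<mu>) = 0))"

text \<open>As \<pi> is multiplicative, convolution of functions becomes multiplication of their
  coefficient matrices. Hence vanishing coefficients survive convolution on either side.\<close>

lemma conv_coeff:
  assumes h: "integrable \<mu> h" and b: "cont b" and \<pi>: "irreducible_rep d \<pi>" and ij: "i < d" "j < d"
  shows "(\<integral>x. conv h b x * cnj (\<pi> x $$ (i, j)) \<partial>\<mu>) =
    (\<Sum>l<d. (\<integral>y. h y * cnj (\<pi> y $$ (i, l)) \<partial>\<mu>) * (\<integral>z. b z * cnj (\<pi> z $$ (l, j)) \<partial>\<mu>))"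
proof -
  note P = irreducible_repD[OF \<pi>]
  have K: "continuous_on UNIV (\<lambda>(x, y). b (- y + x) * cnj (\<pi> x $$ (i, j)))"
    unfolding case_prod_beta'
    by (intro continuous_intros continuous_on_compose2[OF b] continuous_on_compose2[OF P(6)[OF ij]] subset_UNIV)
  have inner: "(\<integral>x. b (- y + x) * cnj (\<pi> x $$ (i, j)) \<partial>\<mu>) =
      (\<Sum>l<d. cnj (\<pi> y $$ (i, l)) * (\<integral>z. b z * cnj (\<pi> z $$ (l, j)) \<partial>\<mu>))" for y
  proof -
    have "cont (\<lambda>z. b z * cnj (\<pi> (y + z) $$ (i, j)))"
      by (intro continuous_intros b continuous_on_compose2[OF P(6)[OF ij]] subset_UNIV)
    from integral_translate_cont[OF this, of "- y"]
    have "(\<integral>x. b (- y + x) * cnj (\<pi> x $$ (i, j)) \<partial>\<mu>) = (\<integral>z. b z * cnj (\<pi> (y + z) $$ (i, j)) \<partial>\<mu>)"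
      by (simp add: add.assoc[symmetric])
    also have "\<dots> = (\<integral>z. (\<Sum>l<d. cnj (\<pi> y $$ (i, l)) * (b z * cnj (\<pi> z $$ (l, j)))) \<partial>\<mu>)"
      by (simp add: rep_add_index[OF \<pi> ij] sum_distrib_left mult_ac)
    also have "\<dots> = (\<Sum>l<d. \<integral>z. cnj (\<pi> y $$ (i, l)) * (b z * cnj (\<pi> z $$ (l, j))) \<partial>\<mu>)"
      by (intro Bochner_Integration.integral_sum integrable_continuous continuous_intros b P)
         (use ij in auto)
    finally show ?thesis by simp
  qed
  have "(\<integral>x. conv h b x * cnj (\<pi> x $$ (i, j)) \<partial>\<mu>) =
      (\<integral>x. (\<integral>y. h y * (b (- y + x) * cnj (\<pi> x $$ (i, j))) \<partial>\<mu>) \<partial>\<mu>)"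
    by (simp add: conv_def mult.assoc[symmetric])
  also have "\<dots> = (\<integral>y. h y * (\<integral>x. b (- y + x) * cnj (\<pi> x $$ (i, j)) \<partial>\<mu>) \<partial>\<mu>)"
    by (rule Fubini_continuous_kernel[OF K h])
  also have "\<dots> = (\<integral>y. (\<Sum>l<d. h y * cnj (\<pi> y $$ (i, l)) * (\<integral>z. b z * cnj (\<pi> z $$ (l, j)) \<partial>\<mu>)) \<partial>\<mu>)"
    unfolding inner by (simp add: sum_distrib_left mult.assoc)
  also have "\<dots> = (\<Sum>l<d. \<integral>y. h y * cnj (\<pi> y $$ (i, l)) * (\<integral>z. b z * cnj (\<pi> z $$ (l, j)) \<partial>\<mu>) \<partial>\<mu>)"
    by (intro Bochner_Integration.integral_sum integrable_mult_left integrable_mult_continuous h continuous_intros P)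
       (use ij in auto)
  finally show ?thesis by simp
qed

lemma orth_irreps_conv_left:
  assumes "orth_irreps h" "integrable \<mu> h" "cont b"
  shows "orth_irreps (conv h b)"
  using assms unfolding orth_irreps_def by (simp add: conv_coeff)

lemma orth_irreps_conv_right:
  assumes "orth_irreps b" "integrable \<mu> h" "cont b"
  shows "orth_irreps (conv h b)"
  using assms unfolding orth_irreps_def by (simp add: conv_coeff)

definition invariant_subspace :: "('g \<Rightarrow> complex) \<Rightarrow> ('g \<Rightarrow> complex) set \<Rightarrow> bool" where
  "invariant_subspace p W \<longleftrightarrow>
     (\<forall>f\<in>W. cont f \<and> conv f p = f) \<and> (\<lambda>_. 0) \<in> W \<and> (\<forall>f\<in>W. \<forall>g\<in>W. (\<lambda>x. f x + g x) \<in> W) \<and>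
     (\<forall>k. \<forall>f\<in>W. (\<lambda>x. k * f x) \<in> W) \<and> (\<forall>z. \<forall>f\<in>W. transl z f \<in> W)"

text \<open>Encodes "dimension at least \<open>d\<close>" for a subspace; the dimension is
  \<open>d\<close> when this holds for \<open>d\<close> and fails for \<open>Suc d\<close>.\<close>

definition has_orthonormal :: "('g \<Rightarrow> complex) set \<Rightarrow> nat \<Rightarrow> bool" where
  "has_orthonormal W d \<longleftrightarrow> (\<exists>F. orthonormal d F \<and> (\<forall>i<d. F i \<in> W))"

lemma invariant_subspaceD:
  assumes "invariant_subspace p W"
  shows "\<And>f. f \<in> W \<Longrightarrow> cont f" "\<And>f. f \<in> W \<Longrightarrow> conv f p = f" "(\<lambda>_. 0) \<in> W"
    "\<And>f g. f \<in> W \<Longrightarrow> g \<in> W \<Longrightarrow> (\<lambda>x. f x + g x) \<in> W" "\<And>k f. f \<in> W \<Longrightarrow> (\<lambda>x. k * f x) \<in> W"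
    "\<And>z f. f \<in> W \<Longrightarrow> transl z f \<in> W"
  using assms unfolding invariant_subspace_def by blast+

lemma invariant_subspace_sum:
  assumes W: "invariant_subspace p W" and F: "\<And>i. i < d \<Longrightarrow> F i \<in> W"
  shows "(\<lambda>x. \<Sum>i<(d::nat). c i * F i x) \<in> W"
  using F
proof (induction d)
  case (Suc d)
  then have "(\<lambda>x. (\<Sum>i<d. c i * F i x) + c d * F d x) \<in> W"
    by (intro invariant_subspaceD[OF W]) auto
  then show ?case by simp
qed (simp add: invariant_subspaceD[OF W])

lemma has_orthonormal_mono:
  assumes "has_orthonormal W n" "m \<le> n"
  shows "has_orthonormal W m"
proof -
  obtain F where "orthonormal n F" "\<forall>i<n. F i \<in> W" using assms(1) by (auto simp: has_orthonormal_def)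
  then have "orthonormal m F \<and> (\<forall>i<m. F i \<in> W)" using assms(2) by (auto simp: orthonormal_def)
  then show ?thesis unfolding has_orthonormal_def by blast
qed

text \<open>On functions with \<open>f = f * p\<close> the kernel \<open>p\<close> is reproducing, so Bessel's inequality
  bounds the dimension by \<open>\<parallel>p\<parallel>\<^sup>2\<close>.\<close>

lemma has_orthonormal_bound:
  assumes p: "cont p" "adj p = p" and W: "invariant_subspace p W" and d: "has_orthonormal W d"
  shows "real d \<le> nrm2 p"
proof -
  obtain F where F: "orthonormal d F" "\<And>i. i < d \<Longrightarrow> F i \<in> W"
    using d unfolding has_orthonormal_def by blast
  have Fc: "cont (F i)" if "i < d" for i using F(1) that by (simp add: orthonormal_def)
  have le: "(\<Sum>i<d. (norm (F i x))\<^sup>2) \<le> nrm2 p" for x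
  proof -
    have "norm (F i x) = norm (ip (transl x p) (F i))" if "i < d" for i
    proof -
      have "F i x = ip (F i) (transl x p)"
        using invariant_subspaceD(2)[OF W F(2)[OF that]] conv_eq_ip[of "F i" p x] by (simp add: p)
      then show ?thesis by (metis complex_mod_cnj ip_cnj)
    qed
    then have "(\<Sum>i<d. (norm (F i x))\<^sup>2) = (\<Sum>i<d. (norm (ip (transl x p) (F i)))\<^sup>2)"
      by (intro sum.cong) auto
    also have "\<dots> \<le> nrm2 (transl x p)"
      by (intro Bessel F continuous_transl p)
    finally show ?thesis by (simp add: nrm2_transl p)
  qed
  have one: "nrm2 (F i) = 1" if "i < d" for i
    using F(1) that ip_self[of "F i"] unfolding orthonormal_def by (metis of_real_eq_1_iff)
  have "real d = (\<Sum>i<d. nrm2 (F i))" by (simp add: one)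
  also have "\<dots> = (\<integral>x. (\<Sum>i<d. (norm (F i x))\<^sup>2) \<partial>\<mu>)"
    unfolding nrm2_def
    by (intro Bochner_Integration.integral_sum[symmetric] integrable_continuous continuous_intros Fc) auto
  also have "\<dots> \<le> norm (\<integral>x. (\<Sum>i<d. (norm (F i x))\<^sup>2) \<partial>\<mu>)" by simp
  also have "\<dots> \<le> nrm2 p"
    by (rule norm_integral_bound) (use le in \<open>simp add: sum_nonneg\<close>)
  finally show ?thesis .
qed

lemma maximal_orthonormal_exists:
  assumes p: "cont p" "adj p = p" and W: "invariant_subspace p W"
  obtains d where "has_orthonormal W d" "\<not> has_orthonormal W (Suc d)"
proof (rule ccontr)
  assume neg: "\<not> thesis"
  have "has_orthonormal W n" for n
  proof (induction n)
    case 0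
    then show ?case by (simp add: has_orthonormal_def orthonormal_def)
  qed (use that neg in blast)
  then have "real n \<le> nrm2 p" for n by (rule has_orthonormal_bound[OF p W])
  then show False using reals_Archimedean2 not_less by blast
qed

text \<open>A nonzero residual of \<open>f\<close> lies in \<open>W\<close> and is orthogonal to the
  family, so after normalization it could be appended, against maximality.\<close>

lemma maximal_orthonormal_spans:
  assumes W: "invariant_subspace p W" and F: "orthonormal d F" "\<And>i. i < d \<Longrightarrow> F i \<in> W"
    and max: "\<not> has_orthonormal W (Suc d)" and f: "f \<in> W"
  shows "f = (\<lambda>x. \<Sum>i<d. ip f (F i) * F i x)"
proof (rule ccontr)
  assume ne: "f \<noteq> (\<lambda>x. \<Sum>i<d. ip f (F i) * F i x)"
  define r where "r = (\<lambda>x. f x - (\<Sum>i<d. ip f (F i) * F i x))"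
  note fc = invariant_subspaceD(1)[OF W f]
  note res = orthonormal_residual[OF F(1) fc, folded r_def]
  have "r = (\<lambda>x. f x + (- 1) * (\<Sum>i<d. ip f (F i) * F i x))" by (simp add: r_def)
  also have "\<dots> \<in> W" by (intro invariant_subspaceD[OF W] f invariant_subspace_sum[OF W] F)
  finally have rW: "r \<in> W" .
  obtain x where "r x \<noteq> 0" using ne by (auto simp: r_def fun_eq_iff)
  then have "nrm2 r \<noteq> 0" using nrm2_eq_0D[OF res(1)] by blast
  then have pos: "nrm2 r > 0" using nrm2_nonneg[of r] by simp
  define k where "k = complex_of_real (1 / sqrt (nrm2 r))"
  have kk: "k * (cnj k * ip r r) = 1"
    using pos unfolding k_def ip_self complex_cnj_complex_of_real of_real_mult[symmetric] by simp
  define G where "G = F(d := (\<lambda>x. k * r x))"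
  have "orthonormal (Suc d) G"
    unfolding orthonormal_def
  proof (intro conjI allI impI)
    fix i assume "i < Suc d"
    then show "cont (G i)"
      using F(1) res(1) by (cases "i = d") (auto simp: G_def orthonormal_def intro!: continuous_intros)
    fix j assume "j < Suc d"
    have rF: "ip (F m) r = 0" if "m < d" for m
      using res(2)[OF that] ip_cnj[of r "F m"] by simp
    consider "i < d" "j < d" | "i = d" "j < d" | "i < d" "j = d" | "i = d" "j = d"
      using \<open>i < Suc d\<close> \<open>j < Suc d\<close> by linarith
    then show "ip (G i) (G j) = (if i = j then 1 else 0)"
    proof cases
      case 1
      then show ?thesis using F(1) by (auto simp: G_def orthonormal_def)
    next
      case 2
      then show ?thesis using res(2)[of j] by (auto simp: G_def ip_scale_left)
    next
      case 3
      then show ?thesis using rF[of i] by (auto simp: G_def ip_scale_right)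
    next
      case 4
      then show ?thesis using kk by (simp add: G_def ip_scale_left ip_scale_right)
    qed
  qed
  moreover have "G i \<in> W" if "i < Suc d" for i
    using that F(2)[of i] invariant_subspaceD(5)[OF W rW] by (cases "i = d") (auto simp: G_def)
  ultimately show False using max unfolding has_orthonormal_def by blast
qed

text \<open>Translation on a nonzero invariant subspace of least dimension is irreducible. A
  function \<open>f\<close> with \<open>conv f p = f\<close> is a combination of its coefficients,
  yet inherits from \<open>p\<close> the orthogonality to all coefficients.\<close>

lemma orth_irreps_idempotent:
  assumes p: "cont p" "adj p = p" and pp: "conv p p = p" and orth: "orth_irreps p"
  shows "p = (\<lambda>_. 0)"
proof (rule ccontr)
  assume nz: "p \<noteq> (\<lambda>_. 0)"
  define good where "good W n \<longleftrightarrow> invariant_subspace p W \<and> (\<exists>f\<in>W. f \<noteq> (\<lambda>_. 0)) \<and>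
    has_orthonormal W n \<and> \<not> has_orthonormal W (Suc n)" for W n
  define V where "V = {f. cont f \<and> conv f p = f}"
  have V: "invariant_subspace p V"
    unfolding invariant_subspace_def
  proof (intro conjI ballI allI)
    fix f assume "f \<in> V"
    then have f: "cont f" "conv f p = f" by (auto simp: V_def)
    show "cont f" "conv f p = f" by (rule f)+
    show "(\<lambda>x. k * f x) \<in> V" for k
    proof -
      have "conv (\<lambda>x. k * f x) p = (\<lambda>x. k * conv f p x)" by (simp add: conv_eq_ip ip_scale_left fun_eq_iff)
      then show ?thesis using f by (auto simp: V_def intro!: continuous_intros)
    qed
    show "transl z f \<in> V" for z
      using transl_conv_left[OF f(1) p(1), of z] f by (auto simp: V_def intro!: continuous_intros)
    fix g assume "g \<in> V"
    then have g: "cont g" "conv g p = g" by (auto simp: V_def)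
    have "ip (\<lambda>x. f x + g x) (transl x p) = ip f (transl x p) + ip g (transl x p)" for x
      unfolding ip_def distrib_right
      by (intro Bochner_Integration.integral_add ip_integrable f g continuous_transl p)
    then have "conv (\<lambda>x. f x + g x) p = (\<lambda>x. conv f p x + conv g p x)" by (simp add: conv_eq_ip p fun_eq_iff)
    then show "(\<lambda>x. f x + g x) \<in> V" using f g by (auto simp: V_def intro!: continuous_intros)
  qed (auto simp: V_def conv_def)
  have "p \<in> V" using p pp by (simp add: V_def)
  then have "\<exists>n W. good W n"
    using maximal_orthonormal_exists[OF p V] V nz unfolding good_def by metis
  define d where "d = (LEAST n. \<exists>W. good W n)"
  obtain W where gW: "good W d" using LeastI_ex[OF \<open>\<exists>n W. good W n\<close>] unfolding d_def by blast
  have dmin: "d \<le> n" if "good W' n" for W' n unfolding d_def using that by (blast intro: Least_le)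
  have W: "invariant_subspace p W" and maxW: "\<not> has_orthonormal W (Suc d)" using gW by (auto simp: good_def)
  note WD = invariant_subspaceD[OF W]
  obtain F where F: "orthonormal d F" "\<And>i. i < d \<Longrightarrow> F i \<in> W"
    using gW unfolding good_def has_orthonormal_def by blast
  have Fc: "cont (F i)" if "i < d" for i using F(1) that by (simp add: orthonormal_def)
  have Fip: "ip (F i) (F j) = (if i = j then 1 else 0)" if "i < d" "j < d" for i j
    using F(1) that by (simp add: orthonormal_def)
  have span: "f = (\<lambda>x. \<Sum>i<d. ip f (F i) * F i x)" if "f \<in> W" for f
    by (rule maximal_orthonormal_spans[OF W F(1) F(2) maxW that])
  obtain f0 where f0: "f0 \<in> W" "f0 \<noteq> (\<lambda>_. 0)" using gW by (auto simp: good_def)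
  have d0: "d > 0" using span[OF f0(1)] f0(2) by (cases d) auto
  \<comment> \<open>The conjugate of the matrix of translation by \<open>z\<close> in the basis
    \<open>F\<close>; the conjugation makes \<open>F 0\<close> a combination of entries of \<pi>
    rather than of their conjugates.\<close>
  define \<pi> where "\<pi> z = mat d d (\<lambda>(i, j). cnj (ip (transl z (F j)) (F i)))" for z
  have \<pi>c: "\<pi> z \<in> carrier_mat d d" and \<pi>dim [simp]: "dim_row (\<pi> z) = d" "dim_col (\<pi> z) = d" for z
    by (simp_all add: \<pi>_def)
  have \<pi>ij: "\<pi> z $$ (i, j) = cnj (ip (transl z (F j)) (F i))" if "i < d" "j < d" for z i j
    using that by (simp add: \<pi>_def)
  have translF: "transl z (F j) x = (\<Sum>i<d. cnj (\<pi> z $$ (i, j)) * F i x)" if "j < d" for z j x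
    using fun_cong[OF span[OF WD(6)[OF F(2)[OF that], of z]], of x] that by (simp add: \<pi>ij)
  have \<pi>0: "\<pi> 0 = 1\<^sub>m d" by (intro eq_matI) (auto simp: \<pi>_def Fip)
  have \<pi>add: "\<pi> (z + w) = \<pi> z * \<pi> w" for z w
  proof (rule eq_matI)
    fix i j assume "i < dim_row (\<pi> z * \<pi> w)" "j < dim_col (\<pi> z * \<pi> w)"
    then have ij: "i < d" "j < d" using \<pi>c by auto
    have "transl (z + w) (F j) x = (\<Sum>k<d. cnj (\<pi> w $$ (k, j)) * transl z (F k) x)" for x
      using translF[OF ij(2), of w "- z + x"]
      by (simp only: transl_transl[symmetric] transl_def[of z])
    then have "transl (z + w) (F j) = (\<lambda>x. \<Sum>k<d. cnj (\<pi> w $$ (k, j)) * transl z (F k) x)"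
      by blast
    then have "ip (transl (z + w) (F j)) (F i) = (\<Sum>k<d. cnj (\<pi> w $$ (k, j)) * ip (transl z (F k)) (F i))"
      using ij by (simp only:) (subst ip_sum_left; auto simp: ip_scale_left intro!: continuous_intros Fc)
    then have "\<pi> (z + w) $$ (i, j) = (\<Sum>k<d. \<pi> z $$ (i, k) * \<pi> w $$ (k, j))"
      using ij by (simp add: \<pi>ij mult.commute)
    then show "\<pi> (z + w) $$ (i, j) = (\<pi> z * \<pi> w) $$ (i, j)"
      using mult_mat_index[OF \<pi>c \<pi>c ij] by simp
  qed (use \<pi>c[of "z + w"] \<pi>c[of z] \<pi>c[of w] in auto)
  have \<pi>adj: "mat_adjoint (\<pi> z) = \<pi> (- z)" for z
  proof (rule eq_matI)
    fix i j assume "i < dim_row (\<pi> (- z))" "j < dim_col (\<pi> (- z))"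
    then have ij: "i < d" "j < d" using \<pi>c[of "- z"] by auto
    have "ip (transl (- z) (F j)) (F i) = ip (transl z (transl (- z) (F j))) (transl z (F i))"
      by (intro ip_transl[symmetric] continuous_transl Fc ij)
    also have "\<dots> = cnj (ip (transl z (F i)) (F j))" by (simp add: transl_transl ip_cnj)
    finally show "mat_adjoint (\<pi> z) $$ (i, j) = \<pi> (- z) $$ (i, j)"
      using ij \<pi>c[of z] by (simp add: \<pi>ij)
  qed (use \<pi>c[of z] \<pi>c[of "- z"] in auto)
  have "unitary_mat d (\<pi> z)" for z
    by (intro unitary_matI \<pi>c) (simp add: \<pi>adj \<pi>0 flip: \<pi>add)
  moreover have "cont (\<lambda>z. \<pi> z $$ (i, j))" if "i < d" "j < d" for i j
  proof -
    have "continuous_on UNIV (\<lambda>(z, x). F j (- z + x))"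
      unfolding case_prod_beta'
      by (rule continuous_on_compose2[OF Fc[OF that(2)]]) (auto intro!: continuous_intros)
    then have "cont (\<lambda>z. \<integral>x. cnj (F i x) * F j (- z + x) \<partial>\<mu>)"
      by (rule continuous_kernel_integral) (intro integrable_continuous continuous_intros Fc that)
    then have "cont (\<lambda>z. cnj (\<integral>x. cnj (F i x) * F j (- z + x) \<partial>\<mu>))" by (intro continuous_intros)
    then show ?thesis using that by (simp add: \<pi>ij ip_def transl_def mult.commute)
  qed
  ultimately have "unitary_rep d \<pi>" by (simp add: unitary_rep_def \<pi>0 \<pi>add)
  moreover have "W' = {0\<^sub>v d} \<or> W' = carrier_vec d"
    if subW': "VectorSpace.subspace class_ring W' (module_vec TYPE(complex) d)"
      and invW': "\<And>x w. w \<in> W' \<Longrightarrow> \<pi> x *\<^sub>v w \<in> W'" for W'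
  proof (rule disjCI)
    assume ne: "W' \<noteq> carrier_vec d"
    have W': "W' \<subseteq> carrier_vec d" "0\<^sub>v d \<in> W'" "\<And>v w. v \<in> W' \<Longrightarrow> w \<in> W' \<Longrightarrow> v + w \<in> W'"
      "\<And>c v. v \<in> W' \<Longrightarrow> c \<cdot>\<^sub>v v \<in> W'"
      using subW' by (auto simp: subspace_module_vec_iff)
    \<comment> \<open>Conjugate-linear to match the conjugation in \<pi>: thus \<open>G\<close>
      intertwines \<pi> with translation and turns \<open>W'\<close> into an invariant space of
      functions.\<close>
    define G where "G w = (\<lambda>x. \<Sum>i<d. cnj (w $ i) * F i x)" for w :: "complex Matrix.vec"
    have ipG: "ip (G w) (F j) = cnj (w $ j)" if "j < d" for w j
    proof -
      have "ip (G w) (F j) = (\<Sum>i<d. cnj (w $ i) * ip (F i) (F j))"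
        unfolding G_def using that by (subst ip_sum_left) (auto simp: ip_scale_left intro!: continuous_intros Fc)
      also have "\<dots> = (\<Sum>i<d. if i = j then cnj (w $ i) else 0)"
        using that by (intro sum.cong) (auto simp: Fip)
      finally show ?thesis using that by simp
    qed
    have Ginj: "v = w" if "v \<in> carrier_vec d" "w \<in> carrier_vec d" "G v = G w" for v w
    proof (rule eq_vecI)
      fix i assume "i < dim_vec w"
      then have "i < d" using that by simp
      then have "cnj (v $ i) = cnj (w $ i)" using ipG[of i v] ipG[of i w] that by simp
      then show "v $ i = w $ i" by simp
    qed (use that in auto)
    have GW: "G w \<in> W" for w unfolding G_def by (rule invariant_subspace_sum[OF W F(2)])
    define W2 where "W2 = G ` W'"
    have W2: "invariant_subspace p W2"
      unfolding invariant_subspace_def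
    proof (intro conjI ballI allI)
      show "(\<lambda>_. 0) \<in> W2"
        unfolding W2_def using W'(2) by (intro image_eqI[of _ _ "0\<^sub>v d"]) (auto simp: G_def)
      fix f assume "f \<in> W2"
      then obtain v where v: "v \<in> W'" "f = G v" by (auto simp: W2_def)
      have vd: "dim_vec v = d" using v W'(1) by auto
      show "cont f" "conv f p = f" using WD(1,2)[OF GW[of v]] v by auto
      show "(\<lambda>x. k * f x) \<in> W2" for k
        unfolding W2_def using v vd W'(4)[OF v(1), of "cnj k"]
        by (intro image_eqI[of _ _ "cnj k \<cdot>\<^sub>v v"]) (auto simp: G_def sum_distrib_left mult.assoc)
      show "transl z f \<in> W2" for z
      proof -
        have "transl z (G v) x = G (\<pi> z *\<^sub>v v) x" for x
        proof -
          have "transl z (G v) x = (\<Sum>j<d. cnj (v $ j) * transl z (F j) x)"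
            by (simp add: G_def transl_def)
          also have "\<dots> = (\<Sum>j<d. \<Sum>i<d. cnj (v $ j) * (cnj (\<pi> z $$ (i, j)) * F i x))"
            by (simp add: translF sum_distrib_left)
          also have "\<dots> = (\<Sum>i<d. \<Sum>j<d. cnj (v $ j) * (cnj (\<pi> z $$ (i, j)) * F i x))"
            by (rule sum.swap)
          also have "\<dots> = (\<Sum>i<d. cnj ((\<pi> z *\<^sub>v v) $ i) * F i x)"
          proof (intro sum.cong refl)
            fix i assume "i \<in> {..<d}"
            then have "(\<pi> z *\<^sub>v v) $ i = (\<Sum>j<d. \<pi> z $$ (i, j) * v $ j)"
              using mult_mat_vec_index[OF \<pi>c subsetD[OF W'(1) v(1)]] by simp
            then show "(\<Sum>j<d. cnj (v $ j) * (cnj (\<pi> z $$ (i, j)) * F i x)) = cnj ((\<pi> z *\<^sub>v v) $ i) * F i x"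
              by (simp add: sum_distrib_left mult_ac)
          qed
          finally show ?thesis by (simp add: G_def)
        qed
        then have "transl z f = G (\<pi> z *\<^sub>v v)" using v by blast
        then show ?thesis using invW'[OF v(1)] by (simp add: W2_def)
      qed
      fix g assume "g \<in> W2"
      then obtain w where w: "w \<in> W'" "g = G w" by (auto simp: W2_def)
      have wd: "dim_vec w = d" using w W'(1) by auto
      show "(\<lambda>x. f x + g x) \<in> W2"
      proof -
        have "G (v + w) x = f x + g x" for x
          by (simp add: G_def v(2) w(2) vd wd distrib_right sum.distrib)
        then have "(\<lambda>x. f x + g x) = G (v + w)" by presburger
        then show ?thesis using W'(3)[OF v(1) w(1)] by (simp add: W2_def)
      qed
    qed
    obtain n where n: "has_orthonormal W2 n" "\<not> has_orthonormal W2 (Suc n)"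
      using maximal_orthonormal_exists[OF p W2] by blast
    \<comment> \<open>A nonzero \<open>W2\<close> has dimension at least \<open>d\<close> by
      minimality. An orthonormal family of length \<open>d\<close> in it spans all of
      \<open>W\<close>, and injectivity of \<open>G\<close> then makes \<open>W'\<close> the full
      space.\<close>
    have "\<forall>f\<in>W2. f = (\<lambda>_. 0)"
    proof (rule ccontr)
      assume "\<not> (\<forall>f\<in>W2. f = (\<lambda>_. 0))"
      then have "good W2 n" using W2 n by (auto simp: good_def)
      then have "has_orthonormal W2 d" using has_orthonormal_mono[OF n(1)] dmin by blast
      then obtain H where H: "orthonormal d H" "\<And>i. i < d \<Longrightarrow> H i \<in> W2"
        unfolding has_orthonormal_def by blast
      have HW: "H i \<in> W" if "i < d" for i using H(2)[OF that] GW by (auto simp: W2_def)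
      have "w \<in> W'" if w: "w \<in> carrier_vec d" for w
      proof -
        have "G w = (\<lambda>x. \<Sum>i<d. ip (G w) (H i) * H i x)"
          by (rule maximal_orthonormal_spans[OF W H(1) HW maxW GW])
        also have "\<dots> \<in> W2" by (rule invariant_subspace_sum[OF W2 H(2)])
        finally obtain w' where w': "w' \<in> W'" "G w = G w'" by (auto simp: W2_def)
        then have "w = w'" using Ginj[OF w subsetD[OF W'(1) w'(1)]] by simp
        then show ?thesis using w' by simp
      qed
      then show False using ne W'(1) by blast
    qed
    then have "w = 0\<^sub>v d" if "w \<in> W'" for w
      using that W'(1,2) Ginj[of w "0\<^sub>v d"] by (auto simp: W2_def)
    then show "W' = {0\<^sub>v d}" using W'(2) by blast
  qed
  ultimately have irr: "irreducible_rep d \<pi>" using d0 unfolding irreducible_rep_def by blast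
  \<comment> \<open>This transfers orthogonality from \<open>p\<close> to
    \<open>F 0\<close>.\<close>
  have "conv (F 0) p = F 0" using WD(2)[OF F(2)[OF d0]] .
  then have orthF: "orth_irreps (F 0)"
    using orth_irreps_conv_right[OF orth integrable_continuous[OF Fc[OF d0]] p(1)] by simp
  have "F 0 x = (\<Sum>i<d. F i 0 * \<pi> x $$ (0, i))" for x
  proof -
    have "F 0 x = transl (- x) (F 0) 0" by (simp add: transl_def)
    also have "\<dots> = (\<Sum>i<d. cnj (\<pi> (- x) $$ (i, 0)) * F i 0)" by (rule translF[OF d0])
    finally show ?thesis using d0 by (simp add: rep_minus_index[OF irr] mult.commute)
  qed
  then have "ip (F 0) (F 0) = ip (F 0) (\<lambda>x. \<Sum>i<d. F i 0 * \<pi> x $$ (0, i))" by presburger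
  also have "\<dots> = (\<Sum>i<d. cnj (F i 0) * ip (F 0) (\<lambda>x. \<pi> x $$ (0, i)))"
    using d0 by (subst ip_sum_right) (auto simp: ip_scale_right intro!: continuous_intros Fc rep_cont[OF irr])
  also have "\<dots> = 0"
    using orthF irr d0 by (simp add: orth_irreps_def ip_def)
  finally show False using Fip[OF d0 d0] by simp
qed

text \<open>Reflecting \<open>k\<close> makes the offending integral the value at the identity of
  the continuous function \<open>g = conv h k'\<close>. Then \<open>conv g (adj g)\<close> is
  self-adjoint with value \<open>nrm2 g\<close> there, and orthogonality persists through its powers
  to the idempotent limit.\<close>

lemma orth_irreps_continuous:
  assumes h: "integrable \<mu> h" "orth_irreps h" and k: "cont k"
  shows "(\<integral>x. h x * k x \<partial>\<mu>) = 0"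
proof (rule ccontr)
  assume nz: "(\<integral>x. h x * k x \<partial>\<mu>) \<noteq> 0"
  define k' where "k' = (\<lambda>x. k (- x))"
  have k': "cont k'"
    unfolding k'_def by (intro continuous_on_compose2[OF k]) (auto intro!: continuous_intros)
  define g where "g = conv h k'"
  have g: "cont g" unfolding g_def by (rule cont_conv[OF h(1) k'])
  have og: "orth_irreps g" unfolding g_def by (rule orth_irreps_conv_left[OF h(2,1) k'])
  have "g 0 \<noteq> 0" using nz by (simp add: g_def conv_def k'_def)
  then have "nrm2 g \<noteq> 0" using nrm2_eq_0D[OF g] by blast
  define \<theta> where "\<theta> = conv g (adj g)"
  have \<theta>: "cont \<theta>" "adj \<theta> = \<theta>"
    using cont_conv'[OF g continuous_adj[OF g]] adj_conv[OF g continuous_adj[OF g]] by (simp_all add: \<theta>_def)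
  have "\<theta> 0 \<noteq> 0" using \<open>nrm2 g \<noteq> 0\<close> by (simp add: \<theta>_def conv_eq_ip ip_self)
  have o\<theta>: "orth_irreps (cpow \<theta> n)" for n
  proof (induction n)
    case 0
    show ?case
      by (simp add: \<theta>_def) (intro orth_irreps_conv_left og integrable_continuous g continuous_adj)
  next
    case (Suc n)
    then show ?case by (simp add: orth_irreps_conv_left cont_cpow \<theta> integrable_continuous)
  qed
  obtain p where p: "cont p" "adj p = p" "conv p p = p" "p 0 \<noteq> 0"
    "\<And>u. integrable \<mu> u \<Longrightarrow> (\<And>n. (\<integral>x. u x * cpow \<theta> n x \<partial>\<mu>) = 0) \<Longrightarrow> (\<integral>x. u x * p x \<partial>\<mu>) = 0"
    by (rule idempotent_kernel[OF \<theta> \<open>\<theta> 0 \<noteq> 0\<close>]) blast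
  have "orth_irreps p"
    unfolding orth_irreps_def
  proof (intro allI impI)
    fix d i j :: nat and \<pi> :: "'g matrep" assume \<pi>: "irreducible_rep d \<pi>" and ij: "i < d" "j < d"
    have "(\<integral>x. cnj (\<pi> x $$ (i, j)) * p x \<partial>\<mu>) = 0"
    proof (rule p(5))
      show "integrable \<mu> (\<lambda>x. cnj (\<pi> x $$ (i, j)))"
        by (intro integrable_continuous continuous_intros rep_cont[OF \<pi>] ij)
      show "(\<integral>x. cnj (\<pi> x $$ (i, j)) * cpow \<theta> n x \<partial>\<mu>) = 0" for n
        using o\<theta>[of n] \<pi> ij unfolding orth_irreps_def by (simp add: mult.commute)
    qed
    then show "(\<integral>x. p x * cnj (\<pi> x $$ (i, j)) \<partial>\<mu>) = 0" by (simp add: mult.commute)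
  qed
  then show False using orth_irreps_idempotent[OF p(1-3)] p(4) by simp
qed

end

section \<open>Functions with values in a Hilbert space\<close>

context haar_compact
begin

section \<open>Passage from continuous test functions to Borel sets\<close>

lemma Urysohn_compact_open:
  assumes "compact K" "open U" "K \<subseteq> U"
  obtains k :: "'g \<Rightarrow> real" where "continuous_on UNIV k" "\<And>x. 0 \<le> k x" "\<And>x. k x \<le> 1"
    "\<And>x. x \<in> K \<Longrightarrow> k x = 1" "\<And>x. x \<notin> U \<Longrightarrow> k x = 0"
proof -
  have "compact_space (euclidean :: 'g topology)"
    using compact_UNIV by (simp add: compact_space_def)
  moreover have "Hausdorff_space (euclidean :: 'g topology)"
    unfolding Hausdorff_space_def disjnt_def using hausdorff[where 'a='g] by simp
  ultimately have n: "normal_space (euclidean :: 'g topology)"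
    by (simp add: compact_Hausdorff_or_regular_imp_normal_space)
  have cl: "closedin euclidean (- U)" "closedin euclidean K"
    using assms compact_imp_closed[OF assms(1)] by auto
  have dj: "disjnt (- U) K" using assms(3) by (auto simp: disjnt_def)
  obtain f where f: "continuous_map euclidean (top_of_set {0..1::real}) f" "f ` (- U) \<subseteq> {0}" "f ` K \<subseteq> {1}"
    using Urysohn_lemma[OF n cl dj, of 0 1] by auto
  show ?thesis
  proof (rule that[of f])
    show "continuous_on UNIV f" using f(1) by (auto simp: continuous_map_in_subtopology)
    have "f x \<in> {0..1}" for x using f(1) by (auto simp: continuous_map_in_subtopology)
    then show "0 \<le> f x" "f x \<le> 1" for x by auto
  qed (use f in auto)
qed

lemma integrable_of_square:
  fixes h :: "'g \<Rightarrow> 'b::{banach,second_countable_topology}"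
  assumes [measurable]: "h \<in> borel_measurable \<mu>" and "integrable \<mu> (\<lambda>x. (norm (h x))\<^sup>2)"
  shows "integrable \<mu> h"
proof (rule Bochner_Integration.integrable_bound)
  show "integrable \<mu> (\<lambda>x. 1 + (norm (h x))\<^sup>2)" using assms by simp
  have "norm (h x) \<le> norm (1 + (norm (h x))\<^sup>2)" for x
  proof -
    have "0 \<le> (norm (h x) - 1)\<^sup>2" by simp
    moreover have "0 \<le> (norm (h x))\<^sup>2" by simp
    ultimately have "norm (h x) \<le> 1 + (norm (h x))\<^sup>2" unfolding power2_diff one_power2 by linarith
    then show ?thesis by simp
  qed
  then show "AE x in \<mu>. norm (h x) \<le> norm (1 + (norm (h x))\<^sup>2)" by simp
qed simp

text \<open>Uniform integrability from the elementary inequality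
  \<open>norm (h x) \<le> t + (norm (h x))\<^sup>2 / t\<close>, with the threshold \<open>t\<close>
  balancing the two terms.\<close>

lemma small_set_integral:
  fixes h :: "'g \<Rightarrow> complex"
  assumes [measurable]: "h \<in> borel_measurable \<mu>" and sq: "integrable \<mu> (\<lambda>x. (norm (h x))\<^sup>2)" and e: "e > 0"
  obtains \<delta> where "\<delta> > 0"
    "\<And>D. D \<in> sets borel \<Longrightarrow> measure \<mu> D < \<delta> \<Longrightarrow> (\<integral>x. indicator D x * norm (h x) \<partial>\<mu>) < e"
proof -
  define I where "I = (\<integral>x. (norm (h x))\<^sup>2 \<partial>\<mu>)"
  have I: "I \<ge> 0" by (simp add: I_def)
  \<comment> \<open>Large enough that \<open>I / t\<close> is at most \<open>e / 2\<close>, also for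
    \<open>I = 0\<close>; the bound \<open>e / (2 * t)\<close> on the measure leaves less than
    \<open>e / 2\<close> for the other term.\<close>
  define t where "t = 2 * (I + 1) / e"
  have t: "t > 0" using I e by (simp add: t_def)
  show ?thesis
  proof (rule that[of "e / (2 * t)"])
    show "e / (2 * t) > 0" using e t by simp
    fix D :: "'g set" assume D: "D \<in> sets borel" "measure \<mu> D < e / (2 * t)"
    have [measurable]: "D \<in> sets \<mu>" using D by simp
    have i: "integrable \<mu> (\<lambda>x. indicator D x :: real)" using D by (intro integrable_const_bound[of _ 1]) (auto simp: indicator_def)
    have "(\<integral>x. indicator D x * norm (h x) \<partial>\<mu>) \<le> (\<integral>x. t * indicator D x + (norm (h x))\<^sup>2 / t \<partial>\<mu>)"
    proof (rule integral_mono)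
      show "integrable \<mu> (\<lambda>x. indicator D x * norm (h x))"
        using integrable_real_mult_indicator[of D \<mu> "\<lambda>x. norm (h x)"] integrable_of_square[OF assms(1) sq] D(1)
        by (simp add: mult.commute)
      show "integrable \<mu> (\<lambda>x. t * indicator D x + (norm (h x))\<^sup>2 / t)" using i sq by simp
      fix x
      have "0 \<le> (norm (h x) - t)\<^sup>2 + norm (h x) * t" using t by simp
      then have "norm (h x) * t \<le> t * t + (norm (h x))\<^sup>2" by (simp add: power2_diff power2_eq_square algebra_simps)
      then have "norm (h x) \<le> t + (norm (h x))\<^sup>2 / t" using t by (simp add: field_simps)
      then show "indicator D x * norm (h x) \<le> t * indicator D x + (norm (h x))\<^sup>2 / t"
        using t by (auto simp: indicator_def)
    qed
    also have "\<dots> = t * measure \<mu> D + I / t" using i sq by (simp add: I_def)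
    also have "\<dots> < e"
    proof -
      have "t * measure \<mu> D < e / 2" using D(2) t by (simp add: field_simps)
      moreover have "I / t \<le> e / 2" using I e t by (simp add: t_def field_simps)
      ultimately show ?thesis by linarith
    qed
    finally show "(\<integral>x. indicator D x * norm (h x) \<partial>\<mu>) < e" .
  qed
qed

text \<open>The definition of a Radon measure gives inner regularity on open sets, so
  \<open>K\<close> is chosen inside \<open>U\<close> and need not lie in \<open>B\<close>. It is
  enough that \<open>U\<close> exceed each of \<open>B\<close> and \<open>K\<close> by
  little.\<close>

lemma Radon_approx:
  assumes B: "B \<in> sets borel" and \<delta>: "\<delta> > 0"
  obtains K U where "compact K" "open U" "B \<subseteq> U" "K \<subseteq> U" "measure \<mu> (U - B) < \<delta>" "measure \<mu> (U - K) < \<delta>"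
proof -
  have rad: "radon_measure \<mu>" using haar by (simp add: normalized_haar_measure_def)
  have "(INF U\<in>{U. open U \<and> B \<subseteq> U}. emeasure \<mu> U) < emeasure \<mu> B + ennreal \<delta>"
  proof -
    have "(INF U\<in>{U. open U \<and> B \<subseteq> U}. emeasure \<mu> U) = emeasure \<mu> B"
      using rad B unfolding radon_measure_def by metis
    moreover have "emeasure \<mu> B < emeasure \<mu> B + ennreal \<delta>"
      using \<delta> by (simp add: emeasure_eq_measure ennreal_plus[symmetric] ennreal_less_iff del: ennreal_plus)
    ultimately show ?thesis by simp
  qed
  then obtain U where U: "open U" "B \<subseteq> U" "emeasure \<mu> U < emeasure \<mu> B + ennreal \<delta>"
    by (auto simp: INF_less_iff)
  have "measure \<mu> U < measure \<mu> B + \<delta>"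
    using U(3) \<delta> by (simp add: emeasure_eq_measure ennreal_plus[symmetric] ennreal_less_iff del: ennreal_plus)
  then have 1: "measure \<mu> (U - B) < \<delta>"
    using finite_measure_Diff[of U B] U B by simp
  have "\<exists>K. compact K \<and> K \<subseteq> U \<and> measure \<mu> U < measure \<mu> K + \<delta>"
  \<comment> \<open>\<open>ennreal\<close> truncates negative reals, so the subtraction of \<delta>
    is reserved for the case where it stays nonnegative; otherwise the empty set serves.\<close>
  proof (cases "measure \<mu> U < \<delta>")
    case True
    then show ?thesis by (intro exI[of _ "{}"]) auto
  next
    case False
    have "ennreal (measure \<mu> U - \<delta>) < emeasure \<mu> U"
      using False \<delta> by (simp add: emeasure_eq_measure ennreal_less_iff)
    also have "\<dots> = (SUP K\<in>{K. compact K \<and> K \<subseteq> U}. emeasure \<mu> K)"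
      using rad U(1) unfolding radon_measure_def by metis
    finally obtain K where "compact K" "K \<subseteq> U" "ennreal (measure \<mu> U - \<delta>) < emeasure \<mu> K"
      by (auto simp: less_SUP_iff)
    then show ?thesis using False by (intro exI[of _ K]) (auto simp: emeasure_eq_measure ennreal_less_iff)
  qed
  then obtain K where K: "compact K" "K \<subseteq> U" "measure \<mu> U < measure \<mu> K + \<delta>" by blast
  have "K \<in> sets borel" using compact_imp_closed[OF K(1)] by simp
  then have "measure \<mu> (U - K) < \<delta>" using finite_measure_Diff[of U K] U K by simp
  then show ?thesis using that[of K U] K U 1 by blast
qed

text \<open>The indicator of \<open>B\<close> and a Urysohn function for \<open>K\<close> inside
  \<open>U\<close> differ by at most 1, and only on \<open>U - B\<close> or \<open>U - K\<close>. So
  the integral of \<open>h\<close> over each Borel set vanishes.\<close>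

lemma AE_zero_if_orth_continuous:
  fixes h :: "'g \<Rightarrow> complex"
  assumes h [measurable]: "h \<in> borel_measurable \<mu>" and sq: "integrable \<mu> (\<lambda>x. (norm (h x))\<^sup>2)"
    and orth: "\<And>k. cont k \<Longrightarrow> (\<integral>x. h x * k x \<partial>\<mu>) = 0"
  shows "AE x in \<mu>. h x = 0"
proof (rule density_zero)
  show int: "integrable \<mu> h" by (rule integrable_of_square[OF h sq])
  fix B assume "B \<in> sets \<mu>"
  then have B: "B \<in> sets borel" by simp
  have "norm (\<integral>x. h x * indicator B x \<partial>\<mu>) \<le> e" if e: "e > 0" for e
  proof -
    obtain \<delta> where \<delta>: "\<delta> > 0"
      "\<And>D. D \<in> sets borel \<Longrightarrow> measure \<mu> D < \<delta> \<Longrightarrow> (\<integral>x. indicator D x * norm (h x) \<partial>\<mu>) < e / 2"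
      using small_set_integral[OF h sq, of "e / 2"] e by auto
    obtain K U where KU: "compact K" "open U" "B \<subseteq> U" "K \<subseteq> U" "measure \<mu> (U - B) < \<delta>" "measure \<mu> (U - K) < \<delta>"
      by (rule Radon_approx[OF B \<delta>(1)])
    have Kb: "K \<in> sets borel" using compact_imp_closed[OF KU(1)] by simp
    obtain k :: "'g \<Rightarrow> real" where k: "continuous_on UNIV k" "\<And>x. 0 \<le> k x" "\<And>x. k x \<le> 1"
      "\<And>x. x \<in> K \<Longrightarrow> k x = 1" "\<And>x. x \<notin> U \<Longrightarrow> k x = 0"
      by (rule Urysohn_compact_open[OF KU(1,2,4)]) blast
    have kc: "cont (\<lambda>x. complex_of_real (k x))" by (intro continuous_intros k)
    have D: "U - B \<in> sets borel" "U - K \<in> sets borel" using KU B Kb by auto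
    have i: "integrable \<mu> (\<lambda>x. indicator D x * norm (h x))" if "D \<in> sets borel" for D :: "'g set"
      using integrable_real_mult_indicator[of D \<mu> "\<lambda>x. norm (h x)"] int that
      by (simp add: mult.commute)
    have iB: "integrable \<mu> (\<lambda>x. h x * indicator B x)"
      using integrable_mult_indicator[of B \<mu> h] int B by (simp add: scaleR_conv_of_real mult.commute of_real_indicator)
    have ik: "integrable \<mu> (\<lambda>x. h x * of_real (k x))" by (rule integrable_mult_continuous[OF int kc])
    have "(\<integral>x. h x * indicator B x \<partial>\<mu>) = (\<integral>x. h x * indicator B x - h x * of_real (k x) \<partial>\<mu>)"
      using iB ik orth[OF kc] by simp
    also have "norm \<dots> \<le> (\<integral>x. norm (h x * indicator B x - h x * of_real (k x)) \<partial>\<mu>)" by simp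
    also have "\<dots> \<le> (\<integral>x. indicator (U - B) x * norm (h x) + indicator (U - K) x * norm (h x) \<partial>\<mu>)"
    proof (rule integral_mono)
      show "integrable \<mu> (\<lambda>x. norm (h x * indicator B x - h x * of_real (k x)))"
        using iB ik by simp
      show "integrable \<mu> (\<lambda>x. indicator (U - B) x * norm (h x) + indicator (U - K) x * norm (h x))"
        using i D by simp
      fix x
      have "norm (complex_of_real (indicator B x) - of_real (k x)) \<le> indicator (U - B) x + indicator (U - K) x"
        using k(2)[of x] k(3)[of x] k(4)[of x] k(5)[of x] KU(3,4)
        unfolding of_real_diff[symmetric] norm_of_real by (auto simp: indicator_def)
      then have "norm (h x) * norm (complex_of_real (indicator B x) - of_real (k x))
          \<le> norm (h x) * (indicator (U - B) x + indicator (U - K) x)"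
        by (intro mult_left_mono) auto
      then show "norm (h x * indicator B x - h x * of_real (k x)) \<le>
          indicator (U - B) x * norm (h x) + indicator (U - K) x * norm (h x)"
        by (simp add: norm_mult[symmetric] right_diff_distrib of_real_indicator algebra_simps)
    qed
    also have "\<dots> \<le> e" using i D \<delta>(2)[OF D(1) KU(5)] \<delta>(2)[OF D(2) KU(6)] by simp
    finally show ?thesis .
  qed
  then have "norm (\<integral>x. h x * indicator B x \<partial>\<mu>) \<le> 0"
    using field_le_epsilon[of "norm (\<integral>x. h x * indicator B x \<partial>\<mu>)" 0] by simp
  then show "set_lebesgue_integral \<mu> B h = 0"
    by (simp add: set_lebesgue_integral_def scaleR_conv_of_real mult.commute of_real_indicator)
qed

lemma orth_irreps_AE_zero:
  assumes "h \<in> borel_measurable \<mu>" "integrable \<mu> (\<lambda>x. (norm (h x))\<^sup>2)" "orth_irreps h"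
  shows "AE x in \<mu>. h x = 0"
  using AE_zero_if_orth_continuous[OF assms(1,2)]
    orth_irreps_continuous[OF integrable_of_square[OF assms(1,2)] assms(3)] by blast

end

section \<open>Inner product geometry in the target space\<close>

context complex_hilbert
begin

lemma cinner_add_right: "cinner x (y + z) = cinner x y + cinner x z"
  by (metis cinner_add_left cinner_commute complex_cnj_add)

lemma cinner_scaleC_right: "cinner x (c *\<^sub>C y) = cnj c * cinner x y"
  by (metis cinner_scaleC_left cinner_commute complex_cnj_mult)

lemma norm_scaleC: "norm (c *\<^sub>C x) = cmod c * norm x"
proof -
  have "complex_of_real ((norm (c *\<^sub>C x))\<^sup>2) = c * cnj c * cinner x x"
    by (simp only: cinner_self[symmetric] cinner_scaleC_left cinner_scaleC_right mult_ac)
  also have "\<dots> = complex_of_real ((cmod c * norm x)\<^sup>2)"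
    by (simp only: cinner_self complex_norm_square[symmetric] of_real_mult[symmetric] power_mult_distrib)
  finally have "(norm (c *\<^sub>C x))\<^sup>2 = (cmod c * norm x)\<^sup>2" using of_real_eq_iff by blast
  then show ?thesis by (simp add: power2_eq_iff_nonneg)
qed

end

text \<open>The real part is what appears when a squared norm is expanded, and it can be compared by
  order when atoms are selected.\<close>

definition rinner :: "'a::complex_hilbert \<Rightarrow> 'a \<Rightarrow> real" where
  "rinner x y = Re (cinner x y)"

lemma rinner_commute: "rinner x y = rinner y x"
  unfolding rinner_def by (subst cinner_commute) simp

lemma rinner_add_left: "rinner (x + y) z = rinner x z + rinner y z"
  by (simp add: rinner_def cinner_add_left)

lemma rinner_scaleR_left: "rinner (r *\<^sub>R x) y = r * rinner x y"
  by (simp add: rinner_def scaleR_scaleC cinner_scaleC_left)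

lemma rinner_self: "rinner x x = (norm x)\<^sup>2"
  by (simp add: rinner_def cinner_self)

lemma rinner_add_right: "rinner x (y + z) = rinner x y + rinner x z"
  by (simp add: rinner_commute[of x] rinner_add_left)

lemma rinner_scaleR_right: "rinner x (r *\<^sub>R y) = r * rinner x y"
  by (simp add: rinner_commute[of x] rinner_scaleR_left)

lemma norm_add_square: "(norm (x + y))\<^sup>2 = (norm x)\<^sup>2 + 2 * rinner x y + (norm y)\<^sup>2"
  by (simp add: rinner_self[symmetric] rinner_add_left rinner_add_right rinner_commute[of y x])

lemma rinner_minus_right: "rinner x (- y) = - rinner x y"
  using rinner_scaleR_right[of x "- 1" y] by simp

lemma norm_diff_square: "(norm (x - y))\<^sup>2 = (norm x)\<^sup>2 - 2 * rinner x y + (norm y)\<^sup>2"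
  using norm_add_square[of x "- y"] by (simp add: rinner_minus_right)

lemma rinner_le: "rinner x y \<le> norm x * norm y"
proof (cases "norm x = 0 \<or> norm y = 0")
  case True
  then show ?thesis
    using rinner_scaleR_left[of 0 x y] rinner_scaleR_right[of x 0 y] by auto
next
  case False
  then have n: "norm x > 0" "norm y > 0" by auto
  have "0 \<le> (norm ((1 / norm x) *\<^sub>R x - (1 / norm y) *\<^sub>R y))\<^sup>2" by simp
  also have "\<dots> = 2 - 2 * (rinner x y / (norm x * norm y))"
    unfolding norm_diff_square using n by (simp add: rinner_scaleR_left rinner_scaleR_right)
  finally show ?thesis using n by (simp add: field_simps)
qed

lemma abs_rinner_le: "\<bar>rinner x y\<bar> \<le> norm x * norm y"
  using rinner_le[of x y] rinner_le[of x "- y"] by (simp add: rinner_minus_right abs_le_iff)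

text \<open>Rotating \<open>x\<close> by a unimodular scalar makes the inner product equal to its
  modulus, which reduces the claim to \<open>rinner_le\<close>.\<close>

lemma norm_cinner_le: "norm (cinner x y) \<le> norm x * norm (y :: 'a::complex_hilbert)"
proof (cases "cinner x y = 0")
  case False
  define c where "c = cnj (cinner x y) / complex_of_real (norm (cinner x y))"
  have c: "norm c = 1" using False by (simp add: c_def norm_divide)
  have "c * cinner x y = of_real (norm (cinner x y))"
    using False by (simp add: c_def field_simps complex_norm_square[symmetric] power2_eq_square flip: of_real_mult)
  then have "norm (cinner x y) = rinner (c *\<^sub>C x) y"
    by (simp add: rinner_def cinner_scaleC_left)
  also have "\<dots> \<le> norm (c *\<^sub>C x) * norm y" by (rule rinner_le)
  finally show ?thesis by (simp add: norm_scaleC c)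
qed simp

lemma scaleC_scaleR_left: "(r *\<^sub>R c) *\<^sub>C x = r *\<^sub>R (c *\<^sub>C (x :: 'a::complex_hilbert))"
  by (simp add: scaleR_scaleC scaleC_scaleC scaleR_conv_of_real)

lemma scaleC_scaleR_right: "c *\<^sub>C (r *\<^sub>R x) = r *\<^sub>R (c *\<^sub>C (x :: 'a::complex_hilbert))"
  by (simp add: scaleR_scaleC scaleC_scaleC mult.commute)

lemma bounded_bilinear_scaleC: "bounded_bilinear (scaleC :: complex \<Rightarrow> 'a \<Rightarrow> 'a::complex_hilbert)"
proof
  show "\<exists>K. \<forall>a b. norm (a *\<^sub>C (b :: 'a)) \<le> norm a * norm b * K"
    by (rule exI[of _ 1]) (simp add: norm_scaleC)
qed (simp_all add: scaleC_add_left scaleC_add_right scaleC_scaleR_left scaleC_scaleR_right)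

lemma bounded_bilinear_cinner: "bounded_bilinear (cinner :: 'a \<Rightarrow> 'a::complex_hilbert \<Rightarrow> complex)"
proof
  show "\<exists>K. \<forall>a b. norm (cinner (a :: 'a) b) \<le> norm a * norm b * K"
    by (rule exI[of _ 1]) (simp add: norm_cinner_le)
qed (simp_all add: cinner_add_left cinner_add_right scaleR_scaleC cinner_scaleC_left cinner_scaleC_right
    scaleR_conv_of_real)

lemma bounded_bilinear_rinner: "bounded_bilinear (rinner :: 'a \<Rightarrow> 'a::complex_hilbert \<Rightarrow> real)"
proof
  show "\<exists>K. \<forall>a b. norm (rinner (a :: 'a) b) \<le> norm a * norm b * K"
    by (rule exI[of _ 1]) (simp add: abs_rinner_le)
qed (simp_all add: rinner_add_left rinner_add_right rinner_scaleR_left rinner_scaleR_right)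

lemmas scaleC_continuous [continuous_intros] = bounded_bilinear.continuous_on[OF bounded_bilinear_scaleC]

lemma borel_measurable_bilinear:
  fixes op :: "'b::{second_countable_topology,real_normed_vector} \<Rightarrow>
    'c::{second_countable_topology,real_normed_vector} \<Rightarrow> 'd::real_normed_vector"
  assumes op: "bounded_bilinear op" and f: "f \<in> borel_measurable M" and g: "g \<in> borel_measurable M"
  shows "(\<lambda>x. op (f x) (g x)) \<in> borel_measurable M"
  by (rule borel_measurable_continuous_Pair[OF f g bounded_bilinear.continuous_on[OF op]])
     (auto intro: continuous_intros)

section \<open>Square-integrable functions with values in a Hilbert space\<close>

context haar_compact
begin

definition L2 :: "('g \<Rightarrow> 'a::{complex_hilbert,second_countable_topology}) \<Rightarrow> bool" where
  "L2 f \<longleftrightarrow> f \<in> borel_measurable \<mu> \<and> integrable \<mu> (\<lambda>x. (norm (f x))\<^sup>2)"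

definition L2_inner where
  "L2_inner f g = (\<integral>x. rinner (f x) (g x) \<partial>\<mu>)"

lemma L2_integrable: "L2 f \<Longrightarrow> integrable \<mu> f"
  by (auto simp: L2_def intro: integrable_of_square)

lemma L2_borel: "L2 f \<Longrightarrow> f \<in> borel_measurable \<mu>"
  by (simp add: L2_def)

lemma L2_bounded:
  assumes "f \<in> borel_measurable \<mu>" "\<And>x. norm (f x) \<le> B"
  shows "L2 f"
  unfolding L2_def
proof
  show "integrable \<mu> (\<lambda>x. (norm (f x))\<^sup>2)"
    using assms by (intro integrable_const_bound[of _ "B\<^sup>2"]) (auto intro!: power_mono)
qed fact

lemma L2_continuous: "continuous_on UNIV f \<Longrightarrow> L2 f"
  by (metis L2_bounded continuous_bounded continuous_borel_measurable)

lemma L2_add: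
  assumes f: "L2 f" and g: "L2 g"
  shows "L2 (\<lambda>x. f x + g x)"
  unfolding L2_def
proof
  have m: "f \<in> borel_measurable \<mu>" "g \<in> borel_measurable \<mu>" using assms by (auto simp: L2_def)
  then show "(\<lambda>x. f x + g x) \<in> borel_measurable \<mu>" by simp
  show "integrable \<mu> (\<lambda>x. (norm (f x + g x))\<^sup>2)"
  proof (rule Bochner_Integration.integrable_bound)
    show "integrable \<mu> (\<lambda>x. 2 * ((norm (f x))\<^sup>2 + (norm (g x))\<^sup>2))"
      using assms by (simp add: L2_def)
    show "(\<lambda>x. (norm (f x + g x))\<^sup>2) \<in> borel_measurable \<mu>" using m by simp
    have "(norm (f x + g x))\<^sup>2 \<le> 2 * ((norm (f x))\<^sup>2 + (norm (g x))\<^sup>2)" for x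
      using zero_le_power2[of "norm (f x - g x)"] unfolding norm_add_square norm_diff_square by simp
    then show "AE x in \<mu>. norm ((norm (f x + g x))\<^sup>2) \<le> norm (2 * ((norm (f x))\<^sup>2 + (norm (g x))\<^sup>2))"
      by (simp add: abs_of_nonneg)
  qed
qed

lemma L2_scaleR: "L2 f \<Longrightarrow> L2 (\<lambda>x. r *\<^sub>R f x)"
  by (auto simp: L2_def power_mult_distrib)

lemma L2_diff: "L2 f \<Longrightarrow> L2 g \<Longrightarrow> L2 (\<lambda>x. f x - g x)"
  using L2_add[of f "\<lambda>x. (- 1) *\<^sub>R g x"] L2_scaleR[of g "- 1"] by simp

lemma rinner_integrable:
  assumes f: "L2 f" and g: "L2 g"
  shows "integrable \<mu> (\<lambda>x. rinner (f x) (g x))"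
proof (rule Bochner_Integration.integrable_bound)
  show "integrable \<mu> (\<lambda>x. (norm (f x))\<^sup>2 + (norm (g x))\<^sup>2)" using assms by (simp add: L2_def)
  show "(\<lambda>x. rinner (f x) (g x)) \<in> borel_measurable \<mu>"
    by (intro borel_measurable_bilinear[OF bounded_bilinear_rinner] L2_borel assms)
  have "norm (rinner (f x) (g x)) \<le> norm ((norm (f x))\<^sup>2 + (norm (g x))\<^sup>2)" for x
  proof -
    have "0 \<le> (norm (f x) - norm (g x))\<^sup>2" by simp
    then have "norm (f x) * norm (g x) \<le> (norm (f x))\<^sup>2 + (norm (g x))\<^sup>2"
      using mult_nonneg_nonneg[OF norm_ge_zero[of "f x"] norm_ge_zero[of "g x"]]
      unfolding power2_diff by linarith
    then show ?thesis using abs_rinner_le[of "f x" "g x"] by simp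
  qed
  then show "AE x in \<mu>. norm (rinner (f x) (g x)) \<le> norm ((norm (f x))\<^sup>2 + (norm (g x))\<^sup>2)" by simp
qed

lemma scaleC_integrable:
  assumes u: "cont u" and h: "integrable \<mu> h"
  shows "integrable \<mu> (\<lambda>x. u x *\<^sub>C (h x :: 'a::{complex_hilbert,second_countable_topology}))"
proof -
  obtain B where B: "\<And>x. norm (u x) \<le> B" using continuous_bounded[OF u] by blast
  show ?thesis
  proof (rule Bochner_Integration.integrable_bound)
    show "integrable \<mu> (\<lambda>x. B * norm (h x))" using h by simp
    show "(\<lambda>x. u x *\<^sub>C h x) \<in> borel_measurable \<mu>"
      using borel_measurable_bilinear[OF bounded_bilinear_scaleC continuous_borel_measurable[OF u]
          borel_measurable_integrable[OF h]] .
    have "norm (u x *\<^sub>C h x) \<le> norm (B * norm (h x))" for x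
      using mult_right_mono[OF order.trans[OF B[of x] abs_ge_self], of "norm (h x)"]
      by (simp add: norm_scaleC abs_mult)
    then show "AE x in \<mu>. norm (u x *\<^sub>C h x) \<le> norm (B * norm (h x))" by simp
  qed
qed

lemma integral_scaleC_const:
  assumes "integrable \<mu> u"
  shows "(\<integral>x. u x *\<^sub>C (a :: 'a::{complex_hilbert,second_countable_topology}) \<partial>\<mu>) = (\<integral>x. u x \<partial>\<mu>) *\<^sub>C a"
  by (rule integral_bounded_linear[OF bounded_bilinear.bounded_linear_left[OF bounded_bilinear_scaleC] assms])

lemma integral_const_scaleC:
  assumes "integrable \<mu> h"
  shows "(\<integral>x. c *\<^sub>C (h x :: 'a::{complex_hilbert,second_countable_topology}) \<partial>\<mu>) = c *\<^sub>C (\<integral>x. h x \<partial>\<mu>)"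
  by (rule integral_bounded_linear[OF bounded_bilinear.bounded_linear_right[OF bounded_bilinear_scaleC] assms])

text \<open>The scalar result applies to \<open>cinner (h x) a\<close> for each \<open>a\<close>; a
  countable dense set of vectors \<open>a\<close> yields one exceptional null set.\<close>

lemma orth_irreps_AE_zero_vector:
  fixes h :: "'g \<Rightarrow> 'a::{complex_hilbert,second_countable_topology}"
  assumes h: "L2 h"
    and orth: "\<And>d \<pi> i j. irreducible_rep d \<pi> \<Longrightarrow> i < d \<Longrightarrow> j < d \<Longrightarrow>
      (\<integral>x. cnj (\<pi> x $$ (i, j)) *\<^sub>C h x \<partial>\<mu>) = 0"
  shows "AE x in \<mu>. h x = 0"
proof -
  have AEa: "AE x in \<mu>. cinner (h x) a = 0" for a
  proof (rule orth_irreps_AE_zero)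
    show m: "(\<lambda>x. cinner (h x) a) \<in> borel_measurable \<mu>"
      by (intro borel_measurable_bilinear[OF bounded_bilinear_cinner L2_borel[OF h]]) simp
    show "integrable \<mu> (\<lambda>x. (norm (cinner (h x) a))\<^sup>2)"
    proof (rule Bochner_Integration.integrable_bound)
      show "integrable \<mu> (\<lambda>x. (norm a)\<^sup>2 * (norm (h x))\<^sup>2)" using h by (simp add: L2_def)
      have "(norm (cinner (h x) a))\<^sup>2 \<le> (norm (h x) * norm a)\<^sup>2" for x
        by (intro power_mono norm_cinner_le) simp
      then show "AE x in \<mu>. norm ((norm (cinner (h x) a))\<^sup>2) \<le> norm ((norm a)\<^sup>2 * (norm (h x))\<^sup>2)"
        by (simp add: power_mult_distrib mult.commute)
    qed (use m in simp)
    show "orth_irreps (\<lambda>x. cinner (h x) a)"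
      unfolding orth_irreps_def
    proof (intro allI impI)
      fix d i j :: nat and \<pi> :: "'g matrep" assume \<pi>: "irreducible_rep d \<pi>" and ij: "i < d" "j < d"
      have int: "integrable \<mu> (\<lambda>x. cnj (\<pi> x $$ (i, j)) *\<^sub>C h x)"
        by (intro scaleC_integrable continuous_intros rep_cont[OF \<pi>] ij L2_integrable h)
      have "(\<integral>x. cinner (h x) a * cnj (\<pi> x $$ (i, j)) \<partial>\<mu>) = (\<integral>x. cinner (cnj (\<pi> x $$ (i, j)) *\<^sub>C h x) a \<partial>\<mu>)"
        by (simp add: cinner_scaleC_left mult.commute)
      also have "\<dots> = cinner (\<integral>x. cnj (\<pi> x $$ (i, j)) *\<^sub>C h x \<partial>\<mu>) a"
        by (rule integral_bounded_linear[OF bounded_bilinear.bounded_linear_left[OF bounded_bilinear_cinner] int])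
      also have "\<dots> = 0"
        using cinner_scaleC_left[of 0 0 a] scaleR_scaleC[of 0 "0 :: 'a"] by (simp add: orth[OF \<pi> ij])
      finally show "(\<integral>x. cinner (h x) a * cnj (\<pi> x $$ (i, j)) \<partial>\<mu>) = 0" .
    qed
  qed
  obtain D :: "'a set" where D: "countable D" "\<And>X. open X \<Longrightarrow> X \<noteq> {} \<Longrightarrow> \<exists>d\<in>D. d \<in> X"
    using countable_dense_setE by metis
  have "AE x in \<mu>. \<forall>a\<in>D. cinner (h x) a = 0" using AEa D(1) by (simp add: AE_ball_countable)
  then show ?thesis
  proof eventually_elim
    case (elim x)
    show ?case
    proof (rule ccontr)
      assume nz: "h x \<noteq> 0"
      then have "ball (h x) (norm (h x)) \<noteq> {}" by simp
      then obtain a where a: "a \<in> D" "a \<in> ball (h x) (norm (h x))" using D(2) open_ball by metis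
      \<comment> \<open>By Pythagoras a vector orthogonal to \<open>h x\<close> has distance at
        least \<open>norm (h x)\<close> from it, which contradicts this choice of
        \<open>a\<close>.\<close>
      have "(norm (h x - a))\<^sup>2 < (norm (h x))\<^sup>2"
        using a(2) by (intro power_strict_mono) (auto simp: dist_norm)
      moreover have "rinner (h x) a = 0" using elim a(1) by (simp add: rinner_def)
      ultimately show False by (simp add: norm_diff_square)
    qed
  qed
qed

end

section \<open>Coefficients in the chosen bases\<close>

locale haar_dual = haar_compact \<mu>
  for \<mu> :: "'g::{topological_group_add,t2_space} measure" +
  fixes rp :: "'g matrep set \<Rightarrow> 'g matrep" and \<xi> :: "'g matrep set \<Rightarrow> nat \<Rightarrow> complex Matrix.vec"
  assumes dual: "dual_choice rp \<xi>"
begin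

abbreviation dm :: "'g matrep set \<Rightarrow> nat" where
  "dm \<sigma> \<equiv> rep_dim (rp \<sigma>)"

definition basis_mat :: "'g matrep set \<Rightarrow> complex Matrix.mat" where
  "basis_mat \<sigma> = mat (dm \<sigma>) (dm \<sigma>) (\<lambda>(k, j). \<xi> \<sigma> (Suc j) $ k)"

text \<open>The representative \<open>rp \<sigma>\<close> written in the basis \<open>\<xi> \<sigma>\<close>. Matrix indices start at 0, whereas
  the basis vectors are numbered from 1.\<close>

definition \<tau> :: "'g matrep set \<Rightarrow> 'g matrep" where
  "\<tau> \<sigma> x = mat_adjoint (basis_mat \<sigma>) * rp \<sigma> x * basis_mat \<sigma>"

lemma rp_irreducible:
  assumes "\<sigma> \<in> unitary_dual"
  shows "rp \<sigma> \<in> irreps" "irreducible_rep (dm \<sigma>) (rp \<sigma>)"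
proof -
  have "rp \<sigma> \<in> \<sigma>" using dual assms by (auto simp: dual_choice_def)
  then show "rp \<sigma> \<in> irreps"
    using assms equiv_unitary_equiv by (auto simp: unitary_dual_def dest: in_quotient_imp_subset)
  then show "irreducible_rep (dm \<sigma>) (rp \<sigma>)" by (rule irreps_rep_dim)
qed

lemma \<xi>_carrier: "\<sigma> \<in> unitary_dual \<Longrightarrow> j < dm \<sigma> \<Longrightarrow> \<xi> \<sigma> (Suc j) \<in> carrier_vec (dm \<sigma>)"
  using dual by (auto simp: dual_choice_def orthonormal_basis_def)

lemma cscalar_prod_sum:
  assumes "v \<in> carrier_vec n" "w \<in> carrier_vec n"
  shows "v \<bullet>c w = (\<Sum>k<n. v $ k * cnj (w $ k :: complex))"
  using assms by (auto simp: scalar_prod_def lessThan_atLeast0 intro!: sum.cong)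

lemma basis_mat_unitary:
  assumes \<sigma>: "\<sigma> \<in> unitary_dual"
  shows "unitary_mat (dm \<sigma>) (basis_mat \<sigma>)"
proof (rule unitary_matI)
  show c: "basis_mat \<sigma> \<in> carrier_mat (dm \<sigma>) (dm \<sigma>)" by (simp add: basis_mat_def)
  show "mat_adjoint (basis_mat \<sigma>) * basis_mat \<sigma> = 1\<^sub>m (dm \<sigma>)"
  proof (rule eq_matI)
    fix i j assume "i < dim_row (1\<^sub>m (dm \<sigma>))" "j < dim_col (1\<^sub>m (dm \<sigma>))"
    then have ij: "i < dm \<sigma>" "j < dm \<sigma>" by auto
    have "(mat_adjoint (basis_mat \<sigma>) * basis_mat \<sigma>) $$ (i, j) =
        (\<Sum>k<dm \<sigma>. mat_adjoint (basis_mat \<sigma>) $$ (i, k) * basis_mat \<sigma> $$ (k, j))"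
      by (rule mult_mat_index[OF mat_adjoint_carrier[OF c] c ij])
    also have "\<dots> = (\<Sum>k<dm \<sigma>. \<xi> \<sigma> (Suc j) $ k * cnj (\<xi> \<sigma> (Suc i) $ k))"
      using ij by (intro sum.cong) (auto simp: basis_mat_def)
    also have "\<dots> = \<xi> \<sigma> (Suc j) \<bullet>c \<xi> \<sigma> (Suc i)"
      by (rule cscalar_prod_sum[symmetric]) (intro \<xi>_carrier \<sigma> ij)+
    also have "\<dots> = (if Suc j = Suc i then 1 else 0)"
    proof -
      have "orthonormal_basis (dm \<sigma>) (\<xi> \<sigma>)" using dual \<sigma> by (auto simp: dual_choice_def)
      moreover have "Suc j \<in> {1..dm \<sigma>}" "Suc i \<in> {1..dm \<sigma>}" using ij by auto
      ultimately show ?thesis unfolding orthonormal_basis_def by blast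
    qed
    finally show "(mat_adjoint (basis_mat \<sigma>) * basis_mat \<sigma>) $$ (i, j) = 1\<^sub>m (dm \<sigma>) $$ (i, j)"
      using ij by auto
  qed (auto simp: basis_mat_def)
qed

lemma \<tau>_irreducible: "\<sigma> \<in> unitary_dual \<Longrightarrow> irreducible_rep (dm \<sigma>) (\<tau> \<sigma>)"
  unfolding \<tau>_def[abs_def]
  by (intro irreducible_rep_unitary_conj rp_irreducible basis_mat_unitary)

lemma \<tau>_index:
  assumes \<sigma>: "\<sigma> \<in> unitary_dual" and ij: "i < dm \<sigma>" "j < dm \<sigma>"
  shows "\<tau> \<sigma> x $$ (i, j) = matrix_coeff (rp \<sigma>) (\<xi> \<sigma>) (Suc i) (Suc j) x"
proof -
  note c = unitary_matD(1,2)[OF basis_mat_unitary[OF \<sigma>]] irreducible_repD(7)[OF rp_irreducible(2)[OF \<sigma>], of x]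
  have "\<tau> \<sigma> x = mat_adjoint (basis_mat \<sigma>) * (rp \<sigma> x * basis_mat \<sigma>)"
    unfolding \<tau>_def by (rule assoc_mult_mat[OF c(2,3,1)])
  then have "\<tau> \<sigma> x $$ (i, j) = (\<Sum>k<dm \<sigma>. mat_adjoint (basis_mat \<sigma>) $$ (i, k) * (rp \<sigma> x * basis_mat \<sigma>) $$ (k, j))"
    using mult_mat_index[OF c(2) mult_carrier_mat[OF c(3,1)] ij] by simp
  also have "\<dots> = (\<Sum>k<dm \<sigma>. (rp \<sigma> x *\<^sub>v \<xi> \<sigma> (Suc j)) $ k * cnj (\<xi> \<sigma> (Suc i) $ k))"
  proof (intro sum.cong refl)
    fix k assume "k \<in> {..<dm \<sigma>}"
    then have k: "k < dm \<sigma>" by simp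
    have "(rp \<sigma> x * basis_mat \<sigma>) $$ (k, j) = (\<Sum>l<dm \<sigma>. rp \<sigma> x $$ (k, l) * basis_mat \<sigma> $$ (l, j))"
      by (rule mult_mat_index[OF c(3,1) k ij(2)])
    also have "\<dots> = (\<Sum>l<dm \<sigma>. rp \<sigma> x $$ (k, l) * \<xi> \<sigma> (Suc j) $ l)"
      using ij by (intro sum.cong) (auto simp: basis_mat_def)
    also have "\<dots> = (rp \<sigma> x *\<^sub>v \<xi> \<sigma> (Suc j)) $ k"
      by (rule mult_mat_vec_index[OF c(3) \<xi>_carrier[OF \<sigma> ij(2)] k, symmetric])
    finally show "mat_adjoint (basis_mat \<sigma>) $$ (i, k) * (rp \<sigma> x * basis_mat \<sigma>) $$ (k, j) =
        (rp \<sigma> x *\<^sub>v \<xi> \<sigma> (Suc j)) $ k * cnj (\<xi> \<sigma> (Suc i) $ k)"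
      using k ij by (simp add: basis_mat_def mult.commute del: index_mult_mat index_mult_mat_vec)
  qed
  also have "\<dots> = (rp \<sigma> x *\<^sub>v \<xi> \<sigma> (Suc j)) \<bullet>c \<xi> \<sigma> (Suc i)"
    using mult_mat_vec_carrier[OF c(3) \<xi>_carrier[OF \<sigma> ij(2)]] \<xi>_carrier[OF \<sigma> ij(1)]
    by (rule cscalar_prod_sum[symmetric])
  finally show ?thesis by (simp add: matrix_coeff_def)
qed

lemma cscalar_prod_adjoint:
  assumes A: "A \<in> carrier_mat n n" and v: "v \<in> carrier_vec n" "w \<in> carrier_vec n"
  shows "(mat_adjoint A *\<^sub>v v) \<bullet>c w = cnj ((A *\<^sub>v w) \<bullet>c v)"
proof -
  have "(mat_adjoint A *\<^sub>v v) \<bullet>c w = (\<Sum>k<n. (mat_adjoint A *\<^sub>v v) $ k * cnj (w $ k))"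
    by (rule cscalar_prod_sum[OF mult_mat_vec_carrier[OF mat_adjoint_carrier[OF A] v(1)] v(2)])
  also have "\<dots> = (\<Sum>k<n. \<Sum>l<n. cnj (A $$ (l, k)) * v $ l * cnj (w $ k))"
  proof (intro sum.cong refl)
    fix k assume k: "k \<in> {..<n}"
    then have "(mat_adjoint A *\<^sub>v v) $ k = (\<Sum>l<n. mat_adjoint A $$ (k, l) * v $ l)"
      using mult_mat_vec_index[OF mat_adjoint_carrier[OF A] v(1)] by simp
    also have "\<dots> = (\<Sum>l<n. cnj (A $$ (l, k)) * v $ l)"
      using A k by (intro sum.cong) auto
    finally show "(mat_adjoint A *\<^sub>v v) $ k * cnj (w $ k) = (\<Sum>l<n. cnj (A $$ (l, k)) * v $ l * cnj (w $ k))"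
      by (simp add: sum_distrib_right)
  qed
  also have "\<dots> = (\<Sum>l<n. \<Sum>k<n. cnj (A $$ (l, k)) * v $ l * cnj (w $ k))" by (rule sum.swap)
  also have "\<dots> = cnj (\<Sum>l<n. (A *\<^sub>v w) $ l * cnj (v $ l))"
  proof -
    have "(A *\<^sub>v w) $ l = (\<Sum>k<n. A $$ (l, k) * w $ k)" if "l < n" for l
      by (rule mult_mat_vec_index[OF A v(2) that])
    then show ?thesis by (simp add: sum_distrib_left mult_ac del: index_mult_mat_vec)
  qed
  also have "\<dots> = cnj ((A *\<^sub>v w) \<bullet>c v)"
    by (subst cscalar_prod_sum[OF mult_mat_vec_carrier[OF A v(2)] v(1)]) simp
  finally show ?thesis .
qed

text \<open>Moving the adjoint across the inner product conjugates it and exchanges the two vectors,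
  so the coefficient at \<open>(\<xi>\<^sub>j, \<xi>\<^sub>i)\<close> belongs to the matrix entry
  with transposed indices. The double sum in the Barron norm absorbs the transposition.\<close>

lemma fourier_coeff_eq:
  assumes \<sigma>: "\<sigma> \<in> unitary_dual" and ij: "i < dm \<sigma>" "j < dm \<sigma>"
  shows "fourier_coeff \<mu> f (rp \<sigma>) (\<xi> \<sigma> (Suc j)) (\<xi> \<sigma> (Suc i)) = (\<integral>x. cnj (\<tau> \<sigma> x $$ (j, i)) *\<^sub>C f x \<partial>\<mu>)"
  unfolding fourier_coeff_def \<tau>_index[OF \<sigma> ij(2,1)] matrix_coeff_def
  using cscalar_prod_adjoint[OF irreducible_repD(7)[OF rp_irreducible(2)[OF \<sigma>]] \<xi>_carrier[OF \<sigma> ij(2)] \<xi>_carrier[OF \<sigma> ij(1)]]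
  by simp

lemma \<tau>_equiv: "\<sigma> \<in> unitary_dual \<Longrightarrow> (\<tau> \<sigma>, rp \<sigma>) \<in> unitary_equiv"
proof (rule unitary_equivI[OF \<tau>_irreducible rp_irreducible(2) basis_mat_unitary])
  fix x assume \<sigma>: "\<sigma> \<in> unitary_dual"
  note c = unitary_matD[OF basis_mat_unitary[OF \<sigma>]] irreducible_repD(7)[OF rp_irreducible(2)[OF \<sigma>], of x]
  have "basis_mat \<sigma> * \<tau> \<sigma> x = basis_mat \<sigma> * (mat_adjoint (basis_mat \<sigma>) * (rp \<sigma> x * basis_mat \<sigma>))"
    unfolding \<tau>_def by (simp only: assoc_mult_mat[OF c(2,5,1)])
  also have "\<dots> = (basis_mat \<sigma> * mat_adjoint (basis_mat \<sigma>)) * (rp \<sigma> x * basis_mat \<sigma>)"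
    by (rule assoc_mult_mat[OF c(1,2) mult_carrier_mat[OF c(5,1)], symmetric])
  also have "\<dots> = rp \<sigma> x * basis_mat \<sigma>"
    unfolding c(4) by (rule left_mult_one_mat[OF mult_carrier_mat[OF c(5,1)]])
  finally show "basis_mat \<sigma> * \<tau> \<sigma> x = rp \<sigma> x * basis_mat \<sigma>" .
qed

lemma irrep_equiv_\<tau>:
  assumes "irreducible_rep d \<pi>"
  obtains \<sigma> where "\<sigma> \<in> unitary_dual" "(\<tau> \<sigma>, \<pi>) \<in> unitary_equiv"
proof
  define \<sigma> where "\<sigma> = unitary_equiv `` {\<pi>}"
  have "\<pi> \<in> irreps" using assms by (auto simp: irreps_def)
  then show \<sigma>: "\<sigma> \<in> unitary_dual" by (auto simp: unitary_dual_def \<sigma>_def intro: quotientI)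
  have "rp \<sigma> \<in> \<sigma>" using dual \<sigma> by (auto simp: dual_choice_def)
  then have "(\<pi>, rp \<sigma>) \<in> unitary_equiv" by (simp add: \<sigma>_def)
  then show "(\<tau> \<sigma>, \<pi>) \<in> unitary_equiv"
    using \<tau>_equiv[OF \<sigma>] by (blast intro: unitary_equiv_sym unitary_equiv_trans)
qed

lemma \<tau>_inequivalent:
  assumes "\<sigma> \<in> unitary_dual" "\<rho> \<in> unitary_dual" "(\<tau> \<sigma>, \<tau> \<rho>) \<in> unitary_equiv"
  shows "\<sigma> = \<rho>"
proof -
  have "(rp \<sigma>, rp \<rho>) \<in> unitary_equiv"
    using assms \<tau>_equiv by (blast intro: unitary_equiv_sym unitary_equiv_trans)
  moreover have "rp \<sigma> \<in> \<sigma>" "rp \<rho> \<in> \<rho>" using dual assms by (auto simp: dual_choice_def)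
  ultimately show ?thesis
    using quotient_eqI[OF equiv_unitary_equiv] assms unfolding unitary_dual_def by blast
qed

text \<open>Over an empty dual the constant 1 would be vacuously orthogonal to all coefficients, so
  its integral would be 0. Supplies the indices when \<open>M = 0\<close>.\<close>

lemma unitary_dual_nonempty: "\<exists>\<sigma>. \<sigma> \<in> (unitary_dual :: 'g matrep set set)"
proof (rule ccontr)
  assume none: "\<not> (\<exists>\<sigma>. \<sigma> \<in> (unitary_dual :: 'g matrep set set))"
  have "\<not> irreducible_rep d \<pi>" for d and \<pi> :: "'g matrep"
    using none irrep_equiv_\<tau> by metis
  then have "orth_irreps (\<lambda>_. 1)" by (simp add: orth_irreps_def)
  then have "(\<integral>x. 1 * 1 \<partial>\<mu>) = (0 :: complex)"
    by (intro orth_irreps_continuous integrable_continuous continuous_intros)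
  then show False by simp
qed

lemma \<tau>_cont: "\<sigma> \<in> unitary_dual \<Longrightarrow> i < dm \<sigma> \<Longrightarrow> j < dm \<sigma> \<Longrightarrow> cont (\<lambda>x. \<tau> \<sigma> x $$ (i, j))"
  by (rule rep_cont[OF \<tau>_irreducible])

lemma norm_\<tau>_le: "\<sigma> \<in> unitary_dual \<Longrightarrow> i < dm \<sigma> \<Longrightarrow> j < dm \<sigma> \<Longrightarrow> norm (\<tau> \<sigma> x $$ (i, j)) \<le> 1"
  by (rule norm_unitary_mat_le[OF irreducible_repD(3)[OF \<tau>_irreducible]])

lemma \<tau>_orthogonality:
  assumes \<sigma>: "\<sigma> \<in> unitary_dual" and \<rho>: "\<rho> \<in> unitary_dual" and "k < dm \<sigma>" "l < dm \<sigma>" "i < dm \<rho>" "j < dm \<rho>"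
  shows "(\<integral>x. \<tau> \<sigma> x $$ (k, l) * cnj (\<tau> \<rho> x $$ (i, j)) \<partial>\<mu>) =
    (if \<sigma> = \<rho> \<and> k = i \<and> l = j then 1 / of_nat (dm \<rho>) else 0)"
proof (cases "\<sigma> = \<rho>")
  case True
  then show ?thesis using Schur_orthogonality_same[OF \<tau>_irreducible[OF \<rho>], of k l i j] assms by simp
next
  case False
  then have "(\<tau> \<rho>, \<tau> \<sigma>) \<notin> unitary_equiv" using \<tau>_inequivalent[OF \<rho> \<sigma>] by blast
  then show ?thesis
    using Schur_orthogonality_inequivalent[OF \<tau>_irreducible[OF \<sigma>] \<tau>_irreducible[OF \<rho>], of k l i j] assms False
    by simp
qed

section \<open>Fourier coefficients and isotypic components\<close>

definition coef where
  "coef f \<sigma> i j = (\<integral>x. cnj (\<tau> \<sigma> x $$ (i, j)) *\<^sub>C f x \<partial>\<mu>)"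

text \<open>The isotypic component of \<open>f\<close> at \<sigma>; the factor
  \<open>dm \<sigma>\<close> cancels the \<open>1 / of_nat (dm \<sigma>)\<close> of Schur
  orthogonality, so coefficients are reproduced exactly.\<close>

definition fourier_part where
  "fourier_part f \<sigma> x = real (dm \<sigma>) *\<^sub>R (\<Sum>i<dm \<sigma>. \<Sum>j<dm \<sigma>. \<tau> \<sigma> x $$ (i, j) *\<^sub>C coef f \<sigma> i j)"

lemma barron_term_eq:
  assumes \<sigma>: "\<sigma> \<in> unitary_dual"
  shows "barron_term \<mu> rp \<xi> \<gamma> s f \<sigma> =
    real (dm \<sigma>) * (1 + (\<gamma> \<sigma>)\<^sup>2) powr (s / 2) * (\<Sum>i<dm \<sigma>. \<Sum>j<dm \<sigma>. norm (coef f \<sigma> i j))"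
proof -
  have "(\<Sum>i=1..dm \<sigma>. \<Sum>j=1..dm \<sigma>. norm (fourier_coeff \<mu> f (rp \<sigma>) (\<xi> \<sigma> j) (\<xi> \<sigma> i))) =
      (\<Sum>i<dm \<sigma>. \<Sum>j<dm \<sigma>. norm (fourier_coeff \<mu> f (rp \<sigma>) (\<xi> \<sigma> (Suc j)) (\<xi> \<sigma> (Suc i))))"
    unfolding One_nat_def sum.atLeast1_atMost_eq by (rule refl)
  also have "\<dots> = (\<Sum>i<dm \<sigma>. \<Sum>j<dm \<sigma>. norm (coef f \<sigma> j i))"
    by (intro sum.cong refl) (simp add: fourier_coeff_eq[OF \<sigma>] coef_def)
  also have "\<dots> = (\<Sum>j<dm \<sigma>. \<Sum>i<dm \<sigma>. norm (coef f \<sigma> j i))" by (rule sum.swap)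
  finally show ?thesis by (simp add: barron_term_def)
qed

lemma continuous_fourier_part: "\<sigma> \<in> unitary_dual \<Longrightarrow> continuous_on UNIV (fourier_part f \<sigma>)"
  unfolding fourier_part_def[abs_def] by (intro continuous_intros \<tau>_cont) auto

lemma norm_fourier_part_le:
  assumes \<sigma>: "\<sigma> \<in> unitary_dual"
  shows "norm (fourier_part f \<sigma> x) \<le> real (dm \<sigma>) * (\<Sum>i<dm \<sigma>. \<Sum>j<dm \<sigma>. norm (coef f \<sigma> i j))"
proof -
  have "norm (\<Sum>i<dm \<sigma>. \<Sum>j<dm \<sigma>. \<tau> \<sigma> x $$ (i, j) *\<^sub>C coef f \<sigma> i j) \<le>
      (\<Sum>i<dm \<sigma>. \<Sum>j<dm \<sigma>. norm (coef f \<sigma> i j))"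
  proof (intro sum_norm_le)
    fix i j assume "i \<in> {..<dm \<sigma>}" "j \<in> {..<dm \<sigma>}"
    then show "norm (\<tau> \<sigma> x $$ (i, j) *\<^sub>C coef f \<sigma> i j) \<le> norm (coef f \<sigma> i j)"
      using mult_right_mono[OF norm_\<tau>_le[OF \<sigma>, of i j x], of "norm (coef f \<sigma> i j)"] by (simp add: norm_scaleC)
  qed
  then show ?thesis by (simp add: fourier_part_def mult_left_mono)
qed

lemma coef_fourier_part:
  fixes f :: "'g \<Rightarrow> 'a::{complex_hilbert,second_countable_topology}"
  assumes \<sigma>: "\<sigma> \<in> unitary_dual" and \<rho>: "\<rho> \<in> unitary_dual" and ij: "i < dm \<rho>" "j < dm \<rho>"
  shows "coef (fourier_part f \<sigma>) \<rho> i j = (if \<sigma> = \<rho> then coef f \<rho> i j else 0)"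
proof -
  let ?u = "\<lambda>k l x. \<tau> \<sigma> x $$ (k, l) * cnj (\<tau> \<rho> x $$ (i, j))"
  have uc: "integrable \<mu> (?u k l)" if "k < dm \<sigma>" "l < dm \<sigma>" for k l
    by (intro integrable_continuous continuous_intros \<tau>_cont \<sigma> \<rho> ij that)
  have "cnj (\<tau> \<rho> x $$ (i, j)) *\<^sub>C fourier_part f \<sigma> x =
      (\<Sum>k<dm \<sigma>. \<Sum>l<dm \<sigma>. real (dm \<sigma>) *\<^sub>R (?u k l x *\<^sub>C coef f \<sigma> k l))" for x
    unfolding fourier_part_def
    by (simp add: scaleC_scaleR_right bounded_bilinear.sum_right[OF bounded_bilinear_scaleC]
        scaleC_scaleC scaleR_sum_right mult.commute)
  then have "coef (fourier_part f \<sigma>) \<rho> i j =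
      (\<integral>x. (\<Sum>k<dm \<sigma>. \<Sum>l<dm \<sigma>. real (dm \<sigma>) *\<^sub>R (?u k l x *\<^sub>C coef f \<sigma> k l)) \<partial>\<mu>)"
    by (simp add: coef_def)
  also have "\<dots> = (\<Sum>k<dm \<sigma>. \<integral>x. (\<Sum>l<dm \<sigma>. real (dm \<sigma>) *\<^sub>R (?u k l x *\<^sub>C coef f \<sigma> k l)) \<partial>\<mu>)"
    by (intro Bochner_Integration.integral_sum integrable_continuous continuous_intros \<tau>_cont \<sigma> \<rho> ij) auto
  also have "\<dots> = (\<Sum>k<dm \<sigma>. \<Sum>l<dm \<sigma>. \<integral>x. real (dm \<sigma>) *\<^sub>R (?u k l x *\<^sub>C coef f \<sigma> k l) \<partial>\<mu>)"
    by (intro sum.cong refl Bochner_Integration.integral_sum integrable_continuous continuous_intros \<tau>_cont \<sigma> \<rho> ij) auto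
  also have "\<dots> = (\<Sum>k<dm \<sigma>. \<Sum>l<dm \<sigma>. real (dm \<sigma>) *\<^sub>R ((\<integral>x. ?u k l x \<partial>\<mu>) *\<^sub>C coef f \<sigma> k l))"
    by (intro sum.cong refl) (simp add: integral_scaleC_const uc)
  also have "\<dots> = (\<Sum>k<dm \<sigma>. \<Sum>l<dm \<sigma>. if \<sigma> = \<rho> \<and> k = i \<and> l = j then coef f \<rho> i j else 0)"
  proof (intro sum.cong refl)
    fix k l assume "k \<in> {..<dm \<sigma>}" "l \<in> {..<dm \<sigma>}"
    then have kl: "k < dm \<sigma>" "l < dm \<sigma>" by auto
    have z: "0 *\<^sub>C a = (0 :: 'a)" "1 *\<^sub>C a = a" for a
      using scaleR_scaleC[of 0 a] scaleR_scaleC[of 1 a] by simp_all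
    have "dm \<rho> > 0" using ij by simp
    then show "real (dm \<sigma>) *\<^sub>R ((\<integral>x. ?u k l x \<partial>\<mu>) *\<^sub>C coef f \<sigma> k l) =
        (if \<sigma> = \<rho> \<and> k = i \<and> l = j then coef f \<rho> i j else 0)"
      using z
      by (auto simp: \<tau>_orthogonality[OF \<sigma> \<rho> kl ij] scaleR_scaleC scaleC_scaleC)
  qed
  also have "\<dots> = (if \<sigma> = \<rho> then coef f \<rho> i j else 0)"
  proof (cases "\<sigma> = \<rho>")
    case True
    have "(\<Sum>l<dm \<sigma>. if \<sigma> = \<rho> \<and> k = i \<and> l = j then coef f \<rho> i j else 0) = (if k = i then coef f \<rho> i j else 0)" for k
      using True ij by (cases "k = i") auto
    then show ?thesis using True ij by simp
  qed simp
  finally show ?thesis .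
qed

text \<open>Every irreducible representation is unitarily conjugate to some
  \<open>\<tau> \<sigma>\<close>, so its entries are linear combinations of entries of
  \<open>\<tau> \<sigma>\<close>.\<close>

lemma AE_zero_if_coef_zero:
  fixes h :: "'g \<Rightarrow> 'a::{complex_hilbert,second_countable_topology}"
  assumes h: "L2 h" and z: "\<And>\<sigma> i j. \<sigma> \<in> unitary_dual \<Longrightarrow> i < dm \<sigma> \<Longrightarrow> j < dm \<sigma> \<Longrightarrow> coef h \<sigma> i j = 0"
  shows "AE x in \<mu>. h x = 0"
proof (rule orth_irreps_AE_zero_vector[OF h])
  fix d i j :: nat and \<pi> :: "'g matrep" assume \<pi>: "irreducible_rep d \<pi>" and ij: "i < d" "j < d"
  obtain \<sigma> where \<sigma>: "\<sigma> \<in> unitary_dual" and eqv: "(\<tau> \<sigma>, \<pi>) \<in> unitary_equiv"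
    by (rule irrep_equiv_\<tau>[OF \<pi>])
  obtain d' U where U: "irreducible_rep d' (\<tau> \<sigma>)" "irreducible_rep d' \<pi>" "unitary_mat d' U"
    "\<And>x. U * \<tau> \<sigma> x = \<pi> x * U"
    using unitary_equivE[OF eqv] by blast
  have dd: "d' = d" using rep_dim_irreducible[OF U(2)] rep_dim_irreducible[OF \<pi>] by simp
  have dm: "dm \<sigma> = d" using rep_dim_irreducible[OF U(1)] rep_dim_irreducible[OF \<tau>_irreducible[OF \<sigma>]] dd by simp
  note c = unitary_matD[OF U(3), unfolded dd] and cp = irreducible_repD(7)[OF \<pi>] and ct = irreducible_repD(7)[OF U(1), unfolded dd]
  have "\<pi> x = U * \<tau> \<sigma> x * mat_adjoint U" for x
    unfolding U(4) using assoc_mult_mat[OF cp c(1,2), of x] right_mult_one_mat[OF cp, of x] c(4) by simp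
  then have "\<pi> x $$ (i, j) = (\<Sum>l<d. (\<Sum>k<d. U $$ (i, k) * \<tau> \<sigma> x $$ (k, l)) * mat_adjoint U $$ (l, j))" for x
    using mult_mat_index[OF mult_carrier_mat[OF c(1) ct] c(2) ij] mult_mat_index[OF c(1) ct ij(1)]
    by (simp del: index_mult_mat)
  then have eq: "cnj (\<pi> x $$ (i, j)) *\<^sub>C h x =
      (\<Sum>l<d. \<Sum>k<d. (cnj (U $$ (i, k)) * cnj (mat_adjoint U $$ (l, j))) *\<^sub>C (cnj (\<tau> \<sigma> x $$ (k, l)) *\<^sub>C h x))" for x
    by (simp add: bounded_bilinear.sum_left[OF bounded_bilinear_scaleC] scaleC_scaleC sum_distrib_left mult_ac
        del: mat_adjoint_index)
  have int: "integrable \<mu> (\<lambda>x. cnj (\<tau> \<sigma> x $$ (k, l)) *\<^sub>C h x)" if "k < d" "l < d" for k l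
    using that dm by (intro scaleC_integrable continuous_intros \<tau>_cont \<sigma> L2_integrable h) auto
  have int': "integrable \<mu> (\<lambda>x. a *\<^sub>C (cnj (\<tau> \<sigma> x $$ (k, l)) *\<^sub>C h x))" if "k < d" "l < d" for k l a
    by (rule integrable_bounded_linear[OF bounded_bilinear.bounded_linear_right[OF bounded_bilinear_scaleC] int[OF that]])
  have z0: "a *\<^sub>C 0 = (0 :: 'a)" for a
    by (rule bounded_bilinear.zero_right[OF bounded_bilinear_scaleC])
  have "(\<integral>x. cnj (\<pi> x $$ (i, j)) *\<^sub>C h x \<partial>\<mu>) =
      (\<Sum>l<d. \<integral>x. (\<Sum>k<d. (cnj (U $$ (i, k)) * cnj (mat_adjoint U $$ (l, j))) *\<^sub>C (cnj (\<tau> \<sigma> x $$ (k, l)) *\<^sub>C h x)) \<partial>\<mu>)"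
    unfolding eq by (intro Bochner_Integration.integral_sum Bochner_Integration.integrable_sum int') auto
  also have "\<dots> =
      (\<Sum>l<d. \<Sum>k<d. \<integral>x. (cnj (U $$ (i, k)) * cnj (mat_adjoint U $$ (l, j))) *\<^sub>C (cnj (\<tau> \<sigma> x $$ (k, l)) *\<^sub>C h x) \<partial>\<mu>)"
    by (intro sum.cong refl Bochner_Integration.integral_sum int') auto
  also have "\<dots> = (\<Sum>l<d. \<Sum>k<d. (cnj (U $$ (i, k)) * cnj (mat_adjoint U $$ (l, j))) *\<^sub>C coef h \<sigma> k l)"
    by (intro sum.cong refl) (simp add: integral_const_scaleC int coef_def)
  also have "\<dots> = 0" using z[OF \<sigma>] dm by (simp add: z0)
  finally show "(\<integral>x. cnj (\<pi> x $$ (i, j)) *\<^sub>C h x \<partial>\<mu>) = 0" .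
qed

end

section \<open>Approximation by matrix coefficients\<close>

context haar_compact
begin

lemma L2_inner_diff_right:
  assumes "L2 F" "L2 a" "L2 b"
  shows "L2_inner F (\<lambda>x. a x - b x) = L2_inner F a - L2_inner F b"
  unfolding L2_inner_def bounded_bilinear.diff_right[OF bounded_bilinear_rinner]
  by (intro Bochner_Integration.integral_diff rinner_integrable assms)

lemma L2_inner_scaleR_right: "L2_inner F (\<lambda>x. r *\<^sub>R a x) = r * L2_inner F a"
  by (simp add: L2_inner_def rinner_scaleR_right)

lemma L2_sum: "(\<And>i. i \<in> I \<Longrightarrow> L2 (a i)) \<Longrightarrow> L2 (\<lambda>x. \<Sum>i\<in>I. a i x)"
proof (induction I rule: infinite_finite_induct)
  case (insert i I)
  then show ?case by (simp add: L2_add)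
qed (auto simp: L2_def)

lemma L2_inner_sum_right:
  assumes "L2 F" "\<And>i. i \<in> I \<Longrightarrow> L2 (a i)"
  shows "L2_inner F (\<lambda>x. \<Sum>i\<in>I. a i x) = (\<Sum>i\<in>I. L2_inner F (a i))"
  unfolding L2_inner_def bounded_bilinear.sum_right[OF bounded_bilinear_rinner]
  by (intro Bochner_Integration.integral_sum rinner_integrable assms)

lemma L2_norm_square_diff:
  assumes "L2 F" "L2 a"
  shows "(\<integral>x. (norm (F x - a x))\<^sup>2 \<partial>\<mu>) = (\<integral>x. (norm (F x))\<^sup>2 \<partial>\<mu>) - 2 * L2_inner F a + (\<integral>x. (norm (a x))\<^sup>2 \<partial>\<mu>)"
  unfolding norm_diff_square L2_inner_def
  using assms rinner_integrable[OF assms] by (simp add: L2_def)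

lemma abs_L2_inner_le:
  assumes F: "L2 F" and a: "L2 a" and le: "AE x in \<mu>. norm (a x) \<le> e"
  shows "\<bar>L2_inner F a\<bar> \<le> (\<integral>x. norm (F x) \<partial>\<mu>) * e"
proof -
  have "\<bar>L2_inner F a\<bar> \<le> (\<integral>x. norm (rinner (F x) (a x)) \<partial>\<mu>)"
    unfolding L2_inner_def real_norm_def[symmetric] by simp
  also have "\<dots> \<le> (\<integral>x. norm (F x) * e \<partial>\<mu>)"
  proof (rule integral_mono_AE)
    show "integrable \<mu> (\<lambda>x. norm (rinner (F x) (a x)))"
      using rinner_integrable[OF F a] by (rule integrable_norm)
    show "integrable \<mu> (\<lambda>x. norm (F x) * e)" using L2_integrable[OF F] by simp
    show "AE x in \<mu>. norm (rinner (F x) (a x)) \<le> norm (F x) * e"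
      using le
    proof eventually_elim
      case (elim x)
      have "norm (rinner (F x) (a x)) \<le> norm (F x) * norm (a x)" by (simp add: abs_rinner_le)
      also have "\<dots> \<le> norm (F x) * e" using elim by (intro mult_left_mono) auto
      finally show ?case .
    qed
  qed
  finally show ?thesis by simp
qed

end

section \<open>Absolutely convergent Fourier series\<close>

context haar_dual
begin

lemma coef_diff:
  assumes "integrable \<mu> a" "integrable \<mu> b" "\<sigma> \<in> unitary_dual" "i < dm \<sigma>" "j < dm \<sigma>"
  shows "coef (\<lambda>x. a x - b x) \<sigma> i j = coef a \<sigma> i j - coef b \<sigma> i j"
  unfolding coef_def bounded_bilinear.diff_right[OF bounded_bilinear_scaleC]
  by (intro Bochner_Integration.integral_diff scaleC_integrable continuous_intros \<tau>_cont assms)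

lemma coef_sum:
  assumes "\<And>k. k \<in> I \<Longrightarrow> integrable \<mu> (a k)" "\<sigma> \<in> unitary_dual" "i < dm \<sigma>" "j < dm \<sigma>"
  shows "coef (\<lambda>x. \<Sum>k\<in>I. a k x) \<sigma> i j = (\<Sum>k\<in>I. coef (a k) \<sigma> i j)"
  unfolding coef_def bounded_bilinear.sum_right[OF bounded_bilinear_scaleC]
  by (intro Bochner_Integration.integral_sum scaleC_integrable continuous_intros \<tau>_cont assms)

lemma norm_coef_le:
  assumes le: "\<And>x. norm (a x) \<le> B" and \<sigma>: "\<sigma> \<in> unitary_dual" "i < dm \<sigma>" "j < dm \<sigma>"
  shows "norm (coef a \<sigma> i j) \<le> B"
  unfolding coef_def
proof (rule norm_integral_bound)
  fix x
  have "norm (cnj (\<tau> \<sigma> x $$ (i, j)) *\<^sub>C a x) \<le> norm (a x)"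
    using mult_right_mono[OF norm_\<tau>_le[OF \<sigma>, of x], of "norm (a x)"] by (simp add: norm_scaleC)
  then show "norm (cnj (\<tau> \<sigma> x $$ (i, j)) *\<^sub>C a x) \<le> B" using le[of x] by simp
qed

text \<open>The Barron term without its weight. It dominates
  \<open>norm (fourier_part f \<sigma> x)\<close> for all \<open>x\<close>, as needed for the
  Weierstrass test.\<close>

definition coef_size where
  "coef_size f \<sigma> = real (dm \<sigma>) * (\<Sum>i<dm \<sigma>. \<Sum>j<dm \<sigma>. norm (coef f \<sigma> i j))"

lemma coef_size_nonneg: "coef_size f \<sigma> \<ge> 0"
  by (simp add: coef_size_def sum_nonneg)

text \<open>The series converges uniformly to some \<open>g0\<close> within the stated tail bound.
  Coefficients are continuous for the uniform norm, so \<open>g0\<close> has those of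
  \<open>f\<close>, and completeness identifies the two almost everywhere.\<close>

lemma fourier_series_AE:
  assumes f: "L2 f" and sm: "coef_size f summable_on unitary_dual"
    and S: "finite S" "S \<subseteq> unitary_dual"
  shows "AE x in \<mu>. norm (f x - (\<Sum>\<sigma>\<in>S. fourier_part f \<sigma> x)) \<le>
    infsum (coef_size f) unitary_dual - sum (coef_size f) S"
proof -
  let ?A = "unitary_dual :: 'g matrep set set"
  define G where "G = fourier_part f"
  define m where "m = coef_size f"
  define t where "t S = infsum m ?A - sum m S" for S
  have m0: "m \<sigma> \<ge> 0" for \<sigma> by (simp add: m_def coef_size_nonneg)
  have Gm: "norm (G \<sigma> x) \<le> m \<sigma>" if "\<sigma> \<in> ?A" for \<sigma> x
    unfolding G_def m_def coef_size_def by (rule norm_fourier_part_le[OF that])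
  have Gc: "continuous_on UNIV (G \<sigma>)" if "\<sigma> \<in> ?A" for \<sigma>
    unfolding G_def by (rule continuous_fourier_part[OF that])
  have ms: "m summable_on ?A" using sm by (simp add: m_def)
  define g0 where "g0 x = infsum (\<lambda>\<sigma>. G \<sigma> x) ?A" for x
  have lim: "((\<lambda>S. \<Sum>\<sigma>\<in>S. G \<sigma> x) \<longlongrightarrow> g0 x) (finite_subsets_at_top ?A)" for x
  proof -
    have "(\<lambda>\<sigma>. norm (G \<sigma> x)) summable_on ?A"
      by (rule summable_on_comparison_test[OF ms]) (use Gm in auto)
    then have "(\<lambda>\<sigma>. G \<sigma> x) summable_on ?A" by (rule abs_summable_summable)
    then have "((\<lambda>\<sigma>. G \<sigma> x) has_sum g0 x) ?A" by (simp add: g0_def has_sum_infsum)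
    then show ?thesis by (simp add: has_sum_def)
  qed
  have tail: "norm (g0 x - (\<Sum>\<sigma>\<in>S. G \<sigma> x)) \<le> t S" if S: "finite S" "S \<subseteq> ?A" for x S
  proof (rule tendsto_upperbound)
    show "((\<lambda>T. norm ((\<Sum>\<sigma>\<in>T. G \<sigma> x) - (\<Sum>\<sigma>\<in>S. G \<sigma> x))) \<longlongrightarrow> norm (g0 x - (\<Sum>\<sigma>\<in>S. G \<sigma> x)))
        (finite_subsets_at_top ?A)"
      by (intro tendsto_intros lim)
    have "norm ((\<Sum>\<sigma>\<in>T. G \<sigma> x) - (\<Sum>\<sigma>\<in>S. G \<sigma> x)) \<le> t S" if T: "finite T" "S \<subseteq> T" "T \<subseteq> ?A" for T
    proof -
      have "(\<Sum>\<sigma>\<in>T. G \<sigma> x) - (\<Sum>\<sigma>\<in>S. G \<sigma> x) = (\<Sum>\<sigma>\<in>T - S. G \<sigma> x)"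
        using T by (simp add: sum_diff)
      also have "norm \<dots> \<le> (\<Sum>\<sigma>\<in>T - S. m \<sigma>)" using T Gm by (intro sum_norm_le) auto
      also have "\<dots> = sum m T - sum m S" using T by (simp add: sum_diff)
      also have "\<dots> \<le> t S"
        unfolding t_def using finite_sum_le_infsum[OF ms T(1,3)] m0 by simp
      finally show ?thesis .
    qed
    then show "\<forall>\<^sub>F T in finite_subsets_at_top ?A. norm ((\<Sum>\<sigma>\<in>T. G \<sigma> x) - (\<Sum>\<sigma>\<in>S. G \<sigma> x)) \<le> t S"
      unfolding eventually_finite_subsets_at_top using S by (intro exI[of _ S]) simp
  qed (rule finite_subsets_at_top_neq_bot)
  have small: "\<exists>S. finite S \<and> S \<subseteq> ?A \<and> \<rho> \<subseteq> S \<and> t S < e" if e: "e > 0" and \<rho>: "finite \<rho>" "\<rho> \<subseteq> ?A" for e \<rho>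
  proof -
    have "(sum m \<longlongrightarrow> infsum m ?A) (finite_subsets_at_top ?A)"
      using has_sum_infsum[OF ms] by (simp add: has_sum_def)
    then have "\<forall>\<^sub>F S in finite_subsets_at_top ?A. dist (sum m S) (infsum m ?A) < e"
      using e by (rule tendstoD)
    then obtain X where X: "finite X" "X \<subseteq> ?A"
      "\<forall>Y. finite Y \<and> X \<subseteq> Y \<and> Y \<subseteq> ?A \<longrightarrow> dist (sum m Y) (infsum m ?A) < e"
      unfolding eventually_finite_subsets_at_top by (elim exE conjE)
    have "dist (sum m (X \<union> \<rho>)) (infsum m ?A) < e" using X(1,2) \<rho> by (intro X(3)[rule_format]) auto
    then have "t (X \<union> \<rho>) < e" by (simp add: t_def dist_real_def abs_less_iff)
    then show ?thesis using X \<rho> by (intro exI[of _ "X \<union> \<rho>"]) auto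
  qed
  have "\<exists>S. finite S \<and> S \<subseteq> ?A \<and> t S < inverse (real (Suc n))" for n
    using small[of "inverse (real (Suc n))" "{}"] by auto
  \<comment> \<open>A limit along all finite subsets need not preserve measurability; this sequence
    exhibits \<open>g0\<close> as a sequential limit of continuous functions.\<close>
  then obtain Sn where Sn: "\<And>n. finite (Sn n)" "\<And>n. Sn n \<subseteq> ?A" "\<And>n. t (Sn n) < inverse (real (Suc n))"
    by metis
  have g0m: "g0 \<in> borel_measurable \<mu>"
  proof (rule borel_measurable_LIMSEQ_metric)
    show "(\<lambda>x. \<Sum>\<sigma>\<in>Sn n. G \<sigma> x) \<in> borel_measurable \<mu>" for n
      using Gc Sn(2)[of n] by (intro continuous_borel_measurable continuous_intros) auto
    show "(\<lambda>n. \<Sum>\<sigma>\<in>Sn n. G \<sigma> x) \<longlonglongrightarrow> g0 x" for x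
    proof (rule Lim_null[THEN iffD2], rule Lim_null_comparison[OF _ LIMSEQ_inverse_real_of_nat])
      have "norm ((\<Sum>\<sigma>\<in>Sn n. G \<sigma> x) - g0 x) \<le> inverse (real (Suc n))" for n
        using tail[OF Sn(1,2), of x n] Sn(3)[of n] by (simp add: norm_minus_commute)
      then show "\<forall>\<^sub>F n in sequentially. norm ((\<Sum>\<sigma>\<in>Sn n. G \<sigma> x) - g0 x) \<le> inverse (real (Suc n))"
        by simp
    qed
  qed
  have g0: "L2 g0"
    using tail[of "{}"] by (intro L2_bounded[OF g0m, of "t {}"]) auto
  have GL2: "L2 (G \<sigma>)" if "\<sigma> \<in> ?A" for \<sigma> by (rule L2_continuous[OF Gc[OF that]])
  have "AE x in \<mu>. f x - g0 x = 0"
  proof (rule AE_zero_if_coef_zero[OF L2_diff[OF f g0]])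
    fix \<rho> i j assume \<rho>: "\<rho> \<in> ?A" "i < dm \<rho>" "j < dm \<rho>"
    have "norm (coef g0 \<rho> i j - coef f \<rho> i j) \<le> e" if e: "e > 0" for e
    proof -
      obtain S where S: "finite S" "S \<subseteq> ?A" "\<rho> \<in> S" "t S < e" using small[OF e, of "{\<rho>}"] \<rho> by auto
      have GS: "integrable \<mu> (G \<sigma>)" if "\<sigma> \<in> S" for \<sigma> using that S GL2 by (blast intro: L2_integrable)
      have "coef (\<lambda>x. \<Sum>\<sigma>\<in>S. G \<sigma> x) \<rho> i j = (\<Sum>\<sigma>\<in>S. coef (G \<sigma>) \<rho> i j)"
        by (rule coef_sum[OF GS \<rho>])
      also have "\<dots> = (\<Sum>\<sigma>\<in>S. if \<sigma> = \<rho> then coef f \<rho> i j else 0)"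
        unfolding G_def using S(2) by (intro sum.cong refl coef_fourier_part \<rho>) auto
      also have "\<dots> = coef f \<rho> i j" using S by simp
      finally have "coef g0 \<rho> i j - coef f \<rho> i j = coef (\<lambda>x. g0 x - (\<Sum>\<sigma>\<in>S. G \<sigma> x)) \<rho> i j"
        using coef_diff[OF L2_integrable[OF g0] Bochner_Integration.integrable_sum[of S, OF GS] \<rho>] by simp
      also have "norm \<dots> \<le> t S" by (rule norm_coef_le[OF tail[OF S(1,2)] \<rho>])
      finally show ?thesis using S(4) by simp
    qed
    then have "norm (coef g0 \<rho> i j - coef f \<rho> i j) \<le> 0"
      using field_le_epsilon[of "norm (coef g0 \<rho> i j - coef f \<rho> i j)" 0] by simp
    then show "coef (\<lambda>x. f x - g0 x) \<rho> i j = 0"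
      by (simp add: coef_diff[OF L2_integrable[OF f] L2_integrable[OF g0] \<rho>])
  qed
  then show ?thesis
  proof eventually_elim
    case (elim x)
    then show ?case using tail[OF S, of x] by (simp add: G_def m_def t_def)
  qed
qed

text \<open>Tails are small in sup norm off a null set and \<open>F\<close> is integrable, so
  pairing with \<open>F\<close> acts term by term.\<close>

lemma fourier_series_inner:
  assumes f: "L2 f" and sm: "coef_size f summable_on unitary_dual" and F: "L2 F"
  shows "((\<lambda>\<sigma>. L2_inner F (fourier_part f \<sigma>)) has_sum L2_inner F f) unitary_dual"
  unfolding has_sum_def tendsto_iff
proof (intro allI impI)
  fix e :: real assume e: "e > 0"
  let ?A = "unitary_dual :: 'g matrep set set"
  define c where "c = (\<integral>x. norm (F x) \<partial>\<mu>)"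
  have c: "c \<ge> 0" by (simp add: c_def)
  define t where "t S = infsum (coef_size f) ?A - sum (coef_size f) S" for S
  have "(sum (coef_size f) \<longlongrightarrow> infsum (coef_size f) ?A) (finite_subsets_at_top ?A)"
    using has_sum_infsum[OF sm] by (simp add: has_sum_def)
  moreover have "e / (c + 1) > 0" using e c by simp
  ultimately have "\<forall>\<^sub>F S in finite_subsets_at_top ?A. dist (sum (coef_size f) S) (infsum (coef_size f) ?A) < e / (c + 1)"
    by (rule tendstoD)
  moreover have "\<forall>\<^sub>F S in finite_subsets_at_top ?A. finite S \<and> S \<subseteq> ?A"
    by (simp add: eventually_finite_subsets_at_top_weakI)
  ultimately show "\<forall>\<^sub>F S in finite_subsets_at_top ?A. dist (\<Sum>\<sigma>\<in>S. L2_inner F (fourier_part f \<sigma>)) (L2_inner F f) < e"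
  proof eventually_elim
    case (elim S)
    have GL2: "L2 (fourier_part f \<sigma>)" if "\<sigma> \<in> S" for \<sigma>
      using elim that by (intro L2_continuous continuous_fourier_part) auto
    have "L2_inner F f - (\<Sum>\<sigma>\<in>S. L2_inner F (fourier_part f \<sigma>)) =
        L2_inner F (\<lambda>x. f x - (\<Sum>\<sigma>\<in>S. fourier_part f \<sigma> x))"
      by (simp add: L2_inner_diff_right F f L2_sum GL2 L2_inner_sum_right)
    also have "\<bar>\<dots>\<bar> \<le> c * t S"
      unfolding c_def t_def using elim
      by (intro abs_L2_inner_le F L2_diff f L2_sum GL2 fourier_series_AE sm) auto
    also have "\<dots> \<le> c * (e / (c + 1))"
      using elim c by (intro mult_left_mono) (auto simp: t_def dist_real_def)
    also have "\<dots> < e" using e c by (simp add: field_simps)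
    finally show ?case by (simp add: dist_real_def abs_minus_commute)
  qed
qed

section \<open>Atoms and their greedy selection\<close>

definition atom :: "'g matrep set \<times> nat \<times> nat \<times> 'a \<Rightarrow> 'g \<Rightarrow> 'a::{complex_hilbert,second_countable_topology}" where
  "atom = (\<lambda>(\<sigma>, i, j, e) x. \<tau> \<sigma> x $$ (i, j) *\<^sub>C e)"

definition valid_index :: "'g matrep set \<times> nat \<times> nat \<times> 'a::{complex_hilbert,second_countable_topology} \<Rightarrow> bool" where
  "valid_index = (\<lambda>(\<sigma>, i, j, e). \<sigma> \<in> unitary_dual \<and> i < dm \<sigma> \<and> j < dm \<sigma> \<and> norm e = 1)"

lemma L2_atom: "valid_index q \<Longrightarrow> L2 (atom q)"
  by (cases q) (auto simp: valid_index_def atom_def intro!: L2_continuous continuous_intros \<tau>_cont)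

lemma norm_atom_le: "valid_index q \<Longrightarrow> norm (atom q x) \<le> 1"
  by (cases q) (auto simp: valid_index_def atom_def norm_scaleC norm_\<tau>_le)

text \<open>The normalized coefficients are a probability distribution on the atoms with barycentre
  \<open>f\<close>, so some atom pairs with \<open>F\<close> at least as well as \<open>f\<close> does.\<close>

lemma good_atom:
  fixes f F :: "'g \<Rightarrow> 'a::{complex_hilbert,second_countable_topology}"
  assumes f: "L2 f" and F: "L2 F" and w: "\<And>\<sigma>. w \<sigma> \<ge> 1"
    and M: "((\<lambda>\<sigma>. w \<sigma> * coef_size f \<sigma>) has_sum M) unitary_dual" "M > 0"
  obtains q where "valid_index q" "L2_inner F f \<le> M / w (fst q) * L2_inner F (atom q)"
proof (rule ccontr)
  let ?A = "unitary_dual :: 'g matrep set set"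
  note pick = that
  assume "\<not> thesis"
  then have less: "M / w (fst q) * L2_inner F (atom q) < L2_inner F f" if "valid_index q" for q
    using pick[OF that] by (meson not_le)
  define \<Phi> where "\<Phi> = L2_inner F f"
  have sm: "coef_size f summable_on ?A"
  proof (rule summable_on_comparison_test)
    show "(\<lambda>\<sigma>. w \<sigma> * coef_size f \<sigma>) summable_on ?A" using M(1) by (auto simp: summable_on_def)
    show "coef_size f \<sigma> \<le> w \<sigma> * coef_size f \<sigma>" for \<sigma>
      using mult_right_mono[OF w[of \<sigma>] coef_size_nonneg[of f \<sigma>]] by simp
  qed (rule coef_size_nonneg)
  have aL2: "L2 (\<lambda>x. \<tau> \<sigma> x $$ (i, j) *\<^sub>C c)" if "\<sigma> \<in> ?A" "i < dm \<sigma>" "j < dm \<sigma>" for \<sigma> i j and c :: 'a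
    by (intro L2_continuous continuous_intros \<tau>_cont that)
  \<comment> \<open>The assumed failure for the atom with unit vector \<open>c / norm c\<close>,
    rescaled by \<open>norm c\<close>. For \<open>c = 0\<close> both sides vanish and strictness is
    lost.\<close>
  have one: "L2_inner F (\<lambda>x. \<tau> \<sigma> x $$ (i, j) *\<^sub>C c) < \<Phi> / M * (w \<sigma> * norm c)"
    if ij: "\<sigma> \<in> ?A" "i < dm \<sigma>" "j < dm \<sigma>" and c: "c \<noteq> 0" for \<sigma> i j c
  proof -
    define e where "e = (1 / norm c) *\<^sub>R c"
    have e: "norm e = 1" "c = norm c *\<^sub>R e" using c by (auto simp: e_def)
    have v: "valid_index (\<sigma>, i, j, e)" using ij e by (simp add: valid_index_def)
    have "(\<lambda>x. \<tau> \<sigma> x $$ (i, j) *\<^sub>C c) = (\<lambda>x. norm c *\<^sub>R atom (\<sigma>, i, j, e) x)"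
      using e(2) by (simp add: atom_def scaleC_scaleR_right[symmetric] fun_eq_iff)
    then have "L2_inner F (\<lambda>x. \<tau> \<sigma> x $$ (i, j) *\<^sub>C c) = norm c * L2_inner F (atom (\<sigma>, i, j, e))"
      by (simp add: L2_inner_scaleR_right)
    also have "\<dots> < norm c * (\<Phi> / M * w \<sigma>)"
    proof (rule mult_strict_left_mono)
      have "M / w \<sigma> * L2_inner F (atom (\<sigma>, i, j, e)) < \<Phi>" using less[OF v] by (simp add: \<Phi>_def)
      then show "L2_inner F (atom (\<sigma>, i, j, e)) < \<Phi> / M * w \<sigma>"
        using M(2) w[of \<sigma>] by (simp add: field_simps)
    qed (use c in simp)
    finally show ?thesis by (simp add: mult_ac)
  qed
  have zero: "L2_inner F (\<lambda>x. \<tau> \<sigma> x $$ (i, j) *\<^sub>C (0::'a)) = 0" for \<sigma> i j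
    by (simp add: L2_inner_def bounded_bilinear.zero_right[OF bounded_bilinear_scaleC]
        bounded_bilinear.zero_right[OF bounded_bilinear_rinner])
  have le: "L2_inner F (\<lambda>x. \<tau> \<sigma> x $$ (i, j) *\<^sub>C c) \<le> \<Phi> / M * (w \<sigma> * norm c)"
    if ij: "\<sigma> \<in> ?A" "i < dm \<sigma>" "j < dm \<sigma>" for \<sigma> i j c
    using one[OF ij, of c] zero by (cases "c = 0") (auto intro: less_imp_le)
  have part: "L2_inner F (fourier_part f \<sigma>) =
      real (dm \<sigma>) * (\<Sum>i<dm \<sigma>. \<Sum>j<dm \<sigma>. L2_inner F (\<lambda>x. \<tau> \<sigma> x $$ (i, j) *\<^sub>C coef f \<sigma> i j))"
    if \<sigma>: "\<sigma> \<in> ?A" for \<sigma>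
  proof -
    have "L2_inner F (\<lambda>x. \<Sum>i<dm \<sigma>. \<Sum>j<dm \<sigma>. \<tau> \<sigma> x $$ (i, j) *\<^sub>C coef f \<sigma> i j) =
        (\<Sum>i<dm \<sigma>. L2_inner F (\<lambda>x. \<Sum>j<dm \<sigma>. \<tau> \<sigma> x $$ (i, j) *\<^sub>C coef f \<sigma> i j))"
      by (intro L2_inner_sum_right F L2_sum aL2 \<sigma>) auto
    also have "\<dots> = (\<Sum>i<dm \<sigma>. \<Sum>j<dm \<sigma>. L2_inner F (\<lambda>x. \<tau> \<sigma> x $$ (i, j) *\<^sub>C coef f \<sigma> i j))"
      by (intro sum.cong refl L2_inner_sum_right F aL2 \<sigma>) auto
    finally show ?thesis unfolding fourier_part_def[abs_def] L2_inner_scaleR_right by simp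
  qed
  have rhs: "\<Phi> / M * (w \<sigma> * coef_size f \<sigma>) =
      real (dm \<sigma>) * (\<Sum>i<dm \<sigma>. \<Sum>j<dm \<sigma>. \<Phi> / M * (w \<sigma> * norm (coef f \<sigma> i j)))" for \<sigma>
    by (simp add: coef_size_def sum_distrib_left mult_ac)
  \<comment> \<open>\<open>M > 0\<close> provides a nonzero coefficient, so one summand is strictly
    smaller and summation over the dual gives \<open>\<Phi> < \<Phi>\<close>.\<close>
  have "\<exists>\<sigma>\<in>?A. w \<sigma> * coef_size f \<sigma> \<noteq> 0"
  proof (rule ccontr)
    assume "\<not> (\<exists>\<sigma>\<in>?A. w \<sigma> * coef_size f \<sigma> \<noteq> 0)"
    then have "((\<lambda>\<sigma>. w \<sigma> * coef_size f \<sigma>) has_sum 0) ?A" by (intro has_sum_0) blast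
    then show False using has_sum_unique[OF M(1)] M(2) by simp
  qed
  then obtain \<sigma>0 where \<sigma>0: "\<sigma>0 \<in> ?A" "coef_size f \<sigma>0 \<noteq> 0" by auto
  then have d0: "dm \<sigma>0 > 0" by (auto simp: coef_size_def intro: gr0I)
  have "(\<Sum>i<dm \<sigma>0. \<Sum>j<dm \<sigma>0. norm (coef f \<sigma>0 i j)) \<noteq> 0" using \<sigma>0(2) by (simp add: coef_size_def)
  then obtain i where i: "i < dm \<sigma>0" "(\<Sum>j<dm \<sigma>0. norm (coef f \<sigma>0 i j)) \<noteq> 0"
    by (meson lessThan_iff sum.not_neutral_contains_not_neutral)
  then obtain j where j: "j < dm \<sigma>0" "coef f \<sigma>0 i j \<noteq> 0"
    by (metis lessThan_iff norm_zero sum.not_neutral_contains_not_neutral)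
  have "L2_inner F (fourier_part f \<sigma>0) < \<Phi> / M * (w \<sigma>0 * coef_size f \<sigma>0)"
    unfolding part[OF \<sigma>0(1)] rhs
  proof (rule mult_strict_left_mono)
    let ?L = "\<lambda>i. \<Sum>j<dm \<sigma>0. L2_inner F (\<lambda>x. \<tau> \<sigma>0 x $$ (i, j) *\<^sub>C coef f \<sigma>0 i j)"
    let ?R = "\<lambda>i. \<Sum>j<dm \<sigma>0. \<Phi> / M * (w \<sigma>0 * norm (coef f \<sigma>0 i j))"
    show "sum ?L {..<dm \<sigma>0} < sum ?R {..<dm \<sigma>0}"
    proof (rule sum_strict_mono_ex1)
      have "?L i < ?R i"
        using i j one[OF \<sigma>0(1) i(1) j] le[OF \<sigma>0(1) i(1)]
        by (intro sum_strict_mono_ex1) auto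
      then show "\<exists>i\<in>{..<dm \<sigma>0}. ?L i < ?R i"
        using i(1) by blast
      show "\<forall>i\<in>{..<dm \<sigma>0}. ?L i \<le> ?R i"
        by (intro ballI sum_mono le[OF \<sigma>0(1)]) auto
    qed simp
  qed (use d0 in simp)
  moreover have "L2_inner F (fourier_part f \<sigma>) \<le> \<Phi> / M * (w \<sigma> * coef_size f \<sigma>)" if \<sigma>: "\<sigma> \<in> ?A" for \<sigma>
    unfolding part[OF \<sigma>] rhs using le[OF \<sigma>] by (intro mult_left_mono sum_mono) auto
  moreover have "((\<lambda>\<sigma>. \<Phi> / M * (w \<sigma> * coef_size f \<sigma>)) has_sum \<Phi> / M * M) ?A"
    by (intro has_sum_cmult_right M)
  ultimately have "L2_inner F f < \<Phi> / M * M"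
    using has_sum_strict_mono[OF fourier_series_inner[OF f sm F], of "\<lambda>\<sigma>. \<Phi> / M * (w \<sigma> * coef_size f \<sigma>)" "\<Phi> / M * M" \<sigma>0] \<sigma>0(1)
    by blast
  then show False using M(2) by (simp add: \<Phi>_def)
qed

text \<open>The approximation error multiplied by \<open>n\<close>, so that the induction adds one
  copy of \<open>f\<close> and subtracts one atom per step.\<close>

definition residual where
  "residual f M w q n x = real n *\<^sub>R f x - (\<Sum>l=1..n. (M / w (fst (q l))) *\<^sub>R atom (q l) x)"

text \<open>Maurey's argument, derandomized: choosing the atoms greedily increases
  \<open>\<parallel>n f - (X\<^sub>1 + \<dots> + X\<^sub>n)\<parallel>\<^sup>2\<close> by at most \<open>M\<^sup>2\<close> in each step.\<close>

lemma greedy_atoms: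
  assumes f: "L2 f" and w: "\<And>\<sigma>. w \<sigma> \<ge> 1"
    and M: "((\<lambda>\<sigma>. w \<sigma> * coef_size f \<sigma>) has_sum M) unitary_dual" "M > 0"
  shows "\<exists>q. (\<forall>l\<in>{1..n}. valid_index (q l)) \<and>
    (\<integral>x. (norm (residual f M w q n x))\<^sup>2 \<partial>\<mu>) \<le> real n * M\<^sup>2"
proof (induction n)
  case 0
  show ?case by (simp add: residual_def)
next
  case (Suc n)
  then obtain q where q: "\<And>l. l \<in> {1..n} \<Longrightarrow> valid_index (q l)"
    and le: "(\<integral>x. (norm (residual f M w q n x))\<^sup>2 \<partial>\<mu>) \<le> real n * M\<^sup>2"
    by blast
  define R where "R = residual f M w q n"
  have R: "L2 R" unfolding R_def residual_def[abs_def] by (intro L2_diff L2_sum L2_scaleR f L2_atom q)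
  \<comment> \<open>The part of the next residual already fixed before the new atom is subtracted;
    the atom is chosen to pair well with it.\<close>
  define F where "F = (\<lambda>x. R x + f x)"
  have F: "L2 F" unfolding F_def by (intro L2_add R f)
  obtain p where p: "valid_index p" "L2_inner F f \<le> M / w (fst p) * L2_inner F (atom p)"
    by (rule good_atom[OF f F w M])
  define X where "X = (\<lambda>x. (M / w (fst p)) *\<^sub>R atom p x)"
  have X: "L2 X" unfolding X_def by (intro L2_scaleR L2_atom p)
  have Xle: "norm (X x) \<le> M" for x
  proof -
    have "M / w (fst p) \<le> M" using w[of "fst p"] M(2) by (simp add: field_simps)
    moreover have "0 \<le> M / w (fst p)" using w[of "fst p"] M(2) by simp
    ultimately have "\<bar>M / w (fst p)\<bar> * norm (atom p x) \<le> M * 1"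
      using norm_atom_le[OF p(1), of x] M(2) by (intro mult_mono) auto
    then show ?thesis by (simp add: X_def)
  qed
  have "(\<integral>x. (norm (X x))\<^sup>2 \<partial>\<mu>) \<le> norm (\<integral>x. (norm (X x))\<^sup>2 \<partial>\<mu>)" by simp
  also have "\<dots> \<le> M\<^sup>2"
    by (rule norm_integral_bound) (use Xle in \<open>auto intro: power_mono\<close>)
  finally have X2: "(\<integral>x. (norm (X x))\<^sup>2 \<partial>\<mu>) \<le> M\<^sup>2" .
  have FX: "L2_inner F f \<le> L2_inner F X" using p(2) by (simp add: X_def L2_inner_scaleR_right)
  have "(\<integral>x. (norm (F x - X x))\<^sup>2 \<partial>\<mu>) \<le> (\<integral>x. (norm (F x))\<^sup>2 \<partial>\<mu>) - 2 * L2_inner F f + M\<^sup>2"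
    unfolding L2_norm_square_diff[OF F X] using FX X2 by simp
  \<comment> \<open>Completes the square and drops the nonnegative squared norm of \<open>f\<close>;
    what remains, \<open>F - f\<close>, is the previous residual.\<close>
  also have "\<dots> \<le> (\<integral>x. (norm (F x - f x))\<^sup>2 \<partial>\<mu>) + M\<^sup>2"
    unfolding L2_norm_square_diff[OF F f] by simp
  also have "\<dots> \<le> real n * M\<^sup>2 + M\<^sup>2" using le by (simp add: F_def R_def)
  finally have step: "(\<integral>x. (norm (F x - X x))\<^sup>2 \<partial>\<mu>) \<le> real (Suc n) * M\<^sup>2" by (simp add: algebra_simps)
  define q' where "q' = q(Suc n := p)"
  have "(\<Sum>l=1..n. (M / w (fst (q' l))) *\<^sub>R atom (q' l) x) = (\<Sum>l=1..n. (M / w (fst (q l))) *\<^sub>R atom (q l) x)" for x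
    by (intro sum.cong) (auto simp: q'_def)
  then have "F x - X x = residual f M w q' (Suc n) x" for x
    by (simp add: F_def R_def residual_def X_def q'_def algebra_simps)
  moreover have "valid_index (q' l)" if "l \<in> {1..Suc n}" for l
    using q[of l] p(1) that by (cases "l = Suc n") (auto simp: q'_def)
  ultimately show ?case using step by (intro exI[of _ q']) simp
qed

lemma AE_zero_if_norm_zero:
  assumes f: "L2 f" and w: "\<And>\<sigma>. w \<sigma> \<ge> 1"
    and M: "((\<lambda>\<sigma>. w \<sigma> * coef_size f \<sigma>) has_sum 0) unitary_dual"
  shows "AE x in \<mu>. f x = 0"
proof (rule AE_zero_if_coef_zero[OF f])
  fix \<sigma> i j assume \<sigma>: "\<sigma> \<in> (unitary_dual :: 'g matrep set set)" "i < dm \<sigma>" "j < dm \<sigma>"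
  have nn: "0 \<le> w \<sigma> * coef_size f \<sigma>" for \<sigma>
    by (rule mult_nonneg_nonneg[OF order.trans[OF zero_le_one w] coef_size_nonneg])
  have "w \<sigma> * coef_size f \<sigma> \<le> 0"
    using has_sum_mono_neutral[OF has_sum_finite[of "{\<sigma>}" "\<lambda>\<sigma>. w \<sigma> * coef_size f \<sigma>"] M] \<sigma>(1) nn by simp
  then have "coef_size f \<sigma> = 0"
    using w[of \<sigma>] coef_size_nonneg[of f \<sigma>] by (simp add: mult_le_0_iff)
  then have "(\<Sum>i<dm \<sigma>. \<Sum>j<dm \<sigma>. norm (coef f \<sigma> i j)) = 0" using \<sigma>(2) by (auto simp: coef_size_def)
  then show "coef f \<sigma> i j = 0"
    using \<sigma>(2,3) by (simp add: sum_nonneg_eq_0_iff sum_nonneg)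
qed

end

theorem theorem4p1:
  fixes \<mu> :: "'g::{topological_group_add,t2_space} measure"
    and rp :: "'g matrep set \<Rightarrow> 'g matrep"
    and \<xi> :: "'g matrep set \<Rightarrow> nat \<Rightarrow> complex Matrix.vec"
    and \<gamma> :: "'g matrep set \<Rightarrow> real"
    and s M :: real
    and f :: "'g \<Rightarrow> 'a::{complex_hilbert,second_countable_topology}"
    and n :: nat
  assumes "compact (UNIV :: 'g set)"
    and "normalized_haar_measure \<mu>"
    and "dual_choice rp \<xi>"
    and "\<exists>a::'a. a \<noteq> 0"
    and "s \<ge> 0"
    and "\<And>\<sigma>. \<sigma> \<in> unitary_dual \<Longrightarrow> \<gamma> \<sigma> > 0"
    and "\<gamma> \<in> borel_measurable (count_space unitary_dual)"
    and "f \<in> barron_space \<mu> rp \<xi> \<gamma> s"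
    and "M = barron_norm \<mu> rp \<xi> \<gamma> s f"
    and "n \<ge> 1"
  shows "\<exists>(\<sigma> :: nat \<Rightarrow> 'g matrep set) (i :: nat \<Rightarrow> nat) (j :: nat \<Rightarrow> nat) (e :: nat \<Rightarrow> 'a).
    (\<forall>l\<in>{1..n}. \<sigma> l \<in> unitary_dual \<and>
       i l \<in> {1..rep_dim (rp (\<sigma> l))} \<and> j l \<in> {1..rep_dim (rp (\<sigma> l))} \<and> norm (e l) = 1) \<and>
    Lp_norm 2 \<mu> (\<lambda>x. f x -
      (M / real n) *\<^sub>R (\<Sum>l=1..n.
         (complex_of_real ((1 + (\<gamma> (\<sigma> l))\<^sup>2) powr (- s / 2)) *
          matrix_coeff (rp (\<sigma> l)) (\<xi> (\<sigma> l)) (i l) (j l) x) *\<^sub>C e l))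
    \<le> M / sqrt (real n)"
proof -
  interpret haar_dual \<mu> rp \<xi> by unfold_locales (use assms in auto)
  define w where "w \<sigma> = (1 + (\<gamma> \<sigma>)\<^sup>2) powr (s / 2)" for \<sigma>
  \<comment> \<open>Here \<open>s \<ge> 0\<close> enters. Weights at least 1 make the unweighted
    coefficient sizes summable and bound each scaled atom by \<open>M\<close>.\<close>
  have w1: "w \<sigma> \<ge> 1" for \<sigma> unfolding w_def using assms(5) by (intro ge_one_powr_ge_zero) auto
  have winv: "(1 + (\<gamma> \<sigma>)\<^sup>2) powr (- s / 2) = 1 / w \<sigma>" for \<sigma>
    by (simp add: w_def powr_minus_divide)
  have f: "L2 f" and sb: "barron_term \<mu> rp \<xi> \<gamma> s f summable_on unitary_dual"
    using assms(8) by (auto simp: barron_space_def Lp_space_def L2_def)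
  have term_eq: "barron_term \<mu> rp \<xi> \<gamma> s f \<sigma> = w \<sigma> * coef_size f \<sigma>" if "\<sigma> \<in> unitary_dual" for \<sigma>
    unfolding barron_term_eq[OF that] coef_size_def w_def by simp
  have hs: "((\<lambda>\<sigma>. w \<sigma> * coef_size f \<sigma>) has_sum M) unitary_dual"
    using has_sum_infsum[OF sb] unfolding assms(9) barron_norm_def
    by (subst has_sum_cong[OF term_eq, symmetric])
  have wc: "w \<sigma> * coef_size f \<sigma> \<ge> 0" for \<sigma>
    by (rule mult_nonneg_nonneg[OF order.trans[OF zero_le_one w1] coef_size_nonneg])
  have M0: "M \<ge> 0" by (rule has_sum_nonneg[OF hs wc])
  have Lp: "Lp_norm 2 \<mu> h = sqrt (\<integral>x. (norm (h x))\<^sup>2 \<partial>\<mu>)" for h :: "'g \<Rightarrow> 'a"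
    by (simp add: Lp_norm_def powr_half_sqrt)
  show ?thesis
  \<comment> \<open>If \<open>M = 0\<close>, then \<open>f\<close> vanishes almost everywhere and
    the approximant is 0 for any choice of indices; a unit vector exists because \<open>A\<close> is
    nontrivial.\<close>
  proof (cases "M = 0")
    case True
    have "AE x in \<mu>. f x = 0" using AE_zero_if_norm_zero[OF f w1] hs True by simp
    then have "(\<integral>x. (norm (f x))\<^sup>2 \<partial>\<mu>) = 0" by (intro integral_eq_zero_AE) auto
    then have z: "Lp_norm 2 \<mu> f = 0" by (simp add: Lp)
    obtain \<sigma> where \<sigma>: "\<sigma> \<in> (unitary_dual :: 'g matrep set set)" using unitary_dual_nonempty by blast
    have d: "dm \<sigma> \<ge> 1" using irreducible_repD(2)[OF rp_irreducible(2)[OF \<sigma>]] by simp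
    obtain a :: 'a where "a \<noteq> 0" using assms(4) by blast
    then have "norm ((1 / norm a) *\<^sub>R a) = 1" by simp
    then show ?thesis
      using \<sigma> d z True
      by (intro exI[of _ "\<lambda>_. \<sigma>"] exI[of _ "\<lambda>_. 1"] exI[of _ "\<lambda>_. (1 / norm a) *\<^sub>R a"]) simp
  next
    case False
    then have Mpos: "M > 0" using M0 by simp
    obtain q where q: "\<And>l. l \<in> {1..n} \<Longrightarrow> valid_index (q l)"
      and le: "(\<integral>x. (norm (residual f M w q n x))\<^sup>2 \<partial>\<mu>) \<le> real n * M\<^sup>2"
      using greedy_atoms[OF f w1 hs Mpos, of n] by blast
    define \<sigma> where "\<sigma> l = fst (q l)" for l
    define i where "i l = fst (snd (q l))" for l
    define j where "j l = fst (snd (snd (q l)))" for l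
    define e where "e l = snd (snd (snd (q l)))" for l
    have v: "\<sigma> l \<in> unitary_dual" "i l < dm (\<sigma> l)" "j l < dm (\<sigma> l)" "norm (e l) = 1" if "l \<in> {1..n}" for l
      using q[OF that] by (auto simp: valid_index_def \<sigma>_def i_def j_def e_def split: prod.splits)
    \<comment> \<open>The \<open>Suc\<close> translates matrix indices counted from 0 into basis
      indices counted from 1.\<close>
    define Y where "Y l x = (complex_of_real ((1 + (\<gamma> (\<sigma> l))\<^sup>2) powr (- s / 2)) *
          matrix_coeff (rp (\<sigma> l)) (\<xi> (\<sigma> l)) (Suc (i l)) (Suc (j l)) x) *\<^sub>C e l" for l x
    have Y: "M *\<^sub>R Y l x = (M / w (fst (q l))) *\<^sub>R atom (q l) x" if l: "l \<in> {1..n}" for l x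
    proof -
      have "atom (q l) x = \<tau> (\<sigma> l) x $$ (i l, j l) *\<^sub>C e l"
        by (simp add: atom_def \<sigma>_def i_def j_def e_def split: prod.splits)
      then have "Y l x = (1 / w (\<sigma> l)) *\<^sub>R atom (q l) x"
        unfolding Y_def winv \<tau>_index[OF v(1-3)[OF l], symmetric] by (simp add: scaleR_scaleC scaleC_scaleC)
      then show ?thesis by (simp add: \<sigma>_def)
    qed
    have n: "real n > 0" using assms(10) by simp
    have "f x - (M / real n) *\<^sub>R (\<Sum>l=1..n. Y l x) =
        (1 / real n) *\<^sub>R residual f M w q n x" for x
    proof -
      have "(\<Sum>l=1..n. (M / w (fst (q l))) *\<^sub>R atom (q l) x) = M *\<^sub>R (\<Sum>l=1..n. Y l x)"
        unfolding scaleR_sum_right by (intro sum.cong refl Y[symmetric]) auto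
      then show ?thesis using n by (simp add: residual_def scaleR_diff_right)
    qed
    then have "Lp_norm 2 \<mu> (\<lambda>x. f x - (M / real n) *\<^sub>R (\<Sum>l=1..n. Y l x)) =
        sqrt ((1 / real n)\<^sup>2 * (\<integral>x. (norm (residual f M w q n x))\<^sup>2 \<partial>\<mu>))"
      by (simp add: Lp power_mult_distrib power_divide)
    also have "\<dots> \<le> sqrt ((1 / real n)\<^sup>2 * (real n * M\<^sup>2))"
      using le by (intro real_sqrt_le_mono mult_left_mono) auto
    also have "(1 / real n)\<^sup>2 * (real n * M\<^sup>2) = M\<^sup>2 / real n"
      using n by (simp add: power2_eq_square)
    also have "sqrt (M\<^sup>2 / real n) = M / sqrt (real n)"
      using Mpos by (simp add: real_sqrt_divide)
    finally have "Lp_norm 2 \<mu> (\<lambda>x. f x - (M / real n) *\<^sub>R (\<Sum>l=1..n. Y l x)) \<le> M / sqrt (real n)" .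
    moreover have "\<forall>l\<in>{1..n}. \<sigma> l \<in> unitary_dual \<and> Suc (i l) \<in> {1..dm (\<sigma> l)} \<and> Suc (j l) \<in> {1..dm (\<sigma> l)} \<and> norm (e l) = 1"
    proof
      fix l assume l: "l \<in> {1..n}"
      show "\<sigma> l \<in> unitary_dual \<and> Suc (i l) \<in> {1..dm (\<sigma> l)} \<and> Suc (j l) \<in> {1..dm (\<sigma> l)} \<and> norm (e l) = 1"
        using v[OF l] by auto
    qed
    ultimately show ?thesis
      unfolding Y_def
      by (intro exI[of _ \<sigma>] exI[of _ "\<lambda>l. Suc (i l)"] exI[of _ "\<lambda>l. Suc (j l)"] exI[of _ e]) blast
  qed
qed

end
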